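(* Let $\mathcal{Z}$ be a linear order equal to $\mathbb{Z}^{\alpha}$ or $\mathbb{Q}.\mathbb{Z}^{\alpha}$ for some countable ordinal $\alpha \ge 1$, or to $\mathbb{Q}.2$. Then there are $2^{\aleph_0}$ pairwise non-isomorphic countable connected $3$-$CS$-homogeneous $2$-level partial orders $M$ such that the interval $I^+(M)$ of $M$ has order-type $1 + \mathcal{Z} + 1$.
   Context: $\mathbb Z^\alpha$ is the set of functions $\alpha\to\mathbb Z$ with finite support, ordered lexicographically ($f<g$ iff $f(\beta)<g(\beta)$ at the greatest $\beta$ where they differ). $A.B$ denotes the lexicographic product "$A$ copies of $B$"; $2$ is the $2$-element chain; $1+\mathcal Z+1$ is $\mathcal Z$ with a least and a greatest point added. A $2$-level partial order is one all of whose maximal chains have exactly two elements; it is connected if its comparability graph is connected. $M$ is $3$-$CS$-homogeneous if every isomorphism between connected $3$-element (induced) substructures of $M$ extends to an automorphism of $M$. An ideal of a poset $M$ is a non-empty bounded above $J\subseteq M$ equal to the set of lower bounds of its set of upper bounds; the Dedekind–MacNeille completion $M^D$ is the set of ideals ordered by inclusion, with $a\in M$ identified with $\{x\in M:x\le a\}$. $\mathrm{Ram}(M)\subseteq M^D$ is the set of points of the form $a\wedge b$ or $a\vee b$ (computed in $M^D$) with $a,b\in M$ incomparable; $M^+=M\cup\mathrm{Ram}(M)$. $I^+(M)$ is the common isomorphism type of the intervals $\{z\in M^+:x\le z\le y\}$ for $x$ minimal and $y$ maximal in $M$, $x<y$. *)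

theory Defs
  imports
    Main
    HOL.Rat
    HOL.Zorn
    "HOL-Library.Equipollence"
    "HOL-Library.Extended"
begin

text \<open>
  Orders are reflexive relations in the style of \<^theory>\<open>HOL.Order_Relation\<close>; the carrier of an
  order \<open>r\<close> is \<open>Field r\<close>, and \<open>Under r A\<close>, \<open>Above r A\<close> are the sets of lower and of upper bounds
  of \<open>A\<close>. Equality of order types is existence of an isomorphism.
\<close>

definition order_iso :: "('a \<Rightarrow> 'b) \<Rightarrow> 'a rel \<Rightarrow> 'b rel \<Rightarrow> bool" where
  "order_iso f r s \<longleftrightarrow>
     bij_betw f (Field r) (Field s) \<and>
     (\<forall>x\<in>Field r. \<forall>y\<in>Field r. (x, y) \<in> r \<longleftrightarrow> (f x, f y) \<in> s)"

definition order_isomorphic :: "'a rel \<Rightarrow> 'b rel \<Rightarrow> bool"  (infix "\<cong>\<^sub>o" 50) where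
  "r \<cong>\<^sub>o s \<longleftrightarrow> (\<exists>f. order_iso f r s)"

text \<open>An ordinal \<open>\<alpha>\<close> is given by a well-order; functions on it are extended by 0 to the whole type.\<close>

definition int_power_carrier :: "'a rel \<Rightarrow> ('a \<Rightarrow> int) set" where
  "int_power_carrier \<alpha> = {f. {\<beta>. f \<beta> \<noteq> 0} \<subseteq> Field \<alpha> \<and> finite {\<beta>. f \<beta> \<noteq> 0}}"

definition int_power_less :: "'a rel \<Rightarrow> ('a \<Rightarrow> int) \<Rightarrow> ('a \<Rightarrow> int) \<Rightarrow> bool" where
  "int_power_less \<alpha> f g \<longleftrightarrow>
     (\<exists>\<beta>. f \<beta> \<noteq> g \<beta> \<and> (\<forall>\<gamma>. f \<gamma> \<noteq> g \<gamma> \<longrightarrow> (\<gamma>, \<beta>) \<in> \<alpha>) \<and> f \<beta> < g \<beta>)"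

definition int_power :: "'a rel \<Rightarrow> ('a \<Rightarrow> int) rel" where
  "int_power \<alpha> = relation_of (\<lambda>f g. f = g \<or> int_power_less \<alpha> f g) (int_power_carrier \<alpha>)"

text \<open>\<open>A\<close> copies of \<open>B\<close>: the first component is the more significant one.\<close>

definition lex_product :: "'a rel \<Rightarrow> 'b rel \<Rightarrow> ('a \<times> 'b) rel" where
  "lex_product A B = Restr ((A - Id) <*lex*> B) (Field A \<times> Field B)"

definition rat_order :: "rat rel" where
  "rat_order = relation_of (\<le>) UNIV"

definition two_chain :: "bool rel" where
  "two_chain = relation_of (\<le>) UNIV"

definition add_endpoints :: "'a rel \<Rightarrow> 'a extended rel" where
  "add_endpoints r =
     (let S = insert Minf (insert Pinf (Fin ` Field r))
      in map_prod Fin Fin ` r \<union> {Minf} \<times> S \<union> S \<times> {Pinf})"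

definition two_level :: "'a rel \<Rightarrow> bool" where
  "two_level M \<longleftrightarrow> Partial_order M \<and>
     (\<forall>C. pred_on.maxchain (Field M) (\<lambda>x y. (x, y) \<in> M) C \<longrightarrow> card C = 2)"

definition connected_order :: "'a rel \<Rightarrow> bool" where
  "connected_order M \<longleftrightarrow> (\<forall>x\<in>Field M. \<forall>y\<in>Field M. (x, y) \<in> (M \<union> M\<inverse>)\<^sup>*)"

definition CS_homogeneous :: "nat \<Rightarrow> 'a rel \<Rightarrow> bool" where
  "CS_homogeneous k M \<longleftrightarrow>
     (\<forall>A B f. A \<subseteq> Field M \<and> B \<subseteq> Field M \<and> finite A \<and> finite B \<and> card A = k \<and> card B = k \<and>
        connected_order (Restr M A) \<and> connected_order (Restr M B) \<and>
        order_iso f (Restr M A) (Restr M B) \<longrightarrow>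
        (\<exists>g. order_iso g M M \<and> (\<forall>x\<in>A. g x = f x)))"

definition ideals :: "'a rel \<Rightarrow> 'a set set" where
  "ideals M = {J. J \<subseteq> Field M \<and> J \<noteq> {} \<and> Above M J \<noteq> {} \<and> J = Under M (Above M J)}"

definition completion :: "'a rel \<Rightarrow> 'a set rel" where
  "completion M = relation_of (\<subseteq>) (ideals M)"

definition is_glb :: "'a rel \<Rightarrow> 'a set \<Rightarrow> 'a \<Rightarrow> bool" where
  "is_glb r A p \<longleftrightarrow> p \<in> Under r A \<and> (\<forall>q\<in>Under r A. (q, p) \<in> r)"

definition is_lub :: "'a rel \<Rightarrow> 'a set \<Rightarrow> 'a \<Rightarrow> bool" where
  "is_lub r A p \<longleftrightarrow> p \<in> Above r A \<and> (\<forall>q\<in>Above r A. (p, q) \<in> r)"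

text \<open>\<open>a \<in> M\<close> is identified with the principal ideal \<open>under M a\<close>.\<close>

definition Ram :: "'a rel \<Rightarrow> 'a set set" where
  "Ram M = {p. \<exists>a\<in>Field M. \<exists>b\<in>Field M. (a, b) \<notin> M \<and> (b, a) \<notin> M \<and>
     (is_glb (completion M) {under M a, under M b} p \<or>
      is_lub (completion M) {under M a, under M b} p)}"

definition plus_extension :: "'a rel \<Rightarrow> 'a set rel" where
  "plus_extension M = Restr (completion M) (under M ` Field M \<union> Ram M)"

definition minimal_in :: "'a rel \<Rightarrow> 'a \<Rightarrow> bool" where
  "minimal_in M x \<longleftrightarrow> x \<in> Field M \<and> (\<forall>z. (z, x) \<in> M \<longrightarrow> z = x)"

definition maximal_in :: "'a rel \<Rightarrow> 'a \<Rightarrow> bool" where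
  "maximal_in M y \<longleftrightarrow> y \<in> Field M \<and> (\<forall>z. (y, z) \<in> M \<longrightarrow> z = y)"

definition plus_interval :: "'a rel \<Rightarrow> 'a \<Rightarrow> 'a \<Rightarrow> 'a set rel" where
  "plus_interval M x y =
     Restr (plus_extension M)
       {z. (under M x, z) \<in> plus_extension M \<and> (z, under M y) \<in> plus_extension M}"

text \<open>
  The common isomorphism type of the intervals exists and is that of \<open>L\<close>. Every two-level order
  has a minimal element lying strictly below a maximal one, so for these the condition is never
  vacuous.
\<close>

definition has_interval_type :: "'a rel \<Rightarrow> 'b rel \<Rightarrow> bool" where
  "has_interval_type M L \<longleftrightarrow>
     (\<forall>x y. minimal_in M x \<and> maximal_in M y \<and> x \<noteq> y \<and> (x, y) \<in> M \<longrightarrow>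
        plus_interval M x y \<cong>\<^sub>o L)"

end

theory Submission
  imports Defs "HOL-Analysis.Abstract_Topology_2"
begin

text \<open>
  Let \<open>C\<close> be the set of points of \<open>Z\<close> with an immediate successor and let \<open>F\<close> be a countable field of
  real numbers. Let \<open>V\<close> and \<open>W\<close> consist of the finitely supported functions to \<open>F\<close> on \<open>C\<close> and on
  \<open>T = {(e, f). e \<le> f}\<close>, respectively. The order attached to \<open>F\<close> has a copy of \<open>V \<times> W\<close> as its
  minimal points \<open>(x, y)\<close> and another one as its maximal points \<open>(m, k)\<close>, and \<open>(x, y) < (m, k)\<close> iff
  \<open>y (e, f) + k (e, f) = m e * x f\<close> for all \<open>(e, f) \<in> T\<close>.

  If \<open>a, a' < b\<close> and \<open>a < b'\<close>, then \<open>a' < b'\<close> iff all indices at which the \<open>V\<close>-coordinates of \<open>a\<close>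
  and \<open>a'\<close> differ lie strictly below all those at which \<open>b\<close> and \<open>b'\<close> differ. Hence the elements of
  \<open>M\<^sup>+\<close> strictly between \<open>a\<close> and \<open>b\<close> correspond to the cuts of \<open>C\<close> that are given by the points of
  \<open>Z\<close>. Translations, triangular substitutions, scalings and the automorphisms of \<open>Z\<close> act
  transitively on the connected three-element substructures of either shape.

  For fixed \<open>e\<close> the coordinates at \<open>e\<close> and \<open>(e, e)\<close> describe the points and the non-vertical lines
  of the affine plane over \<open>F\<close>, and an isomorphism maps this plane into the plane of the other field
  at some level \<open>e'\<close>. Coordinatisation yields a field homomorphism, and among real fields closed
  under square roots the only homomorphisms are inclusions. There are continuum many such countable
  fields because every real number lies in one of them.
\<close>

subsection \<open>Order isomorphisms\<close>

text \<open>The intervals depend on \<open>Z\<close> only, so the invariant that separates the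
  orders comes from the incidences within a single level, where \<open>y + k = m * x\<close> is the
  line equation over \<open>F\<close>. Elements of \<open>C\<close> are the levels at which points
  separate. Maximal points separating at \<open>e\<close> have their meet at level \<open>e\<close>;
  minimal points separating at \<open>e\<close> have their join just above \<open>e\<close>. So
  every point of \<open>Z\<close> is required to be in \<open>C\<close> or directly above a point of
  \<open>C\<close>, and automorphisms of \<open>Z\<close> have to be transitive on \<open>C\<close>
  but not on \<open>Z\<close>. In the two cases built from integer powers all points lie in
  \<open>C\<close>; in the remaining case the lower point of each pair is a meet and the upper one a
  join. An isomorphism of the orders knows nothing about the ordering of the field elements. Closure
  under square roots makes that ordering algebraic, and this turns an abstract homomorphism into an
  inclusion.\<close>

lemma order_iso_compose:
  assumes "order_iso f r s" "order_iso g s t"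
  shows "order_iso (g \<circ> f) r t"
proof -
  have f: "bij_betw f (Field r) (Field s)" and g: "bij_betw g (Field s) (Field t)"
    using assms by (auto simp: order_iso_def)
  have "f x \<in> Field s" if "x \<in> Field r" for x
    using f that by (auto simp: bij_betw_def)
  then show ?thesis
    using assms bij_betw_trans[OF f g] by (auto simp: order_iso_def)
qed

lemma order_iso_inv_into:
  assumes "order_iso f r s"
  shows "order_iso (inv_into (Field r) f) s r"
proof -
  have f: "bij_betw f (Field r) (Field s)"
    using assms by (auto simp: order_iso_def)
  let ?g = "inv_into (Field r) f"
  have g: "bij_betw ?g (Field s) (Field r)"
    by (rule bij_betw_inv_into[OF f])
  have "?g x \<in> Field r" "f (?g x) = x" if "x \<in> Field s" for x
    using g that bij_betw_inv_into_right[OF f that] by (auto simp: bij_betw_def)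
  then show ?thesis
    using assms g unfolding order_iso_def by metis
qed

lemma order_isomorphic_sym: "r \<cong>\<^sub>o s \<Longrightarrow> s \<cong>\<^sub>o r"
  unfolding order_isomorphic_def using order_iso_inv_into by blast

lemma order_isomorphic_trans: "r \<cong>\<^sub>o s \<Longrightarrow> s \<cong>\<^sub>o t \<Longrightarrow> r \<cong>\<^sub>o t"
  unfolding order_isomorphic_def using order_iso_compose by blast

section \<open>Adjoining a least and a greatest point\<close>

lemma Field_add_endpoints: "Field (add_endpoints r) = insert Minf (insert Pinf (Fin ` Field r))"
proof -
  have "Field (map_prod Fin Fin ` r) \<subseteq> Fin ` Field r"
    by (force simp: Field_def)
  then show ?thesis
    unfolding add_endpoints_def Let_def Field_Un by (auto simp: Field_def)
qed

lemma add_endpoints_iff: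
  "(Fin x, Fin y) \<in> add_endpoints r \<longleftrightarrow> (x, y) \<in> r"
  "(Minf, p) \<in> add_endpoints r \<longleftrightarrow> p \<in> Field (add_endpoints r)"
  "(p, Pinf) \<in> add_endpoints r \<longleftrightarrow> p \<in> Field (add_endpoints r)"
  "(Fin x, Minf) \<notin> add_endpoints r"
  "(Pinf, Minf) \<notin> add_endpoints r"
  "(Pinf, Fin x) \<notin> add_endpoints r"
  unfolding Field_add_endpoints by (auto simp: add_endpoints_def Let_def)

lemma add_endpoints_cong:
  assumes "r \<cong>\<^sub>o s"
  shows "add_endpoints r \<cong>\<^sub>o add_endpoints s"
proof -
  obtain f where f: "order_iso f r s"
    using assms by (auto simp: order_isomorphic_def)
  then have b: "inj_on f (Field r)" "f ` Field r = Field s"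
    by (auto simp: order_iso_def bij_betw_def)
  have "inj_on (map_extended f) (Field (add_endpoints r))"
    unfolding Field_add_endpoints by (auto simp: inj_on_def dest: inj_onD[OF b(1)])
  moreover have "map_extended f ` Field (add_endpoints r) = Field (add_endpoints s)"
    unfolding Field_add_endpoints b(2)[symmetric] by (auto simp: image_image)
  moreover have "(p, q) \<in> add_endpoints r \<longleftrightarrow>
      (map_extended f p, map_extended f q) \<in> add_endpoints s"
    if "p \<in> Field (add_endpoints r)" "q \<in> Field (add_endpoints r)" for p q
    using that f unfolding Field_add_endpoints
    by (auto simp: add_endpoints_iff Field_add_endpoints order_iso_def b(2)[symmetric])
  ultimately show ?thesis
    unfolding order_isomorphic_def order_iso_def bij_betw_def by blast
qed

subsection \<open>Real fields closed under square roots\<close>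

text \<open>Differences produce zero, negatives and sums. Division carries no side condition, since
  \<open>x / 0 = 0\<close> and zero is a difference.\<close>

definition sqrt_closed_field :: "real set \<Rightarrow> bool" where
  "sqrt_closed_field F \<longleftrightarrow> 1 \<in> F \<and>
     (\<forall>x\<in>F. \<forall>y\<in>F. x - y \<in> F \<and> x * y \<in> F \<and> x / y \<in> F) \<and> (\<forall>x\<in>F. 0 \<le> x \<longrightarrow> sqrt x \<in> F)"

text \<open>Terms in one variable give both facts about closures at once: their values form a
  countable set, and it is closed under the operations because each operation is a
  constructor.\<close>

datatype field_term = Var | One | Sub field_term field_term | Mul field_term field_term
  | Div field_term field_term | Sqrt field_term

instance field_term :: countable
  by countable_datatype

text \<open>Division by zero and roots of negative numbers have conventional real values; such terms
  merely enlarge the closure.\<close>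

primrec term_value :: "real \<Rightarrow> field_term \<Rightarrow> real" where
  "term_value r Var = r"
| "term_value r One = 1"
| "term_value r (Sub s t) = term_value r s - term_value r t"
| "term_value r (Mul s t) = term_value r s * term_value r t"
| "term_value r (Div s t) = term_value r s / term_value r t"
| "term_value r (Sqrt s) = sqrt (term_value r s)"

definition sqrt_closure :: "real \<Rightarrow> real set" where
  "sqrt_closure r = range (term_value r)"

lemma countable_sqrt_closure: "countable (sqrt_closure r)"
  by (simp add: sqrt_closure_def)

lemma in_sqrt_closure: "r \<in> sqrt_closure r"
  using rangeI[of "term_value r" Var] by (simp add: sqrt_closure_def)

lemma sqrt_closed_field_sqrt_closure: "sqrt_closed_field (sqrt_closure r)"
proof -
  have "1 \<in> range (term_value r)"
    using rangeI[of "term_value r" One] by simp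
  then show ?thesis
    unfolding sqrt_closed_field_def sqrt_closure_def
    by (auto simp flip: term_value.simps)
qed

context
  fixes F assumes F: "sqrt_closed_field F"
begin

lemma field_one: "1 \<in> F"
  and field_diff: "x \<in> F \<Longrightarrow> y \<in> F \<Longrightarrow> x - y \<in> F"
  and field_mult: "x \<in> F \<Longrightarrow> y \<in> F \<Longrightarrow> x * y \<in> F"
  and field_divide: "x \<in> F \<Longrightarrow> y \<in> F \<Longrightarrow> x / y \<in> F"
  and field_sqrt: "x \<in> F \<Longrightarrow> 0 \<le> x \<Longrightarrow> sqrt x \<in> F"
  using F by (auto simp: sqrt_closed_field_def)

lemma field_zero: "0 \<in> F"
  using field_diff[OF field_one field_one] by simp

lemma field_minus: "x \<in> F \<Longrightarrow> - x \<in> F"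
  using field_diff[OF field_zero] by fastforce

lemma field_add: "x \<in> F \<Longrightarrow> y \<in> F \<Longrightarrow> x + y \<in> F"
  using field_diff[OF _ field_minus, of x y] by simp

lemma field_of_nat: "of_nat n \<in> F"
  by (induction n) (auto intro: field_zero field_one field_add)

lemma field_of_int: "of_int n \<in> F"
  by (cases n) (auto intro!: field_of_nat field_minus simp del: of_nat_Suc)

text \<open>Nonnegative elements are squares, so a ring homomorphism is monotone and therefore
  determined by its values on the rationals.\<close>

lemma field_hom_eq_id:
  assumes add: "\<And>x y. x \<in> F \<Longrightarrow> y \<in> F \<Longrightarrow> h (x + y) = h x + (h y :: real)"
    and mult: "\<And>x y. x \<in> F \<Longrightarrow> y \<in> F \<Longrightarrow> h (x * y) = h x * h y"
    and one: "h 1 = 1"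
    and x: "x \<in> F"
  shows "h x = x"
proof -
  have h0: "h 0 = 0"
    using add[of 0 0] field_zero by simp
  have hm: "h (- y) = - h y" if "y \<in> F" for y
    using add[OF that field_minus[OF that]] h0 by simp
  have hn: "h (of_nat n) = of_nat n" for n
    by (induction n) (auto simp: h0 add field_one field_of_nat one)
  have hi: "h (of_int n) = of_int n" for n
    by (cases n) (auto simp: hn hm field_of_nat simp del: of_nat_Suc)
  have pos: "0 \<le> h y" if "y \<in> F" "0 \<le> y" for y
    using mult[OF field_sqrt field_sqrt, of y y] that by simp
  have lin: "h (of_int a * x + of_int b) = of_int a * h x + of_int b" for a b
    using x by (simp add: add mult hi field_of_int field_mult)
  \<comment> \<open>Rationals enter with cleared denominators: comparing \<open>h x\<close> with
    \<open>a / b\<close> means comparing \<open>of_int b * h x\<close> with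
    \<open>of_int a\<close>.\<close>
  have *: "0 \<le> of_int a * h x + of_int b" if "0 \<le> of_int a * x + of_int b" for a b
    using pos[OF _ that] x by (simp add: lin field_add field_mult field_of_int)
  have "\<not> h x < x"
  proof
    assume "h x < x"
    then obtain q where q: "h x < of_rat q" "of_rat q < x"
      using of_rat_dense by blast
    obtain a b where ab: "quotient_of q = (a, b)" by force
    then have b: "b > 0" and "q = of_int a / of_int b"
      by (auto simp: quotient_of_denom_pos quotient_of_div)
    then have "of_rat q = (of_int a / of_int b :: real)"
      by (simp add: of_rat_divide)
    then have a: "of_int a = of_int b * (of_rat q :: real)"
      using b by simp
    have "of_int b * h x < of_int a" "of_int a < of_int b * x"
      unfolding a using q b by simp_all
    then show False
      using *[of b "-a"] by simp
  qed
  moreover have "\<not> x < h x"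
  proof
    assume "x < h x"
    then obtain q where q: "x < of_rat q" "of_rat q < h x"
      using of_rat_dense by blast
    obtain a b where ab: "quotient_of q = (a, b)" by force
    then have b: "b > 0" and "q = of_int a / of_int b"
      by (auto simp: quotient_of_denom_pos quotient_of_div)
    then have "of_rat q = (of_int a / of_int b :: real)"
      by (simp add: of_rat_divide)
    then have a: "of_int a = of_int b * (of_rat q :: real)"
      using b by simp
    have "of_int b * x < of_int a" "of_int a < of_int b * h x"
      unfolding a using q b by simp_all
    then show False
      using *[of "-b" a] by simp
  qed
  ultimately show ?thesis by simp
qed

end

text \<open>The map \<open>sqrt_closure\<close> is not injective, but its values are countable: a
  real is recovered from its closure and a position in an enumeration of it. So the continuum is at
  most the size of \<open>?S\<close> times that of the natural numbers, which is the size of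
  \<open>?S\<close> once \<open>?S\<close> is known to be infinite.\<close>

lemma range_sqrt_closure_eqpoll: "range sqrt_closure \<approx> (UNIV :: nat set set)"
proof -
  let ?S = "range sqrt_closure"
  have "(UNIV :: real set) \<subseteq> (\<lambda>(A, n). from_nat_into A n) ` (?S \<times> (UNIV :: nat set))"
  proof
    fix r :: real
    obtain n where "from_nat_into (sqrt_closure r) n = r"
      using from_nat_into_surj[OF countable_sqrt_closure in_sqrt_closure] by blast
    then show "r \<in> (\<lambda>(A, n). from_nat_into A n) ` (?S \<times> (UNIV :: nat set))"
      by (intro image_eqI[of _ _ "(sqrt_closure r, n)"]) auto
  qed
  then have le: "(UNIV :: real set) \<lesssim> ?S \<times> (UNIV :: nat set)"
    using lepoll_iff by blast
  have inf: "infinite ?S"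
  proof
    assume "finite ?S"
    then have "countable (?S \<times> (UNIV :: nat set))"
      by (simp add: countable_finite)
    then show False
      using countable_lepoll[OF _ le] uncountable_UNIV_real by blast
  qed
  then have "?S \<times> (UNIV :: nat set) \<approx> ?S"
    using card_of_Times_infinite[OF inf, of "UNIV :: nat set"]
      infinite_iff_card_of_nat[of ?S] by (simp add: eqpoll_iff_card_of_ordIso)
  with le have "(UNIV :: real set) \<lesssim> ?S"
    using lepoll_trans2 by blast
  moreover have "?S \<lesssim> (UNIV :: real set)"
    by (rule image_lepoll)
  ultimately have "?S \<approx> (UNIV :: real set)"
    by (simp add: lepoll_antisym)
  then show ?thesis
    using nat_sets_eqpoll_reals eqpoll_sym eqpoll_trans by blast
qed

subsection \<open>Finitely supported functions\<close>

definition finsupp :: "'i set \<Rightarrow> real set \<Rightarrow> ('i \<Rightarrow> real) set" where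
  "finsupp I F = {f. finite {i. f i \<noteq> 0} \<and> {i. f i \<noteq> 0} \<subseteq> I \<and> range f \<subseteq> F}"

lemma finsuppI:
  "finite {i. f i \<noteq> 0} \<Longrightarrow> (\<And>i. f i \<noteq> 0 \<Longrightarrow> i \<in> I) \<Longrightarrow> (\<And>i. f i \<in> F) \<Longrightarrow> f \<in> finsupp I F"
  by (auto simp: finsupp_def)

lemma finsupp_finite: "f \<in> finsupp I F \<Longrightarrow> finite {i. f i \<noteq> 0}"
  and finsupp_outside: "f \<in> finsupp I F \<Longrightarrow> i \<notin> I \<Longrightarrow> f i = 0"
  and finsupp_value: "f \<in> finsupp I F \<Longrightarrow> f i \<in> F"
  and finsupp_in: "f \<in> finsupp I F \<Longrightarrow> f i \<noteq> 0 \<Longrightarrow> i \<in> I"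
  by (auto simp: finsupp_def)

lemma finite_finsupp_diff:
  assumes "f \<in> finsupp I F" "g \<in> finsupp I F"
  shows "finite {i. f i \<noteq> 0 \<or> g i \<noteq> 0}"
  using finite_UnI[OF assms[THEN finsupp_finite]] by (simp add: Un_def)

lemma countable_finsupp:
  assumes "countable I" "countable F"
  shows "countable (finsupp I F)"
proof -
  define G where "G f = (\<lambda>i. (i, f i)) ` {i. f i \<noteq> 0}" for f :: "'a \<Rightarrow> real"
  have "inj G"
  proof
    fix f g assume eq: "G f = G g"
    have G: "(i, c) \<in> G h \<longleftrightarrow> h i = c \<and> c \<noteq> 0" for i c h
      by (auto simp: G_def)
    show "f = g"
    proof
      fix i show "f i = g i"
        using G[of i "f i" f] G[of i "f i" g] G[of i "g i" g] G[of i "g i" f] eq by metis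
    qed
  qed
  then have "inj_on G (finsupp I F)"
    by (rule inj_on_subset) simp
  moreover have "G ` finsupp I F \<subseteq> Fpow (I \<times> F)"
    by (auto simp: G_def finsupp_def Fpow_def)
  then have "countable (G ` finsupp I F)"
    by (rule countable_subset) (simp add: countable_Fpow assms)
  ultimately show ?thesis
    using countable_image_inj_on by blast
qed

context
  fixes F assumes F: "sqrt_closed_field F"
begin

lemma finsupp_zero: "(\<lambda>_. 0) \<in> finsupp I F"
  using field_zero[OF F] by (auto intro: finsuppI)

lemma finsupp_add:
  assumes "f \<in> finsupp I F" "g \<in> finsupp I F"
  shows "(\<lambda>i. f i + g i) \<in> finsupp I F"
proof (rule finsuppI)
  show "finite {i. f i + g i \<noteq> 0}"
    by (rule finite_subset[OF _ finite_finsupp_diff[OF assms]]) auto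
  show "i \<in> I" if "f i + g i \<noteq> 0" for i
    using that finsupp_outside[OF assms(1), of i] finsupp_outside[OF assms(2), of i] by (cases "i \<in> I") auto
  show "f i + g i \<in> F" for i
    using assms by (intro field_add[OF F] finsupp_value)
qed

lemma finsupp_diff:
  assumes "f \<in> finsupp I F" "g \<in> finsupp I F"
  shows "(\<lambda>i. f i - g i) \<in> finsupp I F"
proof (rule finsuppI)
  show "finite {i. f i - g i \<noteq> 0}"
    by (rule finite_subset[OF _ finite_finsupp_diff[OF assms]]) auto
  show "i \<in> I" if "f i - g i \<noteq> 0" for i
    using that finsupp_outside[OF assms(1), of i] finsupp_outside[OF assms(2), of i] by (cases "i \<in> I") auto
  show "f i - g i \<in> F" for i
    using assms by (intro field_diff[OF F] finsupp_value)
qed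

lemma finsupp_divide: "f \<in> finsupp I F \<Longrightarrow> c \<in> F \<Longrightarrow> (\<lambda>i. f i / c) \<in> finsupp I F"
  by (rule finsuppI) (auto intro: field_divide[OF F] finsupp_value dest: finsupp_outside
      intro: finite_subset[OF _ finsupp_finite])

lemma finsupp_unit: "c \<in> F \<Longrightarrow> e \<in> I \<Longrightarrow> (\<lambda>i. if i = e then c else 0) \<in> finsupp I F"
  by (rule finsuppI) (auto intro: field_zero[OF F] split: if_splits)

end

lemma linear_order_ex_greatest:
  assumes r: "Linear_order r"
  shows "finite S \<Longrightarrow> S \<noteq> {} \<Longrightarrow> S \<subseteq> Field r \<Longrightarrow> \<exists>e\<in>S. \<forall>f\<in>S. (f, e) \<in> r"
proof (induction S rule: finite_ne_induct)
  case (singleton x)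
  then show ?case
    using r by (auto simp: order_on_defs dest: refl_onD)
next
  case (insert x S)
  then obtain e where e: "e \<in> S" "\<forall>f\<in>S. (f, e) \<in> r" by auto
  have x: "(x, x) \<in> r" "x \<in> Field r" "e \<in> Field r"
    using insert.prems r e(1) by (auto simp: order_on_defs dest: refl_onD)
  then have "(x, e) \<in> r \<or> (e, x) \<in> r"
    using r unfolding order_on_defs total_on_def by metis
  moreover have "(f, x) \<in> r" if "(e, x) \<in> r" "f \<in> S" for f
    using r e(2) that unfolding order_on_defs by (meson transD)
  ultimately show ?case
    using e x(1) by blast
qed

subsection \<open>The order attached to a field\<close>

text \<open>\<open>jump e z\<close>: the elements of \<open>C\<close> below \<open>z\<close> are exactly those up to \<open>e\<close>.\<close>

locale branching_order =
  fixes Z :: "'z rel" and C :: "'z set"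
  fixes jump :: "'z \<Rightarrow> 'z \<Rightarrow> bool"
  defines "jump e z \<equiv> (e, z) \<in> Z \<and> e \<noteq> z \<and> (\<forall>f\<in>C. (f, z) \<in> Z \<and> f \<noteq> z \<longrightarrow> (f, e) \<in> Z)"
  assumes lin: "Linear_order Z"
    and C_subset: "C \<subseteq> Field Z"
    and C_nonempty: "C \<noteq> {}"
    and C_countable: "countable C"
    and between: "(z, w) \<in> Z \<Longrightarrow> z \<noteq> w \<Longrightarrow> \<exists>e\<in>C. (z, e) \<in> Z \<and> (e, w) \<in> Z \<and> e \<noteq> w"
    and jump_below: "z \<in> Field Z \<Longrightarrow> z \<in> C \<or> (\<exists>e\<in>C. jump e z)"
    and jump_above: "e \<in> C \<Longrightarrow> \<exists>z. jump e z"
    and no_least: "z \<in> Field Z \<Longrightarrow> \<exists>w. (w, z) \<in> Z \<and> w \<noteq> z"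
    and no_greatest: "z \<in> Field Z \<Longrightarrow> \<exists>w. (z, w) \<in> Z \<and> w \<noteq> z"
    and homogeneous: "e \<in> C \<Longrightarrow> f \<in> C \<Longrightarrow>
      \<exists>p. bij p \<and> (\<forall>x y. (p x, p y) \<in> Z \<longleftrightarrow> (x, y) \<in> Z) \<and> (\<forall>x. p x \<in> C \<longleftrightarrow> x \<in> C) \<and> p e = f"
begin

lemma le_refl: "z \<in> Field Z \<Longrightarrow> (z, z) \<in> Z"
  and le_trans: "(z, w) \<in> Z \<Longrightarrow> (w, v) \<in> Z \<Longrightarrow> (z, v) \<in> Z"
  and le_antisym: "(z, w) \<in> Z \<Longrightarrow> (w, z) \<in> Z \<Longrightarrow> z = w"
  and le_total: "z \<in> Field Z \<Longrightarrow> w \<in> Field Z \<Longrightarrow> z \<noteq> w \<Longrightarrow> (z, w) \<in> Z \<or> (w, z) \<in> Z"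
  using lin unfolding linear_order_on_def partial_order_on_def preorder_on_def
  by (auto dest: refl_onD transD antisymD simp: total_on_def)

lemma C_Field: "e \<in> C \<Longrightarrow> e \<in> Field Z"
  using C_subset by blast

lemma ex_greatest: "finite S \<Longrightarrow> S \<noteq> {} \<Longrightarrow> S \<subseteq> Field Z \<Longrightarrow> \<exists>e\<in>S. \<forall>f\<in>S. (f, e) \<in> Z"
  using linear_order_ex_greatest[OF lin] .

lemma ex_least: "finite S \<Longrightarrow> S \<noteq> {} \<Longrightarrow> S \<subseteq> Field Z \<Longrightarrow> \<exists>e\<in>S. \<forall>f\<in>S. (e, f) \<in> Z"
  using linear_order_ex_greatest[of "Z\<inverse>" S] lin by simp

text \<open>Conditions are imposed only at pairs \<open>e \<le> f\<close>; a product
  \<open>m e * x f\<close> with \<open>f < e\<close> is left free. This asymmetry makes the order of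
  \<open>Z\<close> visible in \<open>square\<close>.\<close>

definition T :: "('z \<times> 'z) set" where
  "T = {(e, f). e \<in> C \<and> f \<in> C \<and> (e, f) \<in> Z}"

lemma T_iff: "(e, f) \<in> T \<longleftrightarrow> e \<in> C \<and> f \<in> C \<and> (e, f) \<in> Z"
  by (simp add: T_def)

lemma notin_T_iff: "e \<in> C \<Longrightarrow> f \<in> C \<Longrightarrow> (e, f) \<notin> T \<longleftrightarrow> (f, e) \<in> Z \<and> f \<noteq> e"
  using le_total[of e f] le_refl[of e] le_antisym C_Field by (auto simp: T_iff)

lemma countable_T: "countable T"
  by (rule countable_subset[of _ "C \<times> C"]) (auto simp: T_def C_countable)

text \<open>For two maximal points above a common point this index is the level at which they
  separate; for two minimal points below a common point that role falls to the greatest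
  difference.\<close>

lemma finsupp_least_diff:
  assumes "x \<in> finsupp C F" "y \<in> finsupp C F" "x \<noteq> y"
  obtains e where "e \<in> C" "x e \<noteq> y e" "\<And>f. x f \<noteq> y f \<Longrightarrow> (e, f) \<in> Z"
proof -
  let ?S = "{f. x f \<noteq> y f}"
  have "finite ?S"
    by (rule finite_subset[OF _ finite_finsupp_diff[OF assms(1,2)]]) auto
  moreover have "?S \<subseteq> C"
    using finsupp_in[OF assms(1)] finsupp_in[OF assms(2)] by force
  moreover have "?S \<noteq> {}" using assms(3) by auto
  ultimately obtain e where "e \<in> ?S" "\<forall>f\<in>?S. (e, f) \<in> Z" "e \<in> C"
    using ex_least[of ?S] C_subset by (meson subset_iff)
  then show ?thesis
    by (intro that[of e]) auto
qed

lemma finsupp_greatest_diff: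
  assumes "x \<in> finsupp C F" "y \<in> finsupp C F" "x \<noteq> y"
  obtains e where "e \<in> C" "x e \<noteq> y e" "\<And>f. x f \<noteq> y f \<Longrightarrow> (f, e) \<in> Z"
proof -
  let ?S = "{f. x f \<noteq> y f}"
  have "finite ?S"
    by (rule finite_subset[OF _ finite_finsupp_diff[OF assms(1,2)]]) auto
  moreover have "?S \<subseteq> C"
    using finsupp_in[OF assms(1)] finsupp_in[OF assms(2)] by force
  moreover have "?S \<noteq> {}" using assms(3) by auto
  ultimately obtain e where "e \<in> ?S" "\<forall>f\<in>?S. (f, e) \<in> Z" "e \<in> C"
    using ex_greatest[of ?S] C_subset by (meson subset_iff)
  then show ?thesis
    by (intro that[of e]) auto
qed

end

text \<open>\<open>L\<close> and \<open>U\<close> are the minimal and the maximal points; \<open>lo\<close> and \<open>up\<close> encode their coordinates,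
  \<open>X\<close> and \<open>Y\<close> recover them.\<close>

locale bilinear_order = branching_order Z C jump
  for Z :: "'z rel" and C jump +
  fixes F :: "real set"
    and lo up :: "('z \<Rightarrow> real) \<Rightarrow> ('z \<times> 'z \<Rightarrow> real) \<Rightarrow> 'p"
    and X :: "'p \<Rightarrow> 'z \<Rightarrow> real" and Y :: "'p \<Rightarrow> 'z \<times> 'z \<Rightarrow> real"
    and V W L U
  defines "V \<equiv> finsupp C F" and "W \<equiv> finsupp T F"
    and "L \<equiv> {lo x y |x y. x \<in> V \<and> y \<in> W}" and "U \<equiv> {up x y |x y. x \<in> V \<and> y \<in> W}"
  assumes F: "sqrt_closed_field F"
    and coord: "x \<in> V \<Longrightarrow> y \<in> W \<Longrightarrow>
      X (lo x y) = x \<and> Y (lo x y) = y \<and> X (up x y) = x \<and> Y (up x y) = y"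
    and disj: "L \<inter> U = {}"
begin

lemma lo_in: "x \<in> V \<Longrightarrow> y \<in> W \<Longrightarrow> lo x y \<in> L" and up_in: "x \<in> V \<Longrightarrow> y \<in> W \<Longrightarrow> up x y \<in> U"
  by (auto simp: L_def U_def)

lemma X_lo: "x \<in> V \<Longrightarrow> y \<in> W \<Longrightarrow> X (lo x y) = x" and Y_lo: "x \<in> V \<Longrightarrow> y \<in> W \<Longrightarrow> Y (lo x y) = y"
  and X_up: "x \<in> V \<Longrightarrow> y \<in> W \<Longrightarrow> X (up x y) = x" and Y_up: "x \<in> V \<Longrightarrow> y \<in> W \<Longrightarrow> Y (up x y) = y"
  using coord by auto

lemma X_V: "a \<in> L \<or> a \<in> U \<Longrightarrow> X a \<in> V" and Y_W: "a \<in> L \<or> a \<in> U \<Longrightarrow> Y a \<in> W"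
  by (auto simp: L_def U_def coord)

lemma LU_disj: "a \<in> L \<Longrightarrow> a \<in> U \<Longrightarrow> False"
  using disj by auto

lemma L_eqI: "a \<in> L \<Longrightarrow> a' \<in> L \<Longrightarrow> X a = X a' \<Longrightarrow> Y a = Y a' \<Longrightarrow> a = a'"
  and U_eqI: "b \<in> U \<Longrightarrow> b' \<in> U \<Longrightarrow> X b = X b' \<Longrightarrow> Y b = Y b' \<Longrightarrow> b = b'"
  by (auto simp: L_def U_def coord)

lemma X_C: "a \<in> L \<or> a \<in> U \<Longrightarrow> X a e \<noteq> 0 \<Longrightarrow> e \<in> C"
  using X_V finsupp_outside unfolding V_def by metis

lemma Y_T: "a \<in> L \<or> a \<in> U \<Longrightarrow> Y a t \<noteq> 0 \<Longrightarrow> t \<in> T"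
  using Y_W finsupp_outside unfolding W_def by metis

definition inc :: "'p \<Rightarrow> 'p \<Rightarrow> bool" where
  "inc a b \<longleftrightarrow> (\<forall>e f. (e, f) \<in> T \<longrightarrow> Y a (e, f) + Y b (e, f) = X b e * X a f)"

definition M :: "'p rel" where
  "M = Id_on (L \<union> U) \<union> {(a, b). a \<in> L \<and> b \<in> U \<and> inc a b}"

lemma M_iff: "(p, q) \<in> M \<longleftrightarrow> p = q \<and> p \<in> L \<union> U \<or> p \<in> L \<and> q \<in> U \<and> inc p q"
  by (auto simp: M_def)

lemma Field_M: "Field M = L \<union> U"
  by (auto simp: M_def Field_def)

lemma M_LU: "a \<in> L \<Longrightarrow> b \<in> U \<Longrightarrow> (a, b) \<in> M \<longleftrightarrow> inc a b"
  using LU_disj by (auto simp: M_iff)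

text \<open>The value zero outside \<open>T\<close> turns incidence into an equation in
  \<open>W\<close> that can be solved for an unknown \<open>Y\<close>.\<close>

definition pairing :: "('z \<Rightarrow> real) \<Rightarrow> ('z \<Rightarrow> real) \<Rightarrow> 'z \<times> 'z \<Rightarrow> real" where
  "pairing m x t = (if t \<in> T then m (fst t) * x (snd t) else 0)"

lemma pairing_W: "m \<in> V \<Longrightarrow> x \<in> V \<Longrightarrow> pairing m x \<in> W"
  unfolding W_def
proof (rule finsuppI)
  assume "m \<in> V" "x \<in> V"
  then have "finite ({i. m i \<noteq> 0} \<times> {i. x i \<noteq> 0})"
    by (auto simp: V_def finsupp_finite)
  then show "finite {i. pairing m x i \<noteq> 0}"
    by (rule rev_finite_subset) (auto simp: pairing_def split: if_splits)
qed (auto simp: pairing_def V_def field_zero[OF F] field_mult[OF F] finsupp_value split: if_splits)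

lemma inc_iff_pairing:
  assumes "a \<in> L" "b \<in> U"
  shows "inc a b \<longleftrightarrow> (\<forall>t. Y a t + Y b t = pairing (X b) (X a) t)"
proof -
  have "Y a t + Y b t = 0" if "t \<notin> T" for t
    using that assms Y_T[of a t] Y_T[of b t] by (metis add.right_neutral)
  then show ?thesis
    by (auto simp: inc_def pairing_def)
qed

section \<open>Neighbours of a point\<close>

text \<open>The \<open>V\<close>-coordinate of a neighbour can be prescribed at will and then
  determines its \<open>W\<close>-coordinate: with the next three lemmas, the neighbours of any
  point are parametrised by \<open>V\<close>.\<close>

lemma ex_upper:
  assumes "a \<in> L" "m \<in> V"
  obtains b where "b \<in> U" "X b = m" "inc a b"
proof
  let ?y = "\<lambda>t. pairing m (X a) t - Y a t"
  have y: "?y \<in> W"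
    using pairing_W[of m "X a"] X_V Y_W assms by (auto simp: W_def intro!: finsupp_diff[OF F])
  then show "up m ?y \<in> U" "X (up m ?y) = m" "inc a (up m ?y)"
    using assms by (auto simp: up_in X_up Y_up inc_iff_pairing)
qed

lemma ex_lower:
  assumes "b \<in> U" "x \<in> V"
  obtains a where "a \<in> L" "X a = x" "inc a b"
proof
  let ?y = "\<lambda>t. pairing (X b) x t - Y b t"
  have y: "?y \<in> W"
    using pairing_W[of "X b" x] X_V Y_W assms by (auto simp: W_def intro!: finsupp_diff[OF F])
  then show "lo x ?y \<in> L" "X (lo x ?y) = x" "inc (lo x ?y) b"
    using assms by (auto simp: lo_in X_lo Y_lo inc_iff_pairing)
qed

lemma upper_unique:
  assumes "a \<in> L" "b \<in> U" "b' \<in> U" "inc a b" "inc a b'" "X b = X b'"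
  shows "b = b'"
proof (rule U_eqI)
  have "Y a t + Y b t = Y a t + Y b' t" for t
    using assms inc_iff_pairing by metis
  then show "Y b = Y b'" by auto
qed (use assms in auto)

lemma lower_unique:
  assumes "a \<in> L" "a' \<in> L" "b \<in> U" "inc a b" "inc a' b" "X a = X a'"
  shows "a = a'"
proof (rule L_eqI)
  have "Y a t + Y b t = Y a' t + Y b t" for t
    using assms inc_iff_pairing by metis
  then show "Y a = Y a'" by auto
qed (use assms in auto)

text \<open>The three given equations turn the fourth into
  \<open>(X b' e - X b e) * (X a' f - X a f) = 0\<close> for all \<open>(e, f)\<close> in
  \<open>T\<close>. Without zero divisors this says that no pair of differing indices lies in
  \<open>T\<close>.\<close>

lemma square:
  assumes "a \<in> L" "a' \<in> L" "b \<in> U" "b' \<in> U" "inc a b" "inc a' b" "inc a b'"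
  shows "inc a' b' \<longleftrightarrow> (\<forall>e f. X b' e \<noteq> X b e \<longrightarrow> X a' f \<noteq> X a f \<longrightarrow> (f, e) \<in> Z \<and> f \<noteq> e)"
proof -
  have eq: "Y a' t + Y b' t = X b' e * X a' f \<longleftrightarrow> (X b' e - X b e) * (X a' f - X a f) = 0"
    if "t \<in> T" "t = (e, f)" for t e f
  proof -
    have "Y a t + Y b t = X b e * X a f" "Y a' t + Y b t = X b e * X a' f"
      "Y a t + Y b' t = X b' e * X a f"
      using assms that by (auto simp: inc_def)
    then have "Y a' t + Y b' t = X b e * X a' f + X b' e * X a f - X b e * X a f"
      by linarith
    then show ?thesis by (simp add: algebra_simps del: mult_eq_0_iff) linarith
  qed
  have "e \<in> C" "f \<in> C" if "X b' e \<noteq> X b e" "X a' f \<noteq> X a f" for e f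
    using that X_C[of b e] X_C[of b' e] X_C[of a f] X_C[of a' f] assms by force+
  then have *: "(e, f) \<notin> T \<longleftrightarrow> (f, e) \<in> Z \<and> f \<noteq> e" if "X b' e \<noteq> X b e" "X a' f \<noteq> X a f" for e f
    using that notin_T_iff by blast
  have "inc a' b' \<longleftrightarrow> (\<forall>e f. X b' e \<noteq> X b e \<longrightarrow> X a' f \<noteq> X a f \<longrightarrow> (e, f) \<notin> T)"
    unfolding inc_def using eq by auto
  then show ?thesis
    using * by blast
qed

lemma zero_V: "(\<lambda>_. 0) \<in> V" and zero_W: "(\<lambda>_. 0) \<in> W"
  by (auto simp: V_def W_def intro: finsupp_zero[OF F])

lemma change_at:
  assumes "x \<in> V" "e \<in> C"
  obtains x' where "x' \<in> V" "x' e \<noteq> x e" "\<And>f. f \<noteq> e \<Longrightarrow> x' f = x f"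
proof
  let ?u = "\<lambda>i. x i + (if i = e then 1 else 0)"
  show "?u \<in> V"
    using assms unfolding V_def
    by (intro finsupp_add[OF F] finsupp_unit[OF F] field_one[OF F]) auto
qed auto

lemma Partial_order_M: "Partial_order M"
  unfolding partial_order_on_def preorder_on_def Field_M
proof (intro conjI)
  show "M \<subseteq> (L \<union> U) \<times> (L \<union> U)" by (auto simp: M_iff)
  show "refl_on (L \<union> U) M" by (rule refl_onI) (simp add: M_iff)
  show "trans M" by (rule transI) (use LU_disj in \<open>metis M_iff\<close>)
  show "antisym M" by (rule antisymI) (use LU_disj in \<open>metis M_iff\<close>)
qed

text \<open>A chain has at most one point on each level, and every point has a neighbour on the
  other level. So any chain, the empty one included, lies inside a comparable pair, which a maximal
  chain exhausts.\<close>

lemma two_level_M: "two_level M"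
  unfolding two_level_def
proof (intro conjI allI impI Partial_order_M)
  fix K assume "pred_on.maxchain (Field M) (\<lambda>x y. (x, y) \<in> M) K"
  then have mc: "pred_on.chain (L \<union> U) (\<lambda>x y. (x, y) \<in> M) K"
    "\<nexists>S. pred_on.chain (L \<union> U) (\<lambda>x y. (x, y) \<in> M) S \<and> K \<subset> S"
    unfolding pred_on.maxchain_def Field_M by simp_all
  have chain: "K \<subseteq> L \<union> U" "\<And>p q. p \<in> K \<Longrightarrow> q \<in> K \<Longrightarrow> (p, q) \<in> M \<or> (q, p) \<in> M"
    using mc(1) M_iff unfolding pred_on.chain_def by blast+
  have max: "False" if "K \<subset> S" "S \<subseteq> L \<union> U"
    "\<And>p q. p \<in> S \<Longrightarrow> q \<in> S \<Longrightarrow> (p, q) \<in> M \<or> (q, p) \<in> M" for S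
  proof -
    have "pred_on.chain (L \<union> U) (\<lambda>x y. (x, y) \<in> M) S"
      unfolding pred_on.chain_def using that(2,3) by blast
    then show False
      using mc(2) that(1) by simp
  qed
  have pair: "\<exists>a b. K = {a, b} \<and> a \<in> L \<and> b \<in> U"
    if "a \<in> L" "b \<in> U" "inc a b" "K \<subseteq> {a, b}" for a b
  proof -
    have "\<not> K \<subset> {a, b}"
      using max[of "{a, b}"] that by (auto simp: M_iff)
    then show ?thesis using that by auto
  qed
  have sub: "K \<subseteq> {p, q}" if "p \<in> K" "q \<in> K" "p \<in> L" "q \<in> U" for p q
  proof
    fix r assume "r \<in> K"
    then have "r \<in> L \<or> r \<in> U" "(p, r) \<in> M \<or> (r, p) \<in> M" "(q, r) \<in> M \<or> (r, q) \<in> M"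
      using chain that by auto
    then show "r \<in> {p, q}"
      using that LU_disj unfolding M_iff by blast
  qed
  have "\<exists>a b. K = {a, b} \<and> a \<in> L \<and> b \<in> U"
  proof (cases "\<exists>a\<in>K. a \<in> L")
    case True
    then obtain a where a: "a \<in> K" "a \<in> L" by auto
    show ?thesis
    proof (cases "\<exists>b\<in>K. b \<in> U")
      case True
      then obtain b where b: "b \<in> K" "b \<in> U" by auto
      then have "inc a b" using a chain(2)[of a b] LU_disj unfolding M_iff by blast
      then show ?thesis using pair[of a b] sub[of a b] a b by auto
    next
      case False
      then have K: "K \<subseteq> {a}" using a chain unfolding M_iff by blast
      obtain b where "b \<in> U" "inc a b" using ex_upper[OF a(2) zero_V] by metis
      then show ?thesis using pair[of a b] a K by auto
    qed
  next
    case False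
    have "\<exists>b. b \<in> U \<and> K \<subseteq> {b}"
    proof (cases "K = {}")
      case True
      then show ?thesis using up_in[OF zero_V zero_W] by auto
    next
      case nonempty: False
      then obtain b where b: "b \<in> K" "b \<in> U" using False chain(1) by auto
      then have "K \<subseteq> {b}" using False chain unfolding M_iff by blast
      then show ?thesis using b by auto
    qed
    then obtain b where b: "b \<in> U" "K \<subseteq> {b}" by auto
    obtain a where "a \<in> L" "inc a b" using ex_lower[OF b(1) zero_V] by metis
    then show ?thesis using pair[of a b] b by auto
  qed
  then obtain a b where "K = {a, b}" "a \<in> L" "b \<in> U" by auto
  then show "card K = 2" using LU_disj[of a] by (cases "a = b") auto
qed

end

context bilinear_order
begin

subsection \<open>Connectedness\<close>

abbreviation linked :: "'p \<Rightarrow> 'p \<Rightarrow> bool" where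
  "linked p q \<equiv> (p, q) \<in> (M \<union> M\<inverse>)\<^sup>*"

lemma linked_sym: "linked p q \<Longrightarrow> linked q p"
  using sym_rtrancl[of "M \<union> M\<inverse>"] by (auto simp: sym_Un_converse dest: symD)

lemma inc_linked: "a \<in> L \<Longrightarrow> b \<in> U \<Longrightarrow> inc a b \<Longrightarrow> linked a b"
  by (auto simp: M_iff)

lemma unit_V: "c \<in> F \<Longrightarrow> e \<in> C \<Longrightarrow> (\<lambda>i. if i = e then c else 0) \<in> V"
  unfolding V_def by (rule finsupp_unit[OF F])

text \<open>A walk that closes up in \<open>V\<close> but not in \<open>W\<close>, like a
  commutator. Along \<open>a\<close>, \<open>b\<close>, \<open>a1\<close>, \<open>b1\<close>,
  \<open>a2\<close> the only nonzero product is that of \<open>a1\<close> and \<open>b1\<close>,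
  namely \<open>- c\<close> at \<open>t\<close>; the alternating signs of the \<open>Y\<close> turn
  it into \<open>+ c\<close>.\<close>

lemma linked_change_Y:
  assumes a: "a \<in> L" "X a = (\<lambda>_. 0)" and t: "t \<in> T" and c: "c \<in> F"
  obtains a' where "a' \<in> L" "X a' = (\<lambda>_. 0)" "linked a a'"
    "\<And>s. Y a' s = Y a s + (if s = t then c else 0)"
proof -
  obtain e f where ef: "t = (e, f)" "e \<in> C" "f \<in> C"
    using t by (auto simp: T_def)
  obtain b where b: "b \<in> U" "X b = (\<lambda>_. 0)" "inc a b"
    using ex_upper[OF a(1) zero_V] by metis
  obtain a1 where a1: "a1 \<in> L" "X a1 = (\<lambda>i. if i = f then 1 else 0)" "inc a1 b"
    using ex_lower[OF b(1) unit_V[OF field_one[OF F] ef(3)]] by metis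
  obtain b1 where b1: "b1 \<in> U" "X b1 = (\<lambda>i. if i = e then - c else 0)" "inc a1 b1"
    using ex_upper[OF a1(1) unit_V[OF field_minus[OF F c] ef(2)]] by metis
  obtain a2 where a2: "a2 \<in> L" "X a2 = (\<lambda>_. 0)" "inc a2 b1"
    using ex_lower[OF b1(1) zero_V] by metis
  have "Y a2 s = Y a s + (if s = t then c else 0)" for s
  proof -
    have "Y a s + Y b s = pairing (X b) (X a) s" "Y a1 s + Y b s = pairing (X b) (X a1) s"
      "Y a1 s + Y b1 s = pairing (X b1) (X a1) s" "Y a2 s + Y b1 s = pairing (X b1) (X a2) s"
      using a b a1 b1 a2 inc_iff_pairing by metis+
    moreover have "pairing (X b1) (X a1) s = (if s = t then - c else 0)"
      using t by (cases s) (auto simp: pairing_def a1 b1 ef)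
    ultimately show ?thesis
      by (auto simp: pairing_def a b a1 a2 split: if_splits)
  qed
  moreover have "linked a a2"
    using inc_linked[of a b] linked_sym[OF inc_linked[of a1 b]] inc_linked[of a1 b1]
      linked_sym[OF inc_linked[of a2 b1]] a b a1 b1 a2 by (meson rtrancl_trans)
  ultimately show ?thesis
    using that a2 by blast
qed

lemma linked_zero:
  assumes "a \<in> L" "X a = (\<lambda>_. 0)"
  shows "linked a (lo (\<lambda>_. 0) (\<lambda>_. 0))"
  using assms
proof (induction "card {t. Y a t \<noteq> 0}" arbitrary: a rule: less_induct)
  case less
  have fin: "finite {t. Y a t \<noteq> 0}"
    using Y_W[of a] less.prems by (auto simp: W_def finsupp_finite)
  show ?case
  proof (cases "\<exists>t. Y a t \<noteq> 0")
    case False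
    then have "Y a = (\<lambda>_. 0)" by auto
    then have "a = lo (\<lambda>_. 0) (\<lambda>_. 0)"
      using less.prems by (intro L_eqI) (auto simp: lo_in zero_V zero_W X_lo Y_lo)
    then show ?thesis by simp
  next
    case True
    then obtain t where t: "Y a t \<noteq> 0" by auto
    have "- Y a t \<in> F"
      using Y_W[of a] less.prems by (auto simp: W_def finsupp_value intro: field_minus[OF F])
    then obtain a' where a': "a' \<in> L" "X a' = (\<lambda>_. 0)" "linked a a'"
      "\<And>s. Y a' s = Y a s + (if s = t then - Y a t else 0)"
      using linked_change_Y[OF less.prems Y_T[of a t]] t less.prems by metis
    have "{s. Y a' s \<noteq> 0} \<subset> {s. Y a s \<noteq> 0}"
      using t a'(4)[of t] by (auto simp: a'(4) split: if_splits)
    then have "linked a' (lo (\<lambda>_. 0) (\<lambda>_. 0))"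
      using less.hyps[of a'] a' psubset_card_mono[OF fin] by auto
    then show ?thesis using a'(3) by (meson rtrancl_trans)
  qed
qed

lemma connected_M: "connected_order M"
proof -
  have U: "linked b (lo (\<lambda>_. 0) (\<lambda>_. 0))" if b: "b \<in> U" for b
  proof -
    obtain a where "a \<in> L" "X a = (\<lambda>_. 0)" "inc a b"
      using ex_lower[OF b zero_V] by metis
    then show ?thesis
      using linked_zero[of a] linked_sym[OF inc_linked[of a b]] b by (meson rtrancl_trans)
  qed
  have L: "linked a (lo (\<lambda>_. 0) (\<lambda>_. 0))" if a: "a \<in> L" for a
  proof -
    obtain b where "b \<in> U" "inc a b"
      using ex_upper[OF a zero_V] by metis
    then show ?thesis
      using U[of b] inc_linked[of a b] a by (meson rtrancl_trans)
  qed
  show ?thesis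
    unfolding connected_order_def Field_M
    using L U linked_sym by (blast intro: rtrancl_trans)
qed

subsection \<open>Automorphisms\<close>

lemma automorphismI:
  assumes "\<And>a. a \<in> L \<Longrightarrow> fl a \<in> L" "\<And>a. a \<in> L \<Longrightarrow> gl a \<in> L"
    "\<And>a. a \<in> L \<Longrightarrow> gl (fl a) = a" "\<And>a. a \<in> L \<Longrightarrow> fl (gl a) = a"
    "\<And>b. b \<in> U \<Longrightarrow> fu b \<in> U" "\<And>b. b \<in> U \<Longrightarrow> gu b \<in> U"
    "\<And>b. b \<in> U \<Longrightarrow> gu (fu b) = b" "\<And>b. b \<in> U \<Longrightarrow> fu (gu b) = b"
    and inc: "\<And>a b. a \<in> L \<Longrightarrow> b \<in> U \<Longrightarrow> inc (fl a) (fu b) \<longleftrightarrow> inc a b"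
  obtains g where "order_iso g M M" "\<And>a. a \<in> L \<Longrightarrow> g a = fl a" "\<And>b. b \<in> U \<Longrightarrow> g b = fu b"
proof
  define g where "g p = (if p \<in> L then fl p else fu p)" for p
  define h where "h p = (if p \<in> L then gl p else gu p)" for p
  have LU: "p \<notin> L" if "p \<in> U" for p
    using that LU_disj by blast
  have g: "p \<in> L \<Longrightarrow> g p = fl p \<and> fl p \<in> L" "p \<in> U \<Longrightarrow> g p = fu p \<and> fu p \<in> U" for p
    using LU by (auto simp: g_def assms)
  have h: "p \<in> L \<Longrightarrow> h p = gl p \<and> gl p \<in> L" "p \<in> U \<Longrightarrow> h p = gu p \<and> gu p \<in> U" for p
    using LU by (auto simp: h_def assms)
  have b: "bij_betw g (L \<union> U) (L \<union> U)"
    by (rule bij_betw_byWitness[of _ h]) (auto simp: g h assms(3,4,7,8))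
  have "(p, q) \<in> M \<longleftrightarrow> (g p, g q) \<in> M" if p: "p \<in> L \<union> U" and q: "q \<in> L \<union> U" for p q
  proof -
    have "p = q \<longleftrightarrow> g p = g q"
      using b p q by (meson bij_betw_def inj_on_def)
    moreover have "g p \<in> L \<union> U" "g p \<in> L \<longleftrightarrow> p \<in> L" "g q \<in> U \<longleftrightarrow> q \<in> U"
      using p q g LU by (metis UnE UnI1 UnI2)+
    moreover have "inc (g p) (g q) \<longleftrightarrow> inc p q" if "p \<in> L" "q \<in> U"
      using that by (simp add: g inc)
    ultimately show ?thesis
      using p unfolding M_iff by blast
  qed
  with b show "order_iso g M M"
    unfolding order_iso_def Field_M by blast
  show "\<And>a. a \<in> L \<Longrightarrow> g a = fl a" "\<And>b. b \<in> U \<Longrightarrow> g b = fu b"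
    using g by auto
qed

abbreviation lo0 :: 'p where "lo0 \<equiv> lo (\<lambda>_. 0) (\<lambda>_. 0)"
abbreviation up0 :: 'p where "up0 \<equiv> up (\<lambda>_. 0) (\<lambda>_. 0)"

lemma lo0_L: "lo0 \<in> L" and up0_U: "up0 \<in> U"
  by (simp_all add: lo_in up_in zero_V zero_W)

lemma V_add: "x \<in> V \<Longrightarrow> y \<in> V \<Longrightarrow> (\<lambda>i. x i + y i) \<in> V"
  and V_diff: "x \<in> V \<Longrightarrow> y \<in> V \<Longrightarrow> (\<lambda>i. x i - y i) \<in> V"
  and W_add: "v \<in> W \<Longrightarrow> w \<in> W \<Longrightarrow> (\<lambda>i. v i + w i) \<in> W"
  and W_diff: "v \<in> W \<Longrightarrow> w \<in> W \<Longrightarrow> (\<lambda>i. v i - w i) \<in> W"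
  and V_divide: "c \<in> F \<Longrightarrow> x \<in> V \<Longrightarrow> (\<lambda>i. x i / c) \<in> V"
  and W_divide: "c \<in> F \<Longrightarrow> w \<in> W \<Longrightarrow> (\<lambda>i. w i / c) \<in> W"
  by (auto simp: V_def W_def intro: finsupp_add[OF F] finsupp_diff[OF F] finsupp_divide[OF F])

lemmas closed = lo_in up_in X_V Y_W V_add V_diff W_add W_diff V_divide W_divide pairing_W zero_V zero_W

text \<open>Expand the product of the translated \<open>V\<close>-coordinates: each cross term is
  linear in the coordinates of one level and is absorbed into the \<open>W\<close>-coordinates of
  that level. The constants match because \<open>a0\<close> and \<open>b0\<close> are
  incident.\<close>

lemma aut_flag:
  assumes "a0 \<in> L" "b0 \<in> U" "inc a0 b0"
  obtains g where "order_iso g M M" "g a0 = lo0" "g b0 = up0"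
proof -
  let ?x = "X a0" and ?y = "Y a0" and ?m = "X b0" and ?k = "Y b0"
  have eq: "?y t + ?k t = pairing ?m ?x t" for t
    using assms inc_iff_pairing by blast
  define fl where "fl a = lo (\<lambda>i. X a i - ?x i) (\<lambda>t. Y a t - ?y t - pairing ?m (\<lambda>i. X a i - ?x i) t)" for a
  define gl where "gl a = lo (\<lambda>i. X a i + ?x i) (\<lambda>t. Y a t + ?y t + pairing ?m (X a) t)" for a
  define fu where "fu b = up (\<lambda>i. X b i - ?m i) (\<lambda>t. Y b t - ?k t - pairing (\<lambda>i. X b i - ?m i) ?x t)" for b
  define gu where "gu b = up (\<lambda>i. X b i + ?m i) (\<lambda>t. Y b t + ?k t + pairing (X b) ?x t)" for b
  have fl: "fl a \<in> L" "X (fl a) = (\<lambda>i. X a i - ?x i)"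
    "Y (fl a) = (\<lambda>t. Y a t - ?y t - pairing ?m (\<lambda>i. X a i - ?x i) t)" if "a \<in> L" for a
    using that assms by (auto simp: fl_def X_lo Y_lo closed)
  have gl: "gl a \<in> L" "X (gl a) = (\<lambda>i. X a i + ?x i)"
    "Y (gl a) = (\<lambda>t. Y a t + ?y t + pairing ?m (X a) t)" if "a \<in> L" for a
    using that assms by (auto simp: gl_def X_lo Y_lo closed)
  have fu: "fu a \<in> U" "X (fu a) = (\<lambda>i. X a i - ?m i)"
    "Y (fu a) = (\<lambda>t. Y a t - ?k t - pairing (\<lambda>i. X a i - ?m i) ?x t)" if "a \<in> U" for a
    using that assms by (auto simp: fu_def X_up Y_up closed)
  have gu: "gu a \<in> U" "X (gu a) = (\<lambda>i. X a i + ?m i)"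
    "Y (gu a) = (\<lambda>t. Y a t + ?k t + pairing (X a) ?x t)" if "a \<in> U" for a
    using that assms by (auto simp: gu_def X_up Y_up closed)
  obtain g where g: "order_iso g M M" "\<And>a. a \<in> L \<Longrightarrow> g a = fl a" "\<And>b. b \<in> U \<Longrightarrow> g b = fu b"
  proof (rule automorphismI[of fl gl fu gu])
    show "gl (fl a) = a" "fl (gl a) = a" if "a \<in> L" for a
      using that by (auto intro!: L_eqI simp: fl gl)
    show "gu (fu a) = a" "fu (gu a) = a" if "a \<in> U" for a
      using that by (auto intro!: U_eqI simp: fu gu)
    show "inc (fl a) (fu b) \<longleftrightarrow> inc a b" if ab: "a \<in> L" "b \<in> U" for a b
    proof -
      have "Y (fl a) (e, f) + Y (fu b) (e, f) = X (fu b) e * X (fl a) f \<longleftrightarrow>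
        Y a (e, f) + Y b (e, f) = X b e * X a f" if "(e, f) \<in> T" for e f
        using that eq[of "(e, f)"] by (simp add: fl fu ab pairing_def algebra_simps)
      then show ?thesis unfolding inc_def by blast
    qed
  qed (auto simp: fl gl fu gu)
  moreover have "g a0 = lo0"
    unfolding g(2)[OF assms(1)] fl_def by (rule arg_cong2[of _ _ _ _ lo]) (auto simp: pairing_def)
  moreover have "g b0 = up0"
    unfolding g(3)[OF assms(2)] fu_def by (rule arg_cong2[of _ _ _ _ up]) (auto simp: pairing_def)
  ultimately show ?thesis using that by blast
qed

lemma aut_scale:
  assumes c: "c \<in> F" "c \<noteq> 0" and d: "d \<in> F" "d \<noteq> 0"
  obtains g where "order_iso g M M"
    "\<And>a. a \<in> L \<Longrightarrow> g a = lo (\<lambda>f. X a f / c) (\<lambda>t. Y a t / (c * d))"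
    "\<And>b. b \<in> U \<Longrightarrow> g b = up (\<lambda>f. X b f / d) (\<lambda>t. Y b t / (c * d))"
proof -
  define fl where "fl c d a = lo (\<lambda>f. X a f / c) (\<lambda>t. Y a t / (c * d))" for c d a
  define fu where "fu c d b = up (\<lambda>f. X b f / d) (\<lambda>t. Y b t / (c * d))" for c d b
  have cd: "1 / c \<in> F" "1 / d \<in> F"
    using field_divide[OF F field_one[OF F]] c(1) d(1) by auto
  have fl: "fl c d a \<in> L" "X (fl c d a) = (\<lambda>f. X a f / c)" "Y (fl c d a) = (\<lambda>t. Y a t / (c * d))"
    if "a \<in> L" "c \<in> F" "d \<in> F" for a c d
    using that field_mult[OF F] by (auto simp: fl_def X_lo Y_lo closed)
  have fu: "fu c d a \<in> U" "X (fu c d a) = (\<lambda>f. X a f / d)" "Y (fu c d a) = (\<lambda>t. Y a t / (c * d))"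
    if "a \<in> U" "c \<in> F" "d \<in> F" for a c d
    using that field_mult[OF F] by (auto simp: fu_def X_up Y_up closed)
  obtain g where g: "order_iso g M M" "\<And>a. a \<in> L \<Longrightarrow> g a = fl c d a" "\<And>b. b \<in> U \<Longrightarrow> g b = fu c d b"
  proof (rule automorphismI[of "fl c d" "fl (1 / c) (1 / d)" "fu c d" "fu (1 / c) (1 / d)"])
    show "fl (1 / c) (1 / d) (fl c d a) = a" "fl c d (fl (1 / c) (1 / d) a) = a" if "a \<in> L" for a
      using that c d cd by (auto intro!: L_eqI simp: fl)
    show "fu (1 / c) (1 / d) (fu c d a) = a" "fu c d (fu (1 / c) (1 / d) a) = a" if "a \<in> U" for a
      using that c d cd by (auto intro!: U_eqI simp: fu)
    show "inc (fl c d a) (fu c d b) \<longleftrightarrow> inc a b" if "a \<in> L" "b \<in> U" for a b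
      using that c d by (simp add: inc_def fl fu add_divide_distrib[symmetric] mult.commute)
  qed (auto simp: fl fu c d cd)
  then show ?thesis using that by (simp add: fl_def fu_def)
qed

text \<open>Incidence involves indices only through \<open>T\<close>, which the maps supplied by
  \<open>homogeneous\<close> preserve. Precomposition is contravariant: the coordinate at
  \<open>f = p e\<close> ends up at \<open>e\<close>.\<close>

lemma aut_shift:
  assumes "e \<in> C" "f \<in> C"
  obtains g p where "order_iso g M M" "bij p" "p e = f"
    "\<And>a. a \<in> L \<Longrightarrow> g a = lo (X a \<circ> p) (Y a \<circ> map_prod p p)"
    "\<And>b. b \<in> U \<Longrightarrow> g b = up (X b \<circ> p) (Y b \<circ> map_prod p p)"
proof -
  obtain p where p: "bij p" "\<And>x y. (p x, p y) \<in> Z \<longleftrightarrow> (x, y) \<in> Z" "\<And>x. p x \<in> C \<longleftrightarrow> x \<in> C" "p e = f"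
    using homogeneous[OF assms] by blast
  let ?q = "inv p"
  have pq: "p (?q x) = x" "?q (p x) = x" for x
    using p(1) by (simp_all add: bij_is_surj surj_f_inv_f bij_is_inj inv_f_f)
  have q: "bij ?q" "\<And>x y. (?q x, ?q y) \<in> Z \<longleftrightarrow> (x, y) \<in> Z" "\<And>x. ?q x \<in> C \<longleftrightarrow> x \<in> C"
    using p(1) p(2)[of "?q _" "?q _"] p(3)[of "?q _"] by (simp_all add: pq bij_imp_bij_inv)
  have comp: "x \<circ> r \<in> finsupp I F" if "bij r" "\<And>i. r i \<in> I \<longleftrightarrow> i \<in> I" "x \<in> finsupp I F"
    for x :: "'i \<Rightarrow> real" and r I
  proof (rule finsuppI)
    have "finite (r -` {i. x i \<noteq> 0})"
      using that by (intro finite_vimageI) (auto simp: finsupp_finite bij_is_inj)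
    then show "finite {i. (x \<circ> r) i \<noteq> 0}"
      by (simp add: vimage_def)
  qed (use that finsupp_in finsupp_value in \<open>auto, fastforce+\<close>)
  have V: "x \<circ> r \<in> V" if "bij r" "\<And>x. r x \<in> C \<longleftrightarrow> x \<in> C" "x \<in> V" for r x
    using that by (auto simp: V_def intro!: comp)
  have W: "w \<circ> map_prod r r \<in> W"
    if "bij r" "\<And>x. r x \<in> C \<longleftrightarrow> x \<in> C" "\<And>x y. (r x, r y) \<in> Z \<longleftrightarrow> (x, y) \<in> Z" "w \<in> W" for r w
  proof -
    have "bij (map_prod r r)"
      using that(1) bij_betw_map_prod[of r UNIV UNIV r UNIV UNIV] by simp
    then show ?thesis
      using that by (auto simp: W_def T_def intro!: comp)
  qed
  define fl where "fl r a = lo (X a \<circ> r) (Y a \<circ> map_prod r r)" for r a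
  define fu where "fu r a = up (X a \<circ> r) (Y a \<circ> map_prod r r)" for r a
  have fl: "fl r a \<in> L" "X (fl r a) = X a \<circ> r" "Y (fl r a) = Y a \<circ> map_prod r r"
    if "a \<in> L" "r = p \<or> r = ?q" for a r
    using that V[OF p(1,3)] V[OF q(1,3)] W[OF p(1,3,2)] W[OF q(1,3,2)] by (auto simp: fl_def X_lo Y_lo closed)
  have fu: "fu r a \<in> U" "X (fu r a) = X a \<circ> r" "Y (fu r a) = Y a \<circ> map_prod r r"
    if "a \<in> U" "r = p \<or> r = ?q" for a r
    using that V[OF p(1,3)] V[OF q(1,3)] W[OF p(1,3,2)] W[OF q(1,3,2)] by (auto simp: fu_def X_up Y_up closed)
  obtain g where g: "order_iso g M M" "\<And>a. a \<in> L \<Longrightarrow> g a = fl p a" "\<And>b. b \<in> U \<Longrightarrow> g b = fu p b"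
  proof (rule automorphismI[of "fl p" "fl ?q" "fu p" "fu ?q"])
    show "fl ?q (fl p a) = a" "fl p (fl ?q a) = a" if "a \<in> L" for a
      using that by (auto intro!: L_eqI simp: fl fun_eq_iff pq)
    show "fu ?q (fu p a) = a" "fu p (fu ?q a) = a" if "a \<in> U" for a
      using that by (auto intro!: U_eqI simp: fu fun_eq_iff pq)
    show "inc (fl p a) (fu p b) \<longleftrightarrow> inc a b" if ab: "a \<in> L" "b \<in> U" for a b
    proof -
      have "inc (fl p a) (fu p b) \<longleftrightarrow> (\<forall>e f. (p e, p f) \<in> T \<longrightarrow>
          Y a (p e, p f) + Y b (p e, p f) = X b (p e) * X a (p f))"
        by (simp add: inc_def fl fu ab T_iff p(2,3))
      also have "\<dots> \<longleftrightarrow> inc a b"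
        unfolding inc_def by (metis pq(1))
      finally show ?thesis .
    qed
  qed (auto simp: fl fu)
  then show ?thesis using that p(1,4) by (simp add: fl_def fu_def)
qed

text \<open>The substitution on the \<open>W\<close>-coordinates stays within \<open>T\<close> since \<open>e < f \<le> h\<close> implies \<open>e \<le> h\<close>.\<close>

lemma aut_shear_up:
  assumes e: "e \<in> C" and r: "r \<in> V" "\<And>f. r f \<noteq> 0 \<Longrightarrow> (e, f) \<in> Z \<and> f \<noteq> e"
  obtains g where "order_iso g M M" "g lo0 = lo0"
    "\<And>b. b \<in> U \<Longrightarrow> X (g b) = (\<lambda>f. X b f + r f * X b e)" "g up0 = up0"
proof -
  define sh where "sh s w = (\<lambda>(f, h). if (f, h) \<in> T then w (f, h) + s f * w (e, h) else 0)"
    for s and w :: "'z \<times> 'z \<Rightarrow> real"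
  define fl where "fl s a = lo (X a) (sh s (Y a))" for s a
  define fu where "fu s b = up (\<lambda>f. X b f + s f * X b e) (sh s (Y b))" for s b
  let ?r' = "\<lambda>f. - r f"
  have r': "?r' \<in> V"
    using V_diff[OF zero_V r(1)] by simp
  have re: "r e = 0" using r(2)[of e] by auto
  have shW: "sh s w \<in> W" if "s \<in> V" "w \<in> W" for s w
    unfolding W_def
  proof (rule finsuppI)
    have "finite ({t. w t \<noteq> 0} \<union> {f. s f \<noteq> 0} \<times> snd ` {t. w t \<noteq> 0})"
      using that by (auto simp: V_def W_def finsupp_finite)
    then show "finite {i. sh s w i \<noteq> 0}"
      by (rule rev_finite_subset) (force simp: sh_def split: if_splits)
    show "sh s w i \<in> F" for i
      using that by (cases i) (auto simp: sh_def V_def W_def finsupp_value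
        intro!: field_add[OF F] field_mult[OF F] field_zero[OF F])
  qed (auto simp: sh_def split: if_splits)
  have shV: "(\<lambda>f. x f + s f * c) \<in> V" if "x \<in> V" "s \<in> V" "c \<in> F" for x s c
  proof -
    have "(\<lambda>f. s f * c) \<in> V"
      unfolding V_def
    proof (rule finsuppI)
      show "finite {i. s i * c \<noteq> 0}"
        using that by (auto simp: V_def finsupp_def elim!: rev_finite_subset)
    qed (use that in \<open>auto simp: V_def finsupp_value finsupp_in intro: field_mult[OF F]\<close>)
    then show ?thesis using V_add that by blast
  qed
  have XF: "X a i \<in> F" if "a \<in> L \<or> a \<in> U" for a i
    using X_V[OF that] by (simp add: V_def finsupp_value)
  have fl: "fl s a \<in> L" "X (fl s a) = X a" "Y (fl s a) = sh s (Y a)"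
    if "a \<in> L" "s = r \<or> s = ?r'" for a s
    using that r(1) r' by (auto simp: fl_def X_lo Y_lo closed shW)
  have fu: "fu s a \<in> U" "X (fu s a) = (\<lambda>f. X a f + s f * X a e)" "Y (fu s a) = sh s (Y a)"
    if a: "a \<in> U" and s: "s = r \<or> s = ?r'" for a s
  proof -
    have "s \<in> V" using s r(1) r' by blast
    then show "fu s a \<in> U" "X (fu s a) = (\<lambda>f. X a f + s f * X a e)" "Y (fu s a) = sh s (Y a)"
      using a unfolding fu_def by (simp_all add: X_up Y_up up_in X_V Y_W shW shV XF)
  qed
  have eT: "(e, h) \<in> T" if "(f, h) \<in> T" "r f \<noteq> 0" for f h
    using that r(2) e le_trans by (auto simp: T_iff)
  have inv: "sh ?r' (sh r w) = w" "sh r (sh ?r' w) = w" if "w \<in> W" for w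
    using eT finsupp_outside[of w T F] that by (auto simp: sh_def re fun_eq_iff W_def)
  obtain g where g: "order_iso g M M" "\<And>a. a \<in> L \<Longrightarrow> g a = fl r a" "\<And>b. b \<in> U \<Longrightarrow> g b = fu r b"
  proof (rule automorphismI[of "fl r" "fl ?r'" "fu r" "fu ?r'"])
    show "fl ?r' (fl r a) = a" "fl r (fl ?r' a) = a" if "a \<in> L" for a
      using that by (auto intro!: L_eqI simp: fl inv Y_W)
    show "fu ?r' (fu r a) = a" "fu r (fu ?r' a) = a" if "a \<in> U" for a
      using that by (auto intro!: U_eqI simp: fu inv Y_W re)
    show "inc (fl r a) (fu r b) \<longleftrightarrow> inc a b" if ab: "a \<in> L" "b \<in> U" for a b
    proof -
      \<comment> \<open>\<open>?E\<close> is the defect of incidence. The map adds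
        \<open>r f\<close> times row \<open>e\<close> to row \<open>f\<close> and fixes row
        \<open>e\<close>, as \<open>r e = 0\<close>; so all defects vanish before iff they vanish
        after.\<close>
      let ?E = "\<lambda>f h. Y a (f, h) + Y b (f, h) - X b f * X a h"
      have 1: "inc (fl r a) (fu r b) \<longleftrightarrow> (\<forall>f h. (f, h) \<in> T \<longrightarrow> ?E f h + r f * ?E e h = 0)"
        by (simp add: inc_def fl fu ab sh_def algebra_simps)
      have 2: "inc a b \<longleftrightarrow> (\<forall>f h. (f, h) \<in> T \<longrightarrow> ?E f h = 0)"
        by (simp add: inc_def)
      have "?E e h = 0" if "\<forall>f h. (f, h) \<in> T \<longrightarrow> ?E f h + r f * ?E e h = 0" "(e, h) \<in> T" for h
        using that re by force
      then show ?thesis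
        unfolding 1 2 using eT by (metis (no_types, lifting) add.right_neutral mult_eq_0_iff)
    qed
  qed (auto simp: fl fu)
  moreover have "g lo0 = lo0"
    unfolding g(2)[OF lo0_L] by (rule L_eqI) (auto simp: fl lo0_L X_lo Y_lo closed sh_def)
  moreover have "g up0 = up0"
    unfolding g(3)[OF up0_U] by (rule U_eqI) (auto simp: fu up0_U X_up Y_up closed sh_def)
  ultimately show ?thesis using that by (simp add: fu)
qed

text \<open>Dual of \<open>aut_shear_up\<close>, with columns in place of rows: the coordinate at
  \<open>e\<close> of a minimal point acts on those strictly below \<open>e\<close>. From
  \<open>f \<le> h < e\<close> it follows that \<open>(f, e)\<close> lies in \<open>T\<close>, so
  the substitution stays within \<open>T\<close>.\<close>

lemma aut_shear_down:
  assumes e: "e \<in> C" and r: "r \<in> V" "\<And>f. r f \<noteq> 0 \<Longrightarrow> (f, e) \<in> Z \<and> f \<noteq> e"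
  obtains g where "order_iso g M M" "g lo0 = lo0"
    "\<And>a. a \<in> L \<Longrightarrow> X (g a) = (\<lambda>f. X a f + r f * X a e)" "g up0 = up0"
proof -
  define sh where "sh s w = (\<lambda>(f, h). if (f, h) \<in> T then w (f, h) + s h * w (f, e) else 0)"
    for s and w :: "'z \<times> 'z \<Rightarrow> real"
  define fl where "fl s a = lo (\<lambda>f. X a f + s f * X a e) (sh s (Y a))" for s a
  define fu where "fu s b = up (X b) (sh s (Y b))" for s b
  let ?r' = "\<lambda>f. - r f"
  have r': "?r' \<in> V"
    using V_diff[OF zero_V r(1)] by simp
  have re: "r e = 0" using r(2)[of e] by auto
  have shW: "sh s w \<in> W" if "s \<in> V" "w \<in> W" for s w
    unfolding W_def
  proof (rule finsuppI)
    have "finite ({t. w t \<noteq> 0} \<union> fst ` {t. w t \<noteq> 0} \<times> {f. s f \<noteq> 0})"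
      using that by (auto simp: V_def W_def finsupp_finite)
    then show "finite {i. sh s w i \<noteq> 0}"
      by (rule rev_finite_subset) (force simp: sh_def split: if_splits)
    show "sh s w i \<in> F" for i
      using that by (cases i) (auto simp: sh_def V_def W_def finsupp_value
        intro!: field_add[OF F] field_mult[OF F] field_zero[OF F])
  qed (auto simp: sh_def split: if_splits)
  have shV: "(\<lambda>f. x f + s f * c) \<in> V" if "x \<in> V" "s \<in> V" "c \<in> F" for x s c
  proof -
    have "(\<lambda>f. s f * c) \<in> V"
      unfolding V_def
    proof (rule finsuppI)
      show "finite {i. s i * c \<noteq> 0}"
        using that by (auto simp: V_def finsupp_def elim!: rev_finite_subset)
    qed (use that in \<open>auto simp: V_def finsupp_value finsupp_in intro: field_mult[OF F]\<close>)
    then show ?thesis using V_add that by blast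
  qed
  have XF: "X a i \<in> F" if "a \<in> L \<or> a \<in> U" for a i
    using X_V[OF that] by (simp add: V_def finsupp_value)
  have fu: "fu s a \<in> U" "X (fu s a) = X a" "Y (fu s a) = sh s (Y a)"
    if "a \<in> U" "s = r \<or> s = ?r'" for a s
    using that r(1) r' by (auto simp: fu_def X_up Y_up closed shW)
  have fl: "fl s a \<in> L" "X (fl s a) = (\<lambda>f. X a f + s f * X a e)" "Y (fl s a) = sh s (Y a)"
    if a: "a \<in> L" and s: "s = r \<or> s = ?r'" for a s
  proof -
    have "s \<in> V" using s r(1) r' by blast
    then show "fl s a \<in> L" "X (fl s a) = (\<lambda>f. X a f + s f * X a e)" "Y (fl s a) = sh s (Y a)"
      using a unfolding fl_def by (simp_all add: X_lo Y_lo lo_in X_V Y_W shW shV XF)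
  qed
  have eT: "(f, e) \<in> T" if "(f, h) \<in> T" "r h \<noteq> 0" for f h
    using that r(2) e le_trans by (auto simp: T_iff)
  have inv: "sh ?r' (sh r w) = w" "sh r (sh ?r' w) = w" if "w \<in> W" for w
    using eT finsupp_outside[of w T F] that by (auto simp: sh_def re fun_eq_iff W_def)
  obtain g where g: "order_iso g M M" "\<And>a. a \<in> L \<Longrightarrow> g a = fl r a" "\<And>b. b \<in> U \<Longrightarrow> g b = fu r b"
  proof (rule automorphismI[of "fl r" "fl ?r'" "fu r" "fu ?r'"])
    show "fl ?r' (fl r a) = a" "fl r (fl ?r' a) = a" if "a \<in> L" for a
      using that by (auto intro!: L_eqI simp: fl inv Y_W re)
    show "fu ?r' (fu r a) = a" "fu r (fu ?r' a) = a" if "a \<in> U" for a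
      using that by (auto intro!: U_eqI simp: fu inv Y_W)
    show "inc (fl r a) (fu r b) \<longleftrightarrow> inc a b" if ab: "a \<in> L" "b \<in> U" for a b
    proof -
      let ?E = "\<lambda>f h. Y a (f, h) + Y b (f, h) - X b f * X a h"
      have 1: "inc (fl r a) (fu r b) \<longleftrightarrow> (\<forall>f h. (f, h) \<in> T \<longrightarrow> ?E f h + r h * ?E f e = 0)"
        by (simp add: inc_def fl fu ab sh_def algebra_simps)
      have 2: "inc a b \<longleftrightarrow> (\<forall>f h. (f, h) \<in> T \<longrightarrow> ?E f h = 0)"
        by (simp add: inc_def)
      have "?E f e = 0" if "\<forall>f h. (f, h) \<in> T \<longrightarrow> ?E f h + r h * ?E f e = 0" "(f, e) \<in> T" for f
        using that re by force
      then show ?thesis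
        unfolding 1 2 using eT by (metis (no_types, lifting) add.right_neutral mult_eq_0_iff)
    qed
  qed (auto simp: fl fu)
  moreover have "g lo0 = lo0"
    unfolding g(2)[OF lo0_L] by (rule L_eqI) (auto simp: fl lo0_L X_lo Y_lo closed sh_def)
  moreover have "g up0 = up0"
    unfolding g(3)[OF up0_U] by (rule U_eqI) (auto simp: fu up0_U X_up Y_up closed sh_def)
  ultimately show ?thesis using that by (simp add: fl)
qed

subsection \<open>Homogeneity\<close>

text \<open>Every point of \<open>L\<close> has a point strictly above it and every point of
  \<open>U\<close> one strictly below it, so preserving strict comparabilities means preserving the
  levels.\<close>

lemma aut_in:
  assumes "order_iso g M M"
  shows "a \<in> L \<Longrightarrow> g a \<in> L" "b \<in> U \<Longrightarrow> g b \<in> U" "a \<in> L \<Longrightarrow> b \<in> U \<Longrightarrow> inc (g a) (g b) \<longleftrightarrow> inc a b"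
proof -
  have mono: "(g p, g q) \<in> M \<longleftrightarrow> (p, q) \<in> M" "g p = g q \<longleftrightarrow> p = q" if "p \<in> L \<union> U" "q \<in> L \<union> U" for p q
    using assms that by (auto simp: order_iso_def Field_M bij_betw_def inj_on_def)
  have strict: "g a \<in> L \<and> g b \<in> U \<and> inc (g a) (g b)" if "a \<in> L" "b \<in> U" "inc a b" for a b
    using mono[of a b] that LU_disj unfolding M_iff by blast
  show L: "g a \<in> L" if "a \<in> L"
    using ex_upper[OF that zero_V] strict that by metis
  show U: "g b \<in> U" if "b \<in> U"
    using ex_lower[OF that zero_V] strict that by metis
  show "inc (g a) (g b) \<longleftrightarrow> inc a b" if "a \<in> L" "b \<in> U"
    using mono(1)[of a b] that L U by (simp add: M_LU)
qed

lemma lo0_coord: "X lo0 = (\<lambda>_. 0)" "Y lo0 = (\<lambda>_. 0)"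
  and up0_coord: "X up0 = (\<lambda>_. 0)" "Y up0 = (\<lambda>_. 0)"
  by (simp_all add: X_lo Y_lo X_up Y_up closed)

lemma inc_lo0: "b \<in> U \<Longrightarrow> inc lo0 b \<longleftrightarrow> Y b = (\<lambda>_. 0)"
  by (auto simp: inc_iff_pairing lo0_L lo0_coord pairing_def)

lemma inc_up0: "a \<in> L \<Longrightarrow> inc a up0 \<longleftrightarrow> Y a = (\<lambda>_. 0)"
  by (auto simp: inc_iff_pairing up0_U up0_coord pairing_def)

lemma inc_lo0_up0: "inc lo0 up0"
  by (simp add: inc_up0 lo0_L lo0_coord)

section \<open>Normal forms of forks\<close>

text \<open>Elimination with the least index \<open>e\<close> of the support as pivot:
  \<open>aut_scale\<close> makes the entry there \<open>1\<close>, \<open>aut_shear_up\<close>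
  clears the entries above it, and \<open>aut_shift\<close> moves it to \<open>e0\<close>. The pivot
  is the least index because these shears act upwards.\<close>

lemma aut_upper_unit:
  assumes c: "c \<in> U" "inc lo0 c" "c \<noteq> up0" and e0: "e0 \<in> C"
  obtains g where "order_iso g M M" "g lo0 = lo0" "g up0 = up0"
    "g c = up (\<lambda>f. if f = e0 then 1 else 0) (\<lambda>_. 0)"
proof -
  let ?u = "X c"
  have "?u \<noteq> (\<lambda>_. 0)"
    using c inc_lo0[OF c(1)] U_eqI[OF c(1) up0_U] up0_coord by auto
  then obtain e where e: "e \<in> C" "?u e \<noteq> 0" "\<And>f. ?u f \<noteq> 0 \<Longrightarrow> (e, f) \<in> Z"
    using finsupp_least_diff[of ?u F "\<lambda>_. 0"] X_V[of c] c(1) zero_V unfolding V_def by metis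
  have ue: "?u e \<in> F"
    using X_V[of c] c(1) by (simp add: V_def finsupp_value)
  let ?r = "\<lambda>f. if f = e then 0 else - (?u f / ?u e)"
  have r: "?r \<in> V"
  proof -
    have "(\<lambda>f. (if f = e then 1 else 0) - ?u f / ?u e) \<in> V"
      using unit_V[OF field_one[OF F] e(1)] V_divide[OF ue X_V[of c]] c(1) by (intro V_diff) auto
    also have "(\<lambda>f. (if f = e then 1 else 0) - ?u f / ?u e) = ?r"
      using e(2) by auto
    finally show ?thesis .
  qed
  obtain g1 where g1: "order_iso g1 M M"
    "\<And>a. a \<in> L \<Longrightarrow> g1 a = lo (\<lambda>f. X a f / 1) (\<lambda>t. Y a t / (1 * ?u e))"
    "\<And>b. b \<in> U \<Longrightarrow> g1 b = up (\<lambda>f. X b f / ?u e) (\<lambda>t. Y b t / (1 * ?u e))"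
    by (rule aut_scale[OF field_one[OF F] one_neq_zero ue e(2)]) blast
  obtain g2 where g2: "order_iso g2 M M" "g2 lo0 = lo0"
    "\<And>b. b \<in> U \<Longrightarrow> X (g2 b) = (\<lambda>f. X b f + ?r f * X b e)" "g2 up0 = up0"
  proof (rule aut_shear_up[OF e(1) r])
    show "(e, f) \<in> Z \<and> f \<noteq> e" if "?r f \<noteq> 0" for f
      using that e(3)[of f] by (auto split: if_splits)
  qed auto
  obtain g3 p where g3: "order_iso g3 M M" "bij p" "p e0 = e"
    "\<And>a. a \<in> L \<Longrightarrow> g3 a = lo (X a \<circ> p) (Y a \<circ> map_prod p p)"
    "\<And>b. b \<in> U \<Longrightarrow> g3 b = up (X b \<circ> p) (Y b \<circ> map_prod p p)"
    by (rule aut_shift[OF e0 e(1)]) blast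
  have g1f: "g1 lo0 = lo0" "g1 up0 = up0"
    by (simp_all add: g1 lo0_L up0_U lo0_coord up0_coord)
  have g3f: "g3 lo0 = lo0" "g3 up0 = up0"
    by (simp_all add: g3 lo0_L up0_U lo0_coord up0_coord comp_def)
  have Xg1: "X (g1 c) = (\<lambda>f. ?u f / ?u e)"
    using c(1) ue by (simp add: g1 X_up closed)
  have g1c: "g1 c \<in> U" using aut_in[OF g1(1)] c(1) by blast
  have Xg2: "X (g2 (g1 c)) = (\<lambda>f. if f = e then 1 else 0)"
    using e(2) by (intro ext) (simp add: g2(3)[OF g1c] Xg1)
  have g2c: "g2 (g1 c) \<in> U" using aut_in[OF g2(1)] g1c by blast
  \<comment> \<open>The effect of the shear on \<open>W\<close> is not traced: being above
    \<open>lo0\<close> already forces the \<open>W\<close>-coordinate to vanish.\<close>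
  have "inc (g2 (g1 lo0)) (g2 (g1 c))"
    using c lo0_L by (simp add: aut_in[OF g1(1)] aut_in[OF g2(1)])
  then have Yg2: "Y (g2 (g1 c)) = (\<lambda>_. 0)"
    using inc_lo0[OF g2c] by (simp add: g1f g2)
  have "(\<lambda>f. if f = e then 1 else 0) \<circ> p = (\<lambda>f. if f = e0 then (1::real) else 0)"
    using g3(2,3) by (auto simp: fun_eq_iff bij_def inj_def)
  then have "g3 (g2 (g1 c)) = up (\<lambda>f. if f = e0 then 1 else 0) (\<lambda>_. 0)"
    by (simp add: g3(5)[OF g2c] Xg2 Yg2 comp_def[of "\<lambda>_. 0"])
  moreover have "order_iso (g3 \<circ> (g2 \<circ> g1)) M M"
    by (rule order_iso_compose[OF order_iso_compose[OF g1(1) g2(1)] g3(1)])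
  ultimately show ?thesis
    using that[of "g3 \<circ> (g2 \<circ> g1)"] by (simp add: g1f g2 g3f)
qed

text \<open>Dual elimination: the pivot is the greatest index of the support, because the shears of
  minimal points act downwards.\<close>

lemma aut_lower_unit:
  assumes c: "c \<in> L" "inc c up0" "c \<noteq> lo0" and e0: "e0 \<in> C"
  obtains g where "order_iso g M M" "g lo0 = lo0" "g up0 = up0"
    "g c = lo (\<lambda>f. if f = e0 then 1 else 0) (\<lambda>_. 0)"
proof -
  let ?u = "X c"
  have "?u \<noteq> (\<lambda>_. 0)"
    using c inc_up0[OF c(1)] L_eqI[OF c(1) lo0_L] lo0_coord by auto
  then obtain e where e: "e \<in> C" "?u e \<noteq> 0" "\<And>f. ?u f \<noteq> 0 \<Longrightarrow> (f, e) \<in> Z"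
    using finsupp_greatest_diff[of ?u F "\<lambda>_. 0"] X_V[of c] c(1) zero_V unfolding V_def by metis
  have ue: "?u e \<in> F"
    using X_V[of c] c(1) by (simp add: V_def finsupp_value)
  let ?r = "\<lambda>f. if f = e then 0 else - (?u f / ?u e)"
  have r: "?r \<in> V"
  proof -
    have "(\<lambda>f. (if f = e then 1 else 0) - ?u f / ?u e) \<in> V"
      using unit_V[OF field_one[OF F] e(1)] V_divide[OF ue X_V[of c]] c(1) by (intro V_diff) auto
    also have "(\<lambda>f. (if f = e then 1 else 0) - ?u f / ?u e) = ?r"
      using e(2) by auto
    finally show ?thesis .
  qed
  obtain g1 where g1: "order_iso g1 M M"
    "\<And>a. a \<in> L \<Longrightarrow> g1 a = lo (\<lambda>f. X a f / ?u e) (\<lambda>t. Y a t / (?u e * 1))"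
    "\<And>b. b \<in> U \<Longrightarrow> g1 b = up (\<lambda>f. X b f / 1) (\<lambda>t. Y b t / (?u e * 1))"
    by (rule aut_scale[OF ue e(2) field_one[OF F] one_neq_zero]) blast
  obtain g2 where g2: "order_iso g2 M M" "g2 lo0 = lo0"
    "\<And>a. a \<in> L \<Longrightarrow> X (g2 a) = (\<lambda>f. X a f + ?r f * X a e)" "g2 up0 = up0"
  proof (rule aut_shear_down[OF e(1) r])
    show "(f, e) \<in> Z \<and> f \<noteq> e" if "?r f \<noteq> 0" for f
      using that e(3)[of f] by (auto split: if_splits)
  qed auto
  obtain g3 p where g3: "order_iso g3 M M" "bij p" "p e0 = e"
    "\<And>a. a \<in> L \<Longrightarrow> g3 a = lo (X a \<circ> p) (Y a \<circ> map_prod p p)"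
    "\<And>b. b \<in> U \<Longrightarrow> g3 b = up (X b \<circ> p) (Y b \<circ> map_prod p p)"
    by (rule aut_shift[OF e0 e(1)]) blast
  have g1f: "g1 lo0 = lo0" "g1 up0 = up0"
    by (simp_all add: g1 lo0_L up0_U lo0_coord up0_coord)
  have g3f: "g3 lo0 = lo0" "g3 up0 = up0"
    by (simp_all add: g3 lo0_L up0_U lo0_coord up0_coord comp_def)
  have Xg1: "X (g1 c) = (\<lambda>f. ?u f / ?u e)"
    using c(1) ue by (simp add: g1 X_lo closed)
  have g1c: "g1 c \<in> L" using aut_in[OF g1(1)] c(1) by blast
  have Xg2: "X (g2 (g1 c)) = (\<lambda>f. if f = e then 1 else 0)"
    using e(2) by (intro ext) (simp add: g2(3)[OF g1c] Xg1)
  have g2c: "g2 (g1 c) \<in> L" using aut_in[OF g2(1)] g1c by blast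
  have "inc (g2 (g1 c)) (g2 (g1 up0))"
    using c up0_U by (simp add: aut_in[OF g1(1)] aut_in[OF g2(1)])
  then have Yg2: "Y (g2 (g1 c)) = (\<lambda>_. 0)"
    using inc_up0[OF g2c] by (simp add: g1f g2)
  have "(\<lambda>f. if f = e then 1 else 0) \<circ> p = (\<lambda>f. if f = e0 then (1::real) else 0)"
    using g3(2,3) by (auto simp: fun_eq_iff bij_def inj_def)
  then have "g3 (g2 (g1 c)) = lo (\<lambda>f. if f = e0 then 1 else 0) (\<lambda>_. 0)"
    by (simp add: g3(4)[OF g2c] Xg2 Yg2 comp_def[of "\<lambda>_. 0"])
  moreover have "order_iso (g3 \<circ> (g2 \<circ> g1)) M M"
    by (rule order_iso_compose[OF order_iso_compose[OF g1(1) g2(1)] g3(1)])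
  ultimately show ?thesis
    using that[of "g3 \<circ> (g2 \<circ> g1)"] by (simp add: g1f g2 g3f)
qed

text \<open>The tips are labelled, \<open>b\<close> going to \<open>up0\<close> and \<open>c\<close>
  to the unit vector. Either labelling has the same normal form, so exchanging the tips is
  covered.\<close>

lemma aut_upper_fork:
  assumes abc: "a \<in> L" "b \<in> U" "c \<in> U" "inc a b" "inc a c" "b \<noteq> c" and e: "e \<in> C"
  obtains g where "order_iso g M M" "g a = lo0" "g b = up0"
    "g c = up (\<lambda>f. if f = e then 1 else 0) (\<lambda>_. 0)"
proof -
  obtain g1 where g1: "order_iso g1 M M" "g1 a = lo0" "g1 b = up0"
    using aut_flag[OF abc(1,2,4)] by blast
  have "inj_on g1 (L \<union> U)"
    using g1(1) by (simp add: order_iso_def bij_betw_def Field_M)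
  then have "g1 c \<noteq> up0"
    using g1(3) abc by (metis UnI2 inj_onD)
  moreover have "g1 c \<in> U" "inc lo0 (g1 c)"
    using aut_in[OF g1(1)] abc g1(2) by metis+
  ultimately obtain g2 where g2: "order_iso g2 M M" "g2 lo0 = lo0" "g2 up0 = up0"
    "g2 (g1 c) = up (\<lambda>f. if f = e then 1 else 0) (\<lambda>_. 0)"
    using aut_upper_unit[OF _ _ _ e] by metis
  show ?thesis
    using that[of "g2 \<circ> g1"] order_iso_compose[OF g1(1) g2(1)] g1 g2 by simp
qed

lemma aut_lower_fork:
  assumes abc: "a \<in> U" "b \<in> L" "c \<in> L" "inc b a" "inc c a" "b \<noteq> c" and e: "e \<in> C"
  obtains g where "order_iso g M M" "g a = up0" "g b = lo0"
    "g c = lo (\<lambda>f. if f = e then 1 else 0) (\<lambda>_. 0)"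
proof -
  obtain g1 where g1: "order_iso g1 M M" "g1 b = lo0" "g1 a = up0"
    using aut_flag[OF abc(2,1,4)] by blast
  have "inj_on g1 (L \<union> U)"
    using g1(1) by (simp add: order_iso_def bij_betw_def Field_M)
  then have "g1 c \<noteq> lo0"
    using g1(2) abc by (metis UnI1 inj_onD)
  moreover have "g1 c \<in> L" "inc (g1 c) up0"
    using aut_in[OF g1(1)] abc g1(3) by metis+
  ultimately obtain g2 where g2: "order_iso g2 M M" "g2 lo0 = lo0" "g2 up0 = up0"
    "g2 (g1 c) = lo (\<lambda>f. if f = e then 1 else 0) (\<lambda>_. 0)"
    using aut_lower_unit[OF _ _ _ e] by metis
  show ?thesis
    using that[of "g2 \<circ> g1"] order_iso_compose[OF g1(1) g2(1)] g1 g2 by simp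
qed

lemma aut_match:
  assumes "order_iso g M M" "order_iso h M M" "S \<subseteq> L \<union> U" "f ` S \<subseteq> L \<union> U"
    "\<And>x. x \<in> S \<Longrightarrow> g x = h (f x)"
  shows "\<exists>k. order_iso k M M \<and> (\<forall>x\<in>S. k x = f x)"
proof (intro exI conjI ballI)
  show "order_iso (inv_into (Field M) h \<circ> g) M M"
    by (intro order_iso_compose[OF assms(1)] order_iso_inv_into assms(2))
  have "inj_on h (Field M)"
    using assms(2) by (simp add: order_iso_def bij_betw_def)
  then show "(inv_into (Field M) h \<circ> g) x = f x" if "x \<in> S" for x
    using that assms(3-5) by (auto simp: Field_M)
qed

lemma Field_Restr_M:
  assumes "S \<subseteq> L \<union> U"
  shows "Field (Restr M S) = S"
proof -
  have "(x, x) \<in> Restr M S" if "x \<in> S" for x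
    using that assms by (auto simp: M_iff)
  then show ?thesis
    by (auto simp: Field_def)
qed

text \<open>A connected graph on three vertices has a vertex adjacent to both others. Its neighbours
  lie on the opposite level, which leaves the two orientations of a fork.\<close>

lemma connected_triple:
  assumes "A \<subseteq> L \<union> U" "card A = 3" "connected_order (Restr M A)"
  obtains a b c where "A = {a, b, c}" "b \<noteq> c" "a \<in> L \<and> b \<in> U \<and> c \<in> U \<and> inc a b \<and> inc a c \<or>
    a \<in> U \<and> b \<in> L \<and> c \<in> L \<and> inc b a \<and> inc c a"
proof -
  note concl = that
  obtain p q r where A: "A = {p, q, r}" and dist: "p \<noteq> q" "q \<noteq> r" "p \<noteq> r"
    using assms(2) by (metis card_3_iff)
  let ?R = "Restr M A \<union> (Restr M A)\<inverse>"
  have Fld: "Field (Restr M A) = A"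
    by (rule Field_Restr_M[OF assms(1)])
  define adj where "adj x y \<longleftrightarrow> x \<in> L \<and> y \<in> U \<and> inc x y \<or> y \<in> L \<and> x \<in> U \<and> inc y x" for x y
  have nb: "\<exists>z\<in>A. z \<noteq> x \<and> adj x z" if xy: "x \<in> A" "y \<in> A" "x \<noteq> y" for x y
  proof -
    have "(x, y) \<in> ?R\<^sup>*"
      using assms(3) that unfolding connected_order_def Fld by blast
    then have "x = y \<or> (\<exists>z. z \<noteq> x \<and> (x, z) \<in> ?R)"
    proof (induction rule: converse_rtrancl_induct)
      case (step x z)
      then show ?case by (cases "z = x") auto
    qed simp
    then obtain z where z: "z \<noteq> x" "z \<in> A" "(x, z) \<in> M \<or> (z, x) \<in> M"
      using xy(3) by blast
    then have "adj x z"
      unfolding M_iff adj_def by metis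
    then show ?thesis using z by blast
  qed
  have sym: "adj x y \<Longrightarrow> adj y x" for x y
    by (auto simp: adj_def)
  have fork: thesis if "adj x y" "adj x z" "A = {x, y, z}" "y \<noteq> z" for x y z
  proof (rule concl[OF that(3,4)])
    show "x \<in> L \<and> y \<in> U \<and> z \<in> U \<and> inc x y \<and> inc x z \<or>
        x \<in> U \<and> y \<in> L \<and> z \<in> L \<and> inc y x \<and> inc z x"
      using that(1,2) LU_disj[of x] unfolding adj_def by metis
  qed
  have "adj p q \<or> adj p r" "adj q p \<or> adj q r" "adj r p \<or> adj r q"
    using nb[of p q] nb[of q r] nb[of r p] dist by (auto simp: A)
  then consider "adj p q" "adj p r" | "adj q p" "adj q r" | "adj r p" "adj r q"
    using sym by blast
  then show thesis
  proof cases
    case 1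
    then show ?thesis using fork[of p q r] A dist by simp
  next
    case 2
    then show ?thesis using fork[of q p r] A dist by (simp add: insert_commute)
  next
    case 3
    then show ?thesis using fork[of r p q] A dist by (simp add: insert_commute)
  qed
qed

text \<open>The isomorphism \<open>f\<close> matches two forks of the same orientation, centre with
  centre and tips with tips. Both go to one normal form, so \<open>f\<close> extends to one
  automorphism followed by the inverse of another.\<close>

lemma CS_homogeneous_M: "CS_homogeneous 3 M"
  unfolding CS_homogeneous_def
proof (intro allI impI, elim conjE)
  fix A B f
  assume A: "A \<subseteq> Field M" "card A = 3" "connected_order (Restr M A)"
    and B: "B \<subseteq> Field M" and f: "order_iso f (Restr M A) (Restr M B)"
  have Fld: "Field (Restr M S) = S" if "S \<subseteq> Field M" for S
    using that unfolding Field_M by (rule Field_Restr_M)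
  have fA: "f ` A \<subseteq> L \<union> U" and inj: "inj_on f A"
    and mono: "x \<in> A \<Longrightarrow> y \<in> A \<Longrightarrow> (x, y) \<in> M \<longleftrightarrow> (f x, f y) \<in> M" for x y
    using f A(1) B unfolding order_iso_def Fld[OF A(1)] Fld[OF B] bij_betw_def Field_M by auto
  have step: "f x \<in> L \<and> f y \<in> U \<and> inc (f x) (f y)"
    if "x \<in> A" "y \<in> A" "x \<in> L" "y \<in> U" "inc x y" for x y
  proof -
    have "(f x, f y) \<in> M" "x \<noteq> y"
      using mono[of x y] that LU_disj by (auto simp: M_LU)
    then show ?thesis
      using inj_onD[OF inj, of x y] that unfolding M_iff by blast
  qed
  obtain a b c where abc: "A = {a, b, c}" "b \<noteq> c"
    "a \<in> L \<and> b \<in> U \<and> c \<in> U \<and> inc a b \<and> inc a c \<or> a \<in> U \<and> b \<in> L \<and> c \<in> L \<and> inc b a \<and> inc c a"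
    using connected_triple[OF _ A(2,3)] A(1) unfolding Field_M by metis
  have neq: "f b \<noteq> f c"
    using inj abc by (auto simp: inj_on_def)
  obtain e where e: "e \<in> C" using C_nonempty by auto
  have "\<exists>g h. order_iso g M M \<and> order_iso h M M \<and> (\<forall>x\<in>A. g x = h (f x))"
    using abc(3)
  proof
    assume *: "a \<in> L \<and> b \<in> U \<and> c \<in> U \<and> inc a b \<and> inc a c"
    obtain g where g: "order_iso g M M" "g a = lo0" "g b = up0"
      "g c = up (\<lambda>f. if f = e then 1 else 0) (\<lambda>_. 0)"
      by (rule aut_upper_fork[of a b c e]) (use * abc(2) e in auto)
    have fabc: "f a \<in> L" "f b \<in> U" "f c \<in> U" "inc (f a) (f b)" "inc (f a) (f c)"
      using step[of a b] step[of a c] * by (simp_all add: abc(1))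
    obtain h where h: "order_iso h M M" "h (f a) = lo0" "h (f b) = up0"
      "h (f c) = up (\<lambda>f. if f = e then 1 else 0) (\<lambda>_. 0)"
      by (rule aut_upper_fork[of "f a" "f b" "f c" e]) (use fabc neq e in auto)
    show ?thesis
      using g h unfolding abc(1) by (intro exI[of _ g] exI[of _ h]) simp
  next
    assume *: "a \<in> U \<and> b \<in> L \<and> c \<in> L \<and> inc b a \<and> inc c a"
    obtain g where g: "order_iso g M M" "g a = up0" "g b = lo0"
      "g c = lo (\<lambda>f. if f = e then 1 else 0) (\<lambda>_. 0)"
      by (rule aut_lower_fork[of a b c e]) (use * abc(2) e in auto)
    have fabc: "f a \<in> U" "f b \<in> L" "f c \<in> L" "inc (f b) (f a)" "inc (f c) (f a)"
      using step[of b a] step[of c a] * by (simp_all add: abc(1))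
    obtain h where h: "order_iso h M M" "h (f a) = up0" "h (f b) = lo0"
      "h (f c) = lo (\<lambda>f. if f = e then 1 else 0) (\<lambda>_. 0)"
      by (rule aut_lower_fork[of "f a" "f b" "f c" e]) (use fabc neq e in auto)
    show ?thesis
      using g h unfolding abc(1) by (intro exI[of _ g] exI[of _ h]) simp
  qed
  then show "\<exists>g. order_iso g M M \<and> (\<forall>x\<in>A. g x = f x)"
    using aut_match[of _ _ A f] A(1) fA unfolding Field_M by blast
qed

end

lemma order_isomorphic_embeddingI:
  assumes r: "antisym r" and s: "s = relation_of (\<subseteq>) S" and h: "h ` Field r = S"
    and mono: "\<And>p q. p \<in> Field r \<Longrightarrow> q \<in> Field r \<Longrightarrow> (p, q) \<in> r \<longleftrightarrow> h p \<subseteq> h q"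
  shows "r \<cong>\<^sub>o s"
proof -
  have Fld: "Field s = S"
    unfolding s relation_of_def Field_def by auto
  have "inj_on h (Field r)"
  proof (rule inj_onI)
    fix p q assume "p \<in> Field r" "q \<in> Field r" "h p = h q"
    then have "(p, q) \<in> r" "(q, p) \<in> r"
      using mono by simp_all
    then show "p = q"
      by (rule antisymD[OF r])
  qed
  then have "order_iso h r s"
    unfolding order_iso_def Fld bij_betw_def using mono h by (auto simp: s relation_of_def)
  then show ?thesis
    by (auto simp: order_isomorphic_def)
qed

context bilinear_order
begin

subsection \<open>Ideals and ramification points\<close>

definition lower_common :: "'p \<Rightarrow> 'p \<Rightarrow> 'p set" where
  "lower_common c d = {x\<in>L. inc x c \<and> inc x d}"

definition upper_common :: "'p \<Rightarrow> 'p \<Rightarrow> 'p set" where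
  "upper_common c d = {y\<in>U. inc c y \<and> inc d y}"

lemma under_L: "a \<in> L \<Longrightarrow> under M a = {a}"
  using LU_disj by (auto simp: under_def M_iff)

lemma under_U: "b \<in> U \<Longrightarrow> under M b = insert b {x\<in>L. inc x b}"
  using LU_disj by (auto simp: under_def M_iff)

lemma Above_iff: "y \<in> Above M A \<longleftrightarrow> y \<in> L \<union> U \<and> (\<forall>x\<in>A. (x, y) \<in> M)"
  and Under_iff: "x \<in> Under M A \<longleftrightarrow> x \<in> L \<union> U \<and> (\<forall>y\<in>A. (x, y) \<in> M)"
  by (auto simp: Above_def Under_def Field_M)

lemma Under_inc: "x \<in> Under M A \<Longrightarrow> y \<in> A \<Longrightarrow> x \<in> L \<Longrightarrow> y \<in> U \<Longrightarrow> inc x y"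
  using M_LU by (auto simp: Under_iff)

lemma M_refl: "x \<in> L \<union> U \<Longrightarrow> (x, x) \<in> M"
  by (simp add: M_iff)

lemma ideal_under: "x \<in> L \<union> U \<Longrightarrow> under M x \<in> ideals M"
proof -
  assume x: "x \<in> L \<union> U"
  have sub: "under M x \<subseteq> L \<union> U"
    by (auto simp: under_def M_iff)
  have x_under: "x \<in> under M x"
    using x by (auto simp: under_def M_refl)
  have x_Above: "x \<in> Above M (under M x)"
    using x by (auto simp: Above_iff under_def)
  have "Under M (Above M (under M x)) \<subseteq> under M x"
    using x_Above by (auto simp: Under_iff under_def)
  moreover have "under M x \<subseteq> Under M (Above M (under M x))"
    using sub by (auto simp: Under_iff Above_iff)
  ultimately show ?thesis
    unfolding ideals_def Field_M using sub x_under x_Above by blast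
qed

lemma completion_iff: "(p, q) \<in> completion M \<longleftrightarrow> p \<in> ideals M \<and> q \<in> ideals M \<and> p \<subseteq> q"
  by (auto simp: completion_def relation_of_def)

lemma Field_completion: "Field (completion M) = ideals M"
  by (auto simp: Field_def completion_iff)

lemma glb_iff: "is_glb (completion M) {q, r} p \<longleftrightarrow> p \<in> ideals M \<and> q \<in> ideals M \<and> r \<in> ideals M \<and>
    p \<subseteq> q \<and> p \<subseteq> r \<and> (\<forall>s\<in>ideals M. s \<subseteq> q \<longrightarrow> s \<subseteq> r \<longrightarrow> s \<subseteq> p)"
  by (auto simp: is_glb_def Under_def Field_completion completion_iff)

lemma lub_iff: "is_lub (completion M) {q, r} p \<longleftrightarrow> p \<in> ideals M \<and> q \<in> ideals M \<and> r \<in> ideals M \<and>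
    q \<subseteq> p \<and> r \<subseteq> p \<and> (\<forall>s\<in>ideals M. q \<subseteq> s \<longrightarrow> r \<subseteq> s \<longrightarrow> p \<subseteq> s)"
  by (auto simp: is_lub_def Above_def Field_completion completion_iff)

text \<open>The meet can only be the intersection of the two principal ideals, and ideals are
  non-empty.\<close>

lemma glb_upper_iff:
  assumes "c \<in> U" "d \<in> U" "c \<noteq> d"
  shows "is_glb (completion M) {under M c, under M d} p \<longleftrightarrow> lower_common c d \<noteq> {} \<and> p = lower_common c d"
proof -
  have int: "under M c \<inter> under M d = lower_common c d"
    using assms LU_disj by (auto simp: under_U lower_common_def)
  have ideal: "lower_common c d \<in> ideals M" if "lower_common c d \<noteq> {}"
  proof -
    have cd: "c \<in> Above M (lower_common c d)" "d \<in> Above M (lower_common c d)"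
      using assms by (auto simp: Above_iff lower_common_def M_iff)
    then have "Under M (Above M (lower_common c d)) \<subseteq> lower_common c d"
      unfolding int[symmetric] by (auto simp: Under_iff under_def)
    moreover have "lower_common c d \<subseteq> Under M (Above M (lower_common c d))"
      by (auto simp: Under_iff Above_iff lower_common_def)
    moreover have "lower_common c d \<subseteq> L \<union> U"
      by (auto simp: lower_common_def)
    ultimately show ?thesis
      unfolding ideals_def Field_M using that cd by blast
  qed
  have ne: "p \<noteq> {}" if "p \<in> ideals M"
    using that by (simp add: ideals_def)
  have cd: "under M c \<in> ideals M" "under M d \<in> ideals M"
    using assms ideal_under by auto
  show ?thesis
  proof
    assume g: "is_glb (completion M) {under M c, under M d} p"
    then have p: "p \<in> ideals M" "p \<subseteq> lower_common c d"
      unfolding glb_iff int[symmetric] by auto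
    then have "lower_common c d \<in> ideals M" "lower_common c d \<noteq> {}"
      using ideal ne by auto
    moreover have "lower_common c d \<subseteq> under M c" "lower_common c d \<subseteq> under M d"
      using int by auto
    ultimately show "lower_common c d \<noteq> {} \<and> p = lower_common c d"
      using g p(2) unfolding glb_iff by (metis subset_antisym)
  next
    assume "lower_common c d \<noteq> {} \<and> p = lower_common c d"
    then show "is_glb (completion M) {under M c, under M d} p"
      unfolding glb_iff using ideal int cd by auto
  qed
qed

text \<open>An ideal containing \<open>c\<close> and \<open>d\<close> has its upper bounds among
  their common upper bounds, hence contains every lower bound of the latter. Ideals being bounded
  above, the join exists iff there is a common upper bound.\<close>

lemma lub_lower_iff:
  assumes "c \<in> L" "d \<in> L" "c \<noteq> d"
  shows "is_lub (completion M) {under M c, under M d} p \<longleftrightarrow>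
    upper_common c d \<noteq> {} \<and> p = Under M (upper_common c d)"
proof -
  have Up: "Above M {c, d} = upper_common c d"
  proof (rule set_eqI)
    fix y
    have "y \<in> Above M {c, d} \<longleftrightarrow> y \<in> L \<union> U \<and> (c, y) \<in> M \<and> (d, y) \<in> M"
      by (simp add: Above_iff)
    also have "\<dots> \<longleftrightarrow> y \<in> upper_common c d"
      unfolding upper_common_def M_iff using assms LU_disj by blast
    finally show "y \<in> Above M {c, d} \<longleftrightarrow> y \<in> upper_common c d" .
  qed
  let ?q = "Under M (upper_common c d)"
  have cd: "c \<in> ?q" "d \<in> ?q"
    using assms by (auto simp: Under_iff upper_common_def M_iff)
  have ideal: "?q \<in> ideals M" if "upper_common c d \<noteq> {}"
  proof -
    have "Above M ?q = upper_common c d"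
    proof
      show "Above M ?q \<subseteq> upper_common c d"
      proof
        fix y assume "y \<in> Above M ?q"
        then have "y \<in> L \<union> U" "(c, y) \<in> M" "(d, y) \<in> M"
          using cd by (auto simp: Above_iff)
        then show "y \<in> upper_common c d"
          unfolding Up[symmetric] by (simp add: Above_iff)
      qed
      show "upper_common c d \<subseteq> Above M ?q"
        by (auto simp: Above_iff Under_iff upper_common_def)
    qed
    moreover have "?q \<subseteq> L \<union> U"
      by (auto simp: Under_iff)
    ultimately show ?thesis
      unfolding ideals_def Field_M using that cd by auto
  qed
  have least: "upper_common c d \<noteq> {} \<and> ?q \<subseteq> p" if "p \<in> ideals M" "c \<in> p" "d \<in> p" for p
  proof -
    have "Above M p \<subseteq> upper_common c d"
      unfolding Up[symmetric] using that by (auto simp: Above_iff)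
    then show ?thesis
      using that unfolding ideals_def Under_def by blast
  qed
  have "under M c \<in> ideals M" "under M d \<in> ideals M"
    using assms ideal_under by auto
  then have cd': "{c} \<in> ideals M" "{d} \<in> ideals M"
    using assms by (simp_all add: under_L)
  show ?thesis
  proof
    assume l: "is_lub (completion M) {under M c, under M d} p"
    then have p: "p \<in> ideals M" "c \<in> p" "d \<in> p"
      unfolding lub_iff under_L[OF assms(1)] under_L[OF assms(2)] by auto
    have "p \<subseteq> ?q"
      using l ideal least[OF p] cd unfolding lub_iff under_L[OF assms(1)] under_L[OF assms(2)] by simp
    then show "upper_common c d \<noteq> {} \<and> p = ?q"
      using least[OF p] by (simp add: subset_antisym)
  next
    assume "upper_common c d \<noteq> {} \<and> p = ?q"
    then show "is_lub (completion M) {under M c, under M d} p"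
      unfolding lub_iff under_L[OF assms(1)] under_L[OF assms(2)] using ideal least cd cd' by simp
  qed
qed

text \<open>An incomparable pair on different levels contributes nothing: the only lower bound of a
  minimal point is the point itself, which would make the pair comparable, and dually. So meets come
  from \<open>U\<close> and joins from \<open>L\<close>.\<close>

lemma Ram_iff: "p \<in> Ram M \<longleftrightarrow>
  (\<exists>c\<in>U. \<exists>d\<in>U. c \<noteq> d \<and> lower_common c d \<noteq> {} \<and> p = lower_common c d) \<or>
  (\<exists>c\<in>L. \<exists>d\<in>L. c \<noteq> d \<and> upper_common c d \<noteq> {} \<and> p = Under M (upper_common c d))"
proof
  assume "p \<in> Ram M"
  then obtain c d where cd: "c \<in> L \<union> U" "d \<in> L \<union> U" "(c, d) \<notin> M" "(d, c) \<notin> M"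
    and p: "is_glb (completion M) {under M c, under M d} p \<or> is_lub (completion M) {under M c, under M d} p"
    unfolding Ram_def Field_M by blast
  have cd': "c \<noteq> d" using cd M_refl by blast
  show "(\<exists>c\<in>U. \<exists>d\<in>U. c \<noteq> d \<and> lower_common c d \<noteq> {} \<and> p = lower_common c d) \<or>
    (\<exists>c\<in>L. \<exists>d\<in>L. c \<noteq> d \<and> upper_common c d \<noteq> {} \<and> p = Under M (upper_common c d))"
    using p
  proof
    assume g: "is_glb (completion M) {under M c, under M d} p"
    then have "p \<noteq> {}" "p \<subseteq> under M c" "p \<subseteq> under M d"
      by (simp_all add: glb_iff ideals_def)
    then obtain x where x: "(x, c) \<in> M" "(x, d) \<in> M"
      by (auto simp: under_def)
    then have U: "c \<in> U" "d \<in> U"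
      using cd M_iff by (metis UnE)+
    then show ?thesis using g unfolding glb_upper_iff[OF U cd'] using cd' by metis
  next
    assume l: "is_lub (completion M) {under M c, under M d} p"
    then have "c \<in> p" "d \<in> p" "Above M p \<noteq> {}"
      using cd M_refl[OF cd(1)] M_refl[OF cd(2)] by (auto simp: lub_iff under_def ideals_def)
    then obtain y where "y \<in> Above M p" by blast
    then have y: "(c, y) \<in> M" "(d, y) \<in> M"
      using \<open>c \<in> p\<close> \<open>d \<in> p\<close> by (simp_all add: Above_iff)
    then have L: "c \<in> L" "d \<in> L"
      using cd M_iff by (metis UnE)+
    then show ?thesis using l unfolding lub_lower_iff[OF L cd'] using cd' by metis
  qed
next
  have incomparable: "(c, d) \<notin> M" if "c \<noteq> d" "c \<in> U \<and> d \<in> U \<or> c \<in> L \<and> d \<in> L" for c d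
    using that LU_disj unfolding M_iff by blast
  assume "(\<exists>c\<in>U. \<exists>d\<in>U. c \<noteq> d \<and> lower_common c d \<noteq> {} \<and> p = lower_common c d) \<or>
    (\<exists>c\<in>L. \<exists>d\<in>L. c \<noteq> d \<and> upper_common c d \<noteq> {} \<and> p = Under M (upper_common c d))"
  then show "p \<in> Ram M"
  proof (elim disjE bexE conjE)
    fix c d assume cd: "c \<in> U" "d \<in> U" "c \<noteq> d" "lower_common c d \<noteq> {}" "p = lower_common c d"
    then have "is_glb (completion M) {under M c, under M d} p"
      by (simp add: glb_upper_iff)
    then show ?thesis
      unfolding Ram_def Field_M using cd incomparable[of c d] incomparable[of d c] by blast
  next
    fix c d assume cd: "c \<in> L" "d \<in> L" "c \<noteq> d" "upper_common c d \<noteq> {}"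
      "p = Under M (upper_common c d)"
    then have "is_lub (completion M) {under M c, under M d} p"
      by (simp add: lub_lower_iff)
    then show ?thesis
      unfolding Ram_def Field_M using cd incomparable[of c d] incomparable[of d c] by blast
  qed
qed

lemma Ram_ideals: "Ram M \<subseteq> ideals M"
  by (auto simp: Ram_def glb_iff lub_iff)

subsection \<open>The interval between two comparable points\<close>

text \<open>\<open>cone a b z\<close> is the point of \<open>M\<^sup>+\<close> at level \<open>z\<close> between \<open>a\<close> and \<open>b\<close>.\<close>

definition cone :: "'p \<Rightarrow> 'p \<Rightarrow> 'z \<Rightarrow> 'p set" where
  "cone a b z = {x\<in>L. inc x b \<and> (\<forall>e\<in>C. (z, e) \<in> Z \<longrightarrow> X x e = X a e)}"

lemma X_diff_C: "p \<in> L \<union> U \<Longrightarrow> q \<in> L \<union> U \<Longrightarrow> X p e \<noteq> X q e \<Longrightarrow> e \<in> C"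
  using X_C[of p e] X_C[of q e] by force

lemma lt_iff: "f \<in> Field Z \<Longrightarrow> e \<in> Field Z \<Longrightarrow> (f, e) \<in> Z \<and> f \<noteq> e \<longleftrightarrow> (e, f) \<notin> Z"
  using le_total le_antisym le_refl by blast

lemma cone_iff:
  assumes "z \<in> Field Z" "a \<in> L"
  shows "x \<in> cone a b z \<longleftrightarrow> x \<in> L \<and> inc x b \<and> (\<forall>e. X x e \<noteq> X a e \<longrightarrow> (e, z) \<in> Z \<and> e \<noteq> z)"
  unfolding cone_def using assms X_diff_C[of x a] lt_iff C_Field by blast

lemma lt_le_trans: "(e, f) \<in> Z \<Longrightarrow> e \<noteq> f \<Longrightarrow> (f, g) \<in> Z \<Longrightarrow> (e, g) \<in> Z \<and> e \<noteq> g"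
  and le_lt_trans: "(e, f) \<in> Z \<Longrightarrow> (f, g) \<in> Z \<Longrightarrow> f \<noteq> g \<Longrightarrow> (e, g) \<in> Z \<and> e \<noteq> g"
  using le_trans le_antisym by blast+

lemma Z_Field: "(e, f) \<in> Z \<Longrightarrow> e \<in> Field Z \<and> f \<in> Field Z"
  by (auto simp: Field_def)

lemma ex_upper_at:
  assumes "a \<in> L" "b \<in> U" "inc a b" "e \<in> C"
  obtains y where "y \<in> U" "inc a y" "X y e \<noteq> X b e" "\<And>f. X y f \<noteq> X b f \<Longrightarrow> f = e"
proof -
  obtain m where m: "m \<in> V" "m e \<noteq> X b e" "\<And>f. f \<noteq> e \<Longrightarrow> m f = X b f"
    using change_at[OF _ assms(4), of "X b"] X_V assms(2) by blast
  show ?thesis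
    using ex_upper[OF assms(1) m(1)] m that by metis
qed

lemma ex_lower_at:
  assumes "a \<in> L" "b \<in> U" "inc a b" "e \<in> C"
  obtains x where "x \<in> L" "inc x b" "X x e \<noteq> X a e" "\<And>f. X x f \<noteq> X a f \<Longrightarrow> f = e"
proof -
  obtain m where m: "m \<in> V" "m e \<noteq> X a e" "\<And>f. f \<noteq> e \<Longrightarrow> m f = X a f"
    using change_at[OF _ assms(4), of "X a"] X_V assms(1) by blast
  show ?thesis
    using ex_lower[OF assms(2) m(1)] m that by metis
qed

lemma ex_C_above:
  assumes "z \<in> Field Z"
  obtains e where "e \<in> C" "(z, e) \<in> Z" "e \<noteq> z"
proof -
  obtain w v where "(z, w) \<in> Z" "w \<noteq> z" "(w, v) \<in> Z" "v \<noteq> w"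
    using no_greatest assms Z_Field by metis
  then show ?thesis
    using between[of w v] that le_trans le_antisym by metis
qed

lemma ex_C_below:
  assumes "z \<in> Field Z"
  obtains e where "e \<in> C" "(e, z) \<in> Z" "e \<noteq> z"
  using no_least[OF assms] between that by metis

context
  fixes a b assumes a: "a \<in> L" and b: "b \<in> U" and ab: "inc a b"
begin

text \<open>A level in \<open>C\<close> is the meet of \<open>b\<close> with a maximal point
  differing from \<open>b\<close> at \<open>z\<close> alone. Any other level sits directly above
  some \<open>e\<close> in \<open>C\<close> and is the join of \<open>a\<close> with a minimal point
  differing from \<open>a\<close> at \<open>e\<close> alone.\<close>

lemma cone_in_Ram:
  assumes z: "z \<in> Field Z"
  shows "cone a b z \<in> Ram M"
proof (cases "z \<in> C")
  case True
  obtain c where c: "c \<in> U" "inc a c" "X c z \<noteq> X b z" "\<And>f. X c f \<noteq> X b f \<Longrightarrow> f = z"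
    using ex_upper_at[OF a b ab True] by blast
  have "x \<in> lower_common b c \<longleftrightarrow> x \<in> cone a b z" for x
    unfolding lower_common_def cone_iff[OF z a] using square[OF a _ b c(1) ab _ c(2), of x] c(3,4) by blast
  then have "lower_common b c = cone a b z" by blast
  moreover have "a \<in> cone a b z"
    using a ab by (simp add: cone_def)
  moreover have "b \<noteq> c" using c(3) by blast
  ultimately show ?thesis
    unfolding Ram_iff using b c(1) by blast
next
  case False
  then obtain e where e: "e \<in> C" "jump e z"
    using jump_below[OF z] by blast
  then have ez: "(e, z) \<in> Z" "e \<noteq> z" "\<And>f. f \<in> C \<Longrightarrow> (f, z) \<in> Z \<Longrightarrow> f \<noteq> z \<Longrightarrow> (f, e) \<in> Z"
    by (auto simp: jump_def)
  obtain c where c: "c \<in> L" "inc c b" "X c e \<noteq> X a e" "\<And>f. X c f \<noteq> X a f \<Longrightarrow> f = e"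
    using ex_lower_at[OF a b ab e(1)] by blast
  have up: "y \<in> upper_common a c \<longleftrightarrow> y \<in> U \<and> inc a y \<and> (\<forall>f. X y f \<noteq> X b f \<longrightarrow> (e, f) \<in> Z \<and> e \<noteq> f)" for y
    unfolding upper_common_def using square[OF a c(1) b _ ab c(2), of y] c(3,4) by blast
  have "x \<in> Under M (upper_common a c) \<longleftrightarrow> x \<in> cone a b z" for x
  proof
    assume x: "x \<in> cone a b z"
    then have x': "x \<in> L" "inc x b" "\<And>e. X x e \<noteq> X a e \<Longrightarrow> (e, z) \<in> Z \<and> e \<noteq> z"
      unfolding cone_iff[OF z a] by auto
    have "inc x y" if y: "y \<in> upper_common a c" for y
    proof -
      have "(g, f) \<in> Z \<and> g \<noteq> f" if "X y f \<noteq> X b f" "X x g \<noteq> X a g" for f g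
        using that x'(3)[of g] ez(3)[of g] X_diff_C[of x a g] x'(1) a y up le_lt_trans by blast
      then show ?thesis
        using square[OF a x'(1) b _ ab x'(2), of y] y up by blast
    qed
    then show "x \<in> Under M (upper_common a c)"
      using x'(1) up by (auto simp: Under_iff M_iff)
  next
    assume x: "x \<in> Under M (upper_common a c)"
    have bup: "b \<in> upper_common a c"
      using b ab by (simp add: up)
    \<comment> \<open>A second common upper bound besides \<open>b\<close>: lying below both forces
      \<open>x\<close> to be minimal.\<close>
    obtain f where f: "f \<in> C" "(e, f) \<in> Z" "f \<noteq> e"
      using ex_C_above C_Field e(1) by blast
    obtain y where y: "y \<in> U" "inc a y" "X y f \<noteq> X b f" "\<And>h. X y h \<noteq> X b h \<Longrightarrow> h = f"
      using ex_upper_at[OF a b ab f(1)] by blast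
    have "y \<in> upper_common a c"
      unfolding up using y f by blast
    then have "(x, y) \<in> M" "(x, b) \<in> M" "y \<noteq> b"
      using x bup y(3) by (auto simp: Under_iff)
    then have x': "x \<in> L" "inc x b"
      using LU_disj y(1) b unfolding M_iff by blast+
    have "X x g = X a g" if g: "g \<in> C" "(z, g) \<in> Z" for g
    proof (rule ccontr)
      assume ne: "X x g \<noteq> X a g"
      \<comment> \<open>Since \<open>e < z \<le> g\<close>, changing \<open>b\<close> at
        \<open>g\<close> alone keeps it above \<open>c\<close>; this bound detects a difference of
        \<open>x\<close> and \<open>a\<close> at \<open>g\<close>.\<close>
      obtain y where y: "y \<in> U" "inc a y" "X y g \<noteq> X b g" "\<And>h. X y h \<noteq> X b h \<Longrightarrow> h = g"
        using ex_upper_at[OF a b ab g(1)] by blast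
      have "y \<in> upper_common a c"
        unfolding up using y g lt_le_trans[OF ez(1,2)] by blast
      then have "inc x y"
        using x x'(1) y(1) by (auto simp: Under_iff M_LU)
      then show False
        using square[OF a x'(1) b y(1) ab x'(2) y(2)] y(3) ne by blast
    qed
    then show "x \<in> cone a b z"
      using x' by (simp add: cone_def)
  qed
  then have "Under M (upper_common a c) = cone a b z" by blast
  moreover have "b \<in> upper_common a c"
    using b ab by (simp add: up)
  moreover have "a \<noteq> c" using c(3) by blast
  ultimately show ?thesis
    unfolding Ram_iff using a c(1) by blast
qed

text \<open>A meet of maximal points sits at the least index where they differ. A join of minimal
  points sits just above the greatest such index \<open>e\<close>, at the level supplied by
  \<open>jump_above\<close>.\<close>

lemma Ram_is_cone:
  assumes p: "p \<in> Ram M" "a \<in> p" "p \<subseteq> under M b"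
  shows "\<exists>z\<in>Field Z. p = cone a b z"
  using p(1) unfolding Ram_iff
proof (elim disjE bexE conjE)
  fix c d assume cd: "c \<in> U" "d \<in> U" "c \<noteq> d" and p': "p = lower_common c d"
  have ac: "inc a c" "inc a d"
    using p(2) by (auto simp: p' lower_common_def)
  have pb: "x \<in> L \<and> inc x b" if "x \<in> p" for x
    using that p(3) b LU_disj by (auto simp: p' lower_common_def under_U)
  have "X c \<noteq> X d"
    using upper_unique[OF a cd(1,2) ac] cd(3) by blast
  then obtain e where e: "e \<in> C" "X c e \<noteq> X d e" "\<And>f. X c f \<noteq> X d f \<Longrightarrow> (e, f) \<in> Z"
    using finsupp_least_diff[of "X c" F "X d"] X_V cd unfolding V_def by metis
  have "x \<in> cone a b e" if x: "x \<in> p" for x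
    unfolding cone_iff[OF C_Field[OF e(1)] a]
    using pb[OF x] square[OF a _ cd(1,2) ac(1) _ ac(2), of x] x e(2) by (auto simp: p' lower_common_def)
  moreover have "x \<in> p" if x: "x \<in> cone a b e" for x
  proof -
    have x': "x \<in> L" "inc x b" "\<And>g. X x g \<noteq> X a g \<Longrightarrow> (g, e) \<in> Z \<and> g \<noteq> e"
      using x unfolding cone_iff[OF C_Field[OF e(1)] a] by auto
    \<comment> \<open>So far \<open>x\<close> is known to be below \<open>b\<close> only. The point
      below \<open>c\<close> with the same \<open>V\<close>-coordinate is below \<open>d\<close>
      too, so it belongs to \<open>p\<close> and is below \<open>b\<close>; there it coincides with
      \<open>x\<close>.\<close>
    obtain x2 where x2: "x2 \<in> L" "X x2 = X x" "inc x2 c"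
      using ex_lower[OF cd(1) X_V[of x]] x'(1) by blast
    have "inc x2 d"
      using square[OF a x2(1) cd(1,2) ac(1) x2(3) ac(2)] x'(3) e(3) lt_le_trans x2(2) by metis
    then have "x2 \<in> p"
      using x2 by (simp add: p' lower_common_def)
    then have "x2 = x"
      using lower_unique[OF x2(1) x'(1) b _ x'(2) x2(2)] pb by blast
    then show ?thesis using \<open>x2 \<in> p\<close> by simp
  qed
  ultimately show ?thesis
    using C_Field[OF e(1)] by blast
next
  fix c d assume cd: "c \<in> L" "d \<in> L" "c \<noteq> d" and ne: "upper_common c d \<noteq> {}"
    and p': "p = Under M (upper_common c d)"
  have up_c: "upper_common c d \<subseteq> U" by (auto simp: upper_common_def)
  have "c \<in> p" "d \<in> p"
    using cd by (auto simp: p' Under_iff upper_common_def M_iff)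
  then have cb: "inc c b" "inc d b"
    using p(3) cd b LU_disj by (auto simp: under_U)
  have au: "inc a y" if "y \<in> upper_common c d" for y
    using Under_inc[of a "upper_common c d" y] p(2) that up_c a p' by blast
  have "X c \<noteq> X d"
    using lower_unique[OF cd(1,2) b cb] cd(3) by blast
  then obtain e where e: "e \<in> C" "X c e \<noteq> X d e" "\<And>f. X c f \<noteq> X d f \<Longrightarrow> (f, e) \<in> Z"
    using finsupp_greatest_diff[of "X c" F "X d"] X_V cd unfolding V_def by metis
  obtain z where "jump e z" using jump_above[OF e(1)] by blast
  then have ez: "(e, z) \<in> Z" "e \<noteq> z" "\<And>f. f \<in> C \<Longrightarrow> (f, z) \<in> Z \<Longrightarrow> f \<noteq> z \<Longrightarrow> (f, e) \<in> Z"
    by (auto simp: jump_def)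
  have z: "z \<in> Field Z" using Z_Field[OF ez(1)] by blast
  have up_ex: "\<exists>y\<in>upper_common c d. X y g \<noteq> X b g \<and> (\<forall>f. X y f \<noteq> X b f \<longrightarrow> f = g)"
    if g: "g \<in> C" "(e, g) \<in> Z" "e \<noteq> g" for g
  proof -
    obtain y where y: "y \<in> U" "inc c y" "X y g \<noteq> X b g" "\<And>h. X y h \<noteq> X b h \<Longrightarrow> h = g"
      using ex_upper_at[OF cd(1) b cb(1) g(1)] by blast
    have "(h, f) \<in> Z \<and> h \<noteq> f" if "X y f \<noteq> X b f" "X d h \<noteq> X c h" for f h
      using y(4)[OF that(1)] e(3)[of h] that(2) le_lt_trans[OF _ g(2,3), of h] by (metis (no_types))
    then have "inc d y"
      using square[OF cd(1,2) b y(1) cb y(2)] by blast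
    then have "y \<in> upper_common c d"
      using y(1,2) by (simp add: upper_common_def)
    then show ?thesis using y(3,4) by blast
  qed
  have "x \<in> cone a b z" if x: "x \<in> p" for x
  proof -
    obtain f where f: "f \<in> C" "(e, f) \<in> Z" "f \<noteq> e"
      using ex_C_above C_Field e(1) by blast
    obtain y where y: "y \<in> upper_common c d" "X y f \<noteq> X b f"
      using up_ex[of f] f by blast
    have "(x, y) \<in> M"
      using x y(1) by (auto simp: p' Under_iff)
    then have "x \<noteq> b"
      using y up_c b LU_disj unfolding M_iff by blast
    then have x': "x \<in> L" "inc x b"
      using x p(3) b by (auto simp: under_U)
    have "X x g = X a g" if g: "g \<in> C" "(z, g) \<in> Z" for g
    proof (rule ccontr)
      assume ne: "X x g \<noteq> X a g"
      obtain y where y: "y \<in> upper_common c d" "X y g \<noteq> X b g"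
        using up_ex[of g] g lt_le_trans[OF ez(1,2) g(2)] by blast
      have "inc x y"
        using Under_inc[of x "upper_common c d" y] x y(1) x'(1) up_c p' by blast
      then show False
        using square[OF a x'(1) b _ ab x'(2), of y] au[OF y(1)] y up_c ne by blast
    qed
    then show ?thesis using x' by (simp add: cone_def)
  qed
  moreover have "x \<in> p" if x: "x \<in> cone a b z" for x
  proof -
    have x': "x \<in> L" "inc x b" "\<And>g. X x g \<noteq> X a g \<Longrightarrow> (g, z) \<in> Z \<and> g \<noteq> z"
      using x unfolding cone_iff[OF z a] by auto
    have "inc x y" if y: "y \<in> upper_common c d" for y
    proof -
      have yU: "y \<in> U" "inc c y" "inc d y" using y by (auto simp: upper_common_def)
      have "(g, f) \<in> Z \<and> g \<noteq> f" if fg: "X y f \<noteq> X b f" "X x g \<noteq> X a g" for f g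
      proof -
        have "(e, f) \<in> Z \<and> e \<noteq> f"
          using square[OF cd(1,2) b yU(1) cb yU(2)] yU(3) fg(1) e(2) by metis
        moreover have "(g, e) \<in> Z"
          using x'(3)[OF fg(2)] ez(3) X_diff_C[of x a g] fg(2) x'(1) a by blast
        ultimately show ?thesis using le_lt_trans by blast
      qed
      then show ?thesis
        using square[OF a x'(1) b yU(1) ab x'(2) au[OF y]] by blast
    qed
    then show ?thesis
      using x'(1) up_c by (auto simp: p' Under_iff M_iff)
  qed
  ultimately show ?thesis using z by blast
qed

text \<open>If \<open>w < z\<close>, then \<open>between\<close> gives \<open>e\<close> in
  \<open>C\<close> with \<open>w \<le> e < z\<close>, and a point differing from \<open>a\<close> at
  \<open>e\<close> alone separates the two cones.\<close>

lemma cone_mono_iff: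
  assumes "z \<in> Field Z" "w \<in> Field Z"
  shows "cone a b z \<subseteq> cone a b w \<longleftrightarrow> (z, w) \<in> Z"
proof
  assume "(z, w) \<in> Z"
  then show "cone a b z \<subseteq> cone a b w"
    unfolding cone_def using le_trans by blast
next
  assume sub: "cone a b z \<subseteq> cone a b w"
  show "(z, w) \<in> Z"
  proof (rule ccontr)
    assume "(z, w) \<notin> Z"
    then obtain e where e: "e \<in> C" "(w, e) \<in> Z" "(e, z) \<in> Z" "e \<noteq> z"
      using between[of w z] lt_iff assms by blast
    obtain x where x: "x \<in> L" "inc x b" "X x e \<noteq> X a e" "\<And>f. X x f \<noteq> X a f \<Longrightarrow> f = e"
      using ex_lower_at[OF a b ab e(1)] by blast
    have "x \<in> cone a b z"
      unfolding cone_iff[OF assms(1) a] using x e by blast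
    then have "x \<in> cone a b w" using sub by blast
    then show False using x(3) e(1,2) by (simp add: cone_def)
  qed
qed

text \<open>The only principal ideals in the interval are the two ends; all other elements are
  cones. A cone never contains \<open>b\<close>, and it is larger than \<open>{a}\<close> because
  \<open>C\<close> has elements below every point of \<open>Z\<close>.\<close>

lemma plus_interval_M: "plus_interval M a b \<cong>\<^sub>o add_endpoints Z"
proof (rule order_isomorphic_sym, rule order_isomorphic_embeddingI)
  let ?S = "{under M a, under M b} \<union> cone a b ` Field Z"
  define h where "h p = (case p of Minf \<Rightarrow> under M a | Fin z \<Rightarrow> cone a b z | Pinf \<Rightarrow> under M b)" for p
  let ?P = "under M ` (L \<union> U) \<union> Ram M"
  have P: "(p, q) \<in> plus_extension M \<longleftrightarrow> p \<in> ?P \<and> q \<in> ?P \<and> p \<subseteq> q" for p q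
    unfolding plus_extension_def Field_M using ideal_under Ram_ideals
    by (auto simp: completion_iff)
  have ua: "under M a = {a}" and ub: "under M b = insert b {x\<in>L. inc x b}"
    using a b by (simp_all add: under_L under_U)
  have cone_sub: "cone a b z \<subseteq> under M b" "a \<in> cone a b z" "b \<notin> cone a b z" for z
    using ab a LU_disj b by (auto simp: cone_def ub)
  have uP: "under M a \<in> ?P" "under M b \<in> ?P"
    using a b by auto
  have mem: "z \<in> ?P \<and> a \<in> z \<and> z \<subseteq> under M b \<longleftrightarrow> z \<in> ?S" for z
  proof
    assume z: "z \<in> ?P \<and> a \<in> z \<and> z \<subseteq> under M b"
    show "z \<in> ?S"
    proof (cases "z \<in> Ram M")
      case True
      then show ?thesis using Ram_is_cone z by blast
    next
      case False
      then obtain x where x: "x \<in> L \<union> U" "z = under M x" using z by blast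
      then have "x \<in> under M b" using z M_refl by (auto simp: under_def)
      then have "x = b \<or> x \<in> L" by (auto simp: ub)
      then have "x = b \<or> x = a" using x z by (auto simp: under_L)
      then show ?thesis using x by blast
    qed
  next
    assume "z \<in> ?S"
    then consider "z = under M a" | "z = under M b" | w where "w \<in> Field Z" "z = cone a b w"
      by blast
    then show "z \<in> ?P \<and> a \<in> z \<and> z \<subseteq> under M b"
    proof cases
      case 1
      then show ?thesis using uP(1) a ab by (simp add: ua ub)
    next
      case 2
      then show ?thesis using uP(2) a ab by (simp add: ub)
    next
      case 3
      then show ?thesis using cone_in_Ram[OF 3(1)] cone_sub by simp
    qed
  qed
  have "(under M a, z) \<in> plus_extension M \<and> (z, under M b) \<in> plus_extension M \<longleftrightarrow>
      z \<in> ?P \<and> a \<in> z \<and> z \<subseteq> under M b" for z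
    unfolding P using uP by (auto simp: ua)
  then have set: "{z. (under M a, z) \<in> plus_extension M \<and> (z, under M b) \<in> plus_extension M} = ?S"
    unfolding mem by (simp only: Collect_mem_eq)
  have SP: "z \<in> ?P" if "z \<in> ?S" for z
    by (rule mem[THEN iffD2, OF that, THEN conjunct1])
  show "plus_interval M a b = relation_of (\<subseteq>) ?S"
  proof (rule set_eqI)
    fix pq :: "'p set \<times> 'p set"
    obtain p q where pq: "pq = (p, q)" by (cases pq)
    have "pq \<in> plus_interval M a b \<longleftrightarrow> (p, q) \<in> plus_extension M \<and> p \<in> ?S \<and> q \<in> ?S"
      unfolding plus_interval_def set pq by (simp only: Int_iff mem_Sigma_iff)
    also have "\<dots> \<longleftrightarrow> p \<in> ?S \<and> q \<in> ?S \<and> p \<subseteq> q"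
      unfolding P using SP by meson
    also have "\<dots> \<longleftrightarrow> pq \<in> relation_of (\<subseteq>) ?S"
      unfolding relation_of_def pq by (simp only: mem_Collect_eq case_prod_conv mem_Sigma_iff conj_assoc)
    finally show "pq \<in> plus_interval M a b \<longleftrightarrow> pq \<in> relation_of (\<subseteq>) ?S" .
  qed
  show "h ` Field (add_endpoints Z) = ?S"
    unfolding Field_add_endpoints by (auto simp: h_def image_image)
  show "antisym (add_endpoints Z)"
  proof (rule antisymI)
    fix p q assume "(p, q) \<in> add_endpoints Z" "(q, p) \<in> add_endpoints Z"
    then show "p = q"
      using le_antisym by (cases p; cases q) (simp_all add: add_endpoints_iff)
  qed
  have nlow: "\<not> cone a b z \<subseteq> {a}" if z: "z \<in> Field Z" for z
  proof -
    obtain e where e: "e \<in> C" "(e, z) \<in> Z" "e \<noteq> z" using ex_C_below[OF z] by blast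
    obtain x where x: "x \<in> L" "inc x b" "X x e \<noteq> X a e" "\<And>f. X x f \<noteq> X a f \<Longrightarrow> f = e"
      using ex_lower_at[OF a b ab e(1)] by blast
    have "x \<in> cone a b z" "x \<noteq> a"
      unfolding cone_iff[OF z a] using x e by blast+
    then show ?thesis by blast
  qed
  have ba: "b \<noteq> a" using LU_disj a b by blast
  show "(p, q) \<in> add_endpoints Z \<longleftrightarrow> h p \<subseteq> h q"
    if "p \<in> Field (add_endpoints Z)" "q \<in> Field (add_endpoints Z)" for p q
  proof -
    have sub: "a \<in> under M b" "\<not> under M b \<subseteq> cone a b z" "{a} \<subseteq> cone a b z" "{a} \<subseteq> under M b" "\<not> under M b \<subseteq> {a}" for z
      using cone_sub[of z] ab a ba by (auto simp: ub)
    have hF: "h Minf = {a}" "h Pinf = under M b" "h (Fin z) = cone a b z" for z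
      by (simp_all add: h_def ua)
    have "p = Minf \<or> p = Pinf \<or> (\<exists>z. p = Fin z \<and> z \<in> Field Z)"
      "q = Minf \<or> q = Pinf \<or> (\<exists>z. q = Fin z \<and> z \<in> Field Z)"
      using that unfolding Field_add_endpoints by blast+
    then show ?thesis
      by (elim disjE exE conjE)
        (simp_all add: hF add_endpoints_iff Field_add_endpoints sub nlow cone_sub cone_mono_iff)
  qed
qed

end

lemma has_interval_type_M: "has_interval_type M (add_endpoints Z)"
  unfolding has_interval_type_def
proof (intro allI impI, elim conjE)
  fix x y assume "x \<noteq> y" "(x, y) \<in> M"
  then show "plus_interval M x y \<cong>\<^sub>o add_endpoints Z"
    using plus_interval_M unfolding M_iff by blast
qed

end

subsection \<open>Recovering the field\<close>

locale bilinear_order_pair =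
  A: bilinear_order Z C jump F lo up X Y V W L U +
  B: bilinear_order Z C jump F' lo' up' X' Y' V' W' L' U'
  for Z :: "'z rel" and C jump
    and F and lo up :: "('z \<Rightarrow> real) \<Rightarrow> ('z \<times> 'z \<Rightarrow> real) \<Rightarrow> 'p" and X Y V W L U
    and F' and lo' up' :: "('z \<Rightarrow> real) \<Rightarrow> ('z \<times> 'z \<Rightarrow> real) \<Rightarrow> 'q" and X' Y' V' W' L' U'
begin

section \<open>Isomorphisms and branching levels\<close>

lemma iso_in:
  assumes "order_iso g A.M B.M"
  shows "a \<in> L \<Longrightarrow> g a \<in> L'" "b \<in> U \<Longrightarrow> g b \<in> U'"
    "a \<in> L \<Longrightarrow> b \<in> U \<Longrightarrow> B.inc (g a) (g b) \<longleftrightarrow> A.inc a b"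
proof -
  have mono: "(g p, g q) \<in> B.M \<longleftrightarrow> (p, q) \<in> A.M" "g p = g q \<longleftrightarrow> p = q"
    if "p \<in> L \<union> U" "q \<in> L \<union> U" for p q
    using assms that by (auto simp: order_iso_def A.Field_M bij_betw_def inj_on_def)
  have strict: "g a \<in> L' \<and> g b \<in> U' \<and> B.inc (g a) (g b)" if "a \<in> L" "b \<in> U" "A.inc a b" for a b
    using mono[of a b] that A.LU_disj unfolding A.M_iff B.M_iff by blast
  show L: "g a \<in> L'" if "a \<in> L"
    using A.ex_upper[OF that A.zero_V] strict that by metis
  show U: "g b \<in> U'" if "b \<in> U"
    using A.ex_lower[OF that A.zero_V] strict that by metis
  show "B.inc (g a) (g b) \<longleftrightarrow> A.inc a b" if "a \<in> L" "b \<in> U"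
    using mono(1)[of a b] that L U by (simp add: A.M_LU B.M_LU)
qed

lemma iso_surj:
  assumes "order_iso g A.M B.M"
  shows "a' \<in> L' \<Longrightarrow> \<exists>a\<in>L. g a = a'" "b' \<in> U' \<Longrightarrow> \<exists>b\<in>U. g b = b'"
proof -
  have "g ` (L \<union> U) = L' \<union> U'"
    using assms by (simp add: order_iso_def A.Field_M B.Field_M bij_betw_def)
  then have surj: "\<exists>p\<in>L \<union> U. g p = q" if "q \<in> L' \<union> U'" for q
    using that by (metis imageE)
  show "\<exists>a\<in>L. g a = a'" if a': "a' \<in> L'"
    using surj[of a'] a' iso_in(2)[OF assms] B.LU_disj by blast
  show "\<exists>b\<in>U. g b = b'" if b': "b' \<in> U'"
    using surj[of b'] b' iso_in(1)[OF assms] B.LU_disj by blast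
qed

definition greatest_diff :: "('z \<Rightarrow> real) \<Rightarrow> ('z \<Rightarrow> real) \<Rightarrow> 'z \<Rightarrow> bool" where
  "greatest_diff x y e \<longleftrightarrow> x e \<noteq> y e \<and> (\<forall>f. x f \<noteq> y f \<longrightarrow> (f, e) \<in> Z)"

definition least_diff :: "('z \<Rightarrow> real) \<Rightarrow> ('z \<Rightarrow> real) \<Rightarrow> 'z \<Rightarrow> bool" where
  "least_diff x y e \<longleftrightarrow> x e \<noteq> y e \<and> (\<forall>f. x f \<noteq> y f \<longrightarrow> (e, f) \<in> Z)"

lemma greatest_diff_unique: "greatest_diff x y e \<Longrightarrow> greatest_diff x y e' \<Longrightarrow> e = e'"
  and least_diff_unique: "least_diff x y e \<Longrightarrow> least_diff x y e' \<Longrightarrow> e = e'"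
  unfolding greatest_diff_def least_diff_def using A.le_antisym by blast+

lemma greatest_diff_sym: "greatest_diff x y e \<Longrightarrow> greatest_diff y x e"
  and least_diff_sym: "least_diff x y e \<Longrightarrow> least_diff y x e"
  unfolding greatest_diff_def least_diff_def by metis+

context
  fixes g assumes iso: "order_iso g A.M B.M"
begin

lemmas g_in = iso_in[OF iso]

lemma g_neq: "p \<in> L \<union> U \<Longrightarrow> q \<in> L \<union> U \<Longrightarrow> p \<noteq> q \<Longrightarrow> g p \<noteq> g q"
  using iso by (auto simp: order_iso_def A.Field_M bij_betw_def inj_on_def)

text \<open>Equality of branching levels can be read off the order. With level \<open>e2\<close> for
  \<open>a1\<close> and \<open>e1\<close> for \<open>b1\<close>, \<open>a1\<close> not below
  \<open>b1\<close> means \<open>e1 \<le> e2\<close>. Moreover \<open>e1 < e2\<close> iff some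
  neighbours \<open>a2\<close>, \<open>b2\<close> of the flag satisfy: \<open>a2\<close> not below
  \<open>b1\<close>, \<open>a2\<close> below \<open>b2\<close>, \<open>a1\<close> not below
  \<open>b2\<close>.\<close>

lemma levels_agree:
  assumes a: "a \<in> L" "a1 \<in> L" "b \<in> U" "b1 \<in> U" "A.inc a b" "A.inc a1 b" "A.inc a b1"
    and lev: "greatest_diff (X a1) (X a) e" "least_diff (X b1) (X b) e"
  shows "\<exists>e'\<in>C. greatest_diff (X' (g a1)) (X' (g a)) e' \<and> least_diff (X' (g b1)) (X' (g b)) e'"
proof -
  have neq: "a1 \<noteq> a" "b1 \<noteq> b"
    using lev by (auto simp: greatest_diff_def least_diff_def)
  have g: "g a \<in> L'" "g a1 \<in> L'" "g b \<in> U'" "g b1 \<in> U'"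
    "B.inc (g a) (g b)" "B.inc (g a1) (g b)" "B.inc (g a) (g b1)"
    using a by (simp_all add: g_in)
  have "X' (g a1) \<noteq> X' (g a)"
    using B.lower_unique[of "g a1" "g a" "g b"] g g_neq[of a1 a] neq a by blast
  then obtain e2 where e2: "e2 \<in> C" "greatest_diff (X' (g a1)) (X' (g a)) e2"
    using A.finsupp_greatest_diff[of "X' (g a1)" F' "X' (g a)"] B.X_V g(1,2)
    unfolding greatest_diff_def B.V_def by metis
  have "X' (g b1) \<noteq> X' (g b)"
    using B.upper_unique[of "g a" "g b1" "g b"] g g_neq[of b1 b] neq a by blast
  then obtain e1 where e1: "e1 \<in> C" "least_diff (X' (g b1)) (X' (g b)) e1"
    using A.finsupp_least_diff[of "X' (g b1)" F' "X' (g b)"] B.X_V g(3,4)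
    unfolding least_diff_def B.V_def by metis
  have "\<not> A.inc a1 b1"
    using A.square[OF a] lev unfolding greatest_diff_def least_diff_def by blast
  then have "\<not> B.inc (g a1) (g b1)"
    using a by (simp add: g_in)
  then obtain f h where fh: "X' (g b1) f \<noteq> X' (g b) f" "X' (g a1) h \<noteq> X' (g a) h"
    "\<not> ((h, f) \<in> Z \<and> h \<noteq> f)"
    using B.square[OF g] by blast
  then have "(e1, f) \<in> Z" "(h, e2) \<in> Z"
    using e1 e2 unfolding greatest_diff_def least_diff_def by blast+
  moreover have "(f, h) \<in> Z"
    using fh(3) A.lt_iff[of h f] calculation A.Z_Field by blast
  ultimately have le: "(e1, e2) \<in> Z"
    using A.le_trans by blast
  have "e1 = e2"
  proof (rule ccontr)
    assume ne: "e1 \<noteq> e2"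
    \<comment> \<open>The witnesses of \<open>e1 < e2\<close> on the image side differ from the flag
      at \<open>e1\<close> alone and at \<open>e2\<close> alone; pulled back, they contradict the
      common level \<open>e\<close>.\<close>
    obtain a2' where a2': "a2' \<in> L'" "B.inc a2' (g b)" "X' a2' e1 \<noteq> X' (g a) e1"
      "\<And>f. X' a2' f \<noteq> X' (g a) f \<Longrightarrow> f = e1"
      using B.ex_lower_at[OF g(1,3,5) e1(1)] by blast
    obtain a2 where a2: "a2 \<in> L" "g a2 = a2'"
      using iso_surj(1)[OF iso a2'(1)] by blast
    have a2b: "A.inc a2 b"
      using a2'(2) g_in(3)[OF a2(1) a(3)] a2 by simp
    have "\<not> B.inc a2' (g b1)"
      using B.square[OF g(1) a2'(1) g(3,4,5) a2'(2) g(7)] a2'(3) e1(2) unfolding least_diff_def by blast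
    then have "\<not> A.inc a2 b1"
      using g_in(3)[OF a2(1) a(4)] a2 by simp
    then obtain f h where fh: "X b1 f \<noteq> X b f" "X a2 h \<noteq> X a h" "\<not> ((h, f) \<in> Z \<and> h \<noteq> f)"
      using A.square[OF a(1) a2(1) a(3,4,5) a2b a(7)] by blast
    have ef: "(e, f) \<in> Z"
      using lev(2) fh(1) unfolding least_diff_def by blast
    have "h \<in> C"
      using A.X_diff_C[of a2 a h] a2(1) a(1) fh(2) by blast
    then have "(f, h) \<in> Z"
      using fh(3) A.lt_iff[of h f] A.Z_Field[OF ef] A.C_Field by blast
    then have eh: "(e, h) \<in> Z"
      using ef A.le_trans by blast
    obtain b2' where b2': "b2' \<in> U'" "B.inc (g a) b2'" "X' b2' e2 \<noteq> X' (g b) e2"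
      "\<And>f. X' b2' f \<noteq> X' (g b) f \<Longrightarrow> f = e2"
      using B.ex_upper_at[OF g(1,3,5) e2(1)] by blast
    obtain b2 where b2: "b2 \<in> U" "g b2 = b2'"
      using iso_surj(2)[OF iso b2'(1)] by blast
    have ab2: "A.inc a b2"
      using b2'(2) g_in(3)[OF a(1) b2(1)] b2 by simp
    have "B.inc a2' b2'"
      using B.square[OF g(1) a2'(1) g(3) b2'(1) g(5) a2'(2) b2'(2)] a2'(4) b2'(4) le ne by blast
    then have "A.inc a2 b2"
      using g_in(3)[OF a2(1) b2(1)] a2 b2 by simp
    then have hk: "(h, k) \<in> Z \<and> h \<noteq> k" if "X b2 k \<noteq> X b k" for k
      using A.square[OF a(1) a2(1) a(3) b2(1) a(5) a2b ab2] fh(2) that by blast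
    \<comment> \<open>The indices satisfy \<open>i \<le> e \<le> h < k\<close>: differences of
      \<open>a1\<close> end at \<open>e\<close>, \<open>a2\<close> reaches \<open>h\<close>, and
      \<open>b2\<close> departs from \<open>b\<close> only beyond \<open>h\<close>.\<close>
    have "(i, k) \<in> Z \<and> i \<noteq> k" if ik: "X b2 k \<noteq> X b k" "X a1 i \<noteq> X a i" for i k
    proof -
      have "(i, e) \<in> Z"
        using lev(1) ik(2) unfolding greatest_diff_def by blast
      then have "(i, h) \<in> Z"
        using eh by (rule A.le_trans)
      then show ?thesis
        using A.le_lt_trans[of i h k] hk[OF ik(1)] by blast
    qed
    then have "A.inc a1 b2"
      using A.square[OF a(1,2,3) b2(1) a(5,6) ab2] by blast
    then have "B.inc (g a1) b2'"
      using g_in(3)[OF a(2) b2(1)] b2 by simp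
    then show False
      using B.square[OF g(1,2,3) b2'(1) g(5,6) b2'(2)] e2(2) b2'(3) unfolding greatest_diff_def by blast
  qed
  then show ?thesis
    using e1 e2 by blast
qed

context
  fixes e assumes e: "e \<in> C"
    and base: "g A.lo0 = B.lo0" "g A.up0 = B.up0"
begin

text \<open>\<open>al s t\<close> and \<open>be m k\<close> are the points and the non-vertical lines of the affine plane over \<open>F\<close>.\<close>

definition al :: "real \<Rightarrow> real \<Rightarrow> 'p" where
  "al s t = lo (\<lambda>i. if i = e then s else 0) (\<lambda>i. if i = (e, e) then t else 0)"

definition be :: "real \<Rightarrow> real \<Rightarrow> 'p" where
  "be m k = up (\<lambda>i. if i = e then m else 0) (\<lambda>i. if i = (e, e) then k else 0)"

section \<open>The affine plane at a fixed level\<close>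

lemma eeT: "(e, e) \<in> A.T"
  using e A.le_refl A.C_Field by (simp add: A.T_iff)

lemma unit_W: "t \<in> F \<Longrightarrow> (\<lambda>i. if i = (e, e) then t else 0) \<in> W"
  unfolding A.W_def by (rule finsupp_unit[OF A.F _ eeT])

lemma al: "s \<in> F \<Longrightarrow> t \<in> F \<Longrightarrow> al s t \<in> L" "s \<in> F \<Longrightarrow> t \<in> F \<Longrightarrow> X (al s t) = (\<lambda>i. if i = e then s else 0)"
    "s \<in> F \<Longrightarrow> t \<in> F \<Longrightarrow> Y (al s t) = (\<lambda>i. if i = (e, e) then t else 0)"
  and be: "s \<in> F \<Longrightarrow> t \<in> F \<Longrightarrow> be s t \<in> U" "s \<in> F \<Longrightarrow> t \<in> F \<Longrightarrow> X (be s t) = (\<lambda>i. if i = e then s else 0)"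
    "s \<in> F \<Longrightarrow> t \<in> F \<Longrightarrow> Y (be s t) = (\<lambda>i. if i = (e, e) then t else 0)"
  by (simp_all add: al_def be_def A.lo_in A.up_in A.X_lo A.Y_lo A.X_up A.Y_up A.unit_V e unit_W)

lemma inc_al_be:
  assumes "s \<in> F" "t \<in> F" "m \<in> F" "k \<in> F"
  shows "A.inc (al s t) (be m k) \<longleftrightarrow> t + k = m * s"
  unfolding A.inc_def using eeT by (auto simp: al be assms)

lemmas F_closed = field_zero[OF A.F] field_one[OF A.F] field_add[OF A.F] field_diff[OF A.F]
  field_minus[OF A.F] field_mult[OF A.F] field_divide[OF A.F]

lemma plane_levels:
  assumes F: "s \<in> F" "t \<in> F" "s1 \<in> F" "t1 \<in> F" "m \<in> F" "k \<in> F" "m1 \<in> F" "k1 \<in> F"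
    and eq: "t + k = m * s" "t1 + k = m * s1" "t + k1 = m1 * s" and ne: "s1 \<noteq> s" "m1 \<noteq> m"
  shows "\<exists>e'\<in>C. greatest_diff (X' (g (al s1 t1))) (X' (g (al s t))) e' \<and>
    least_diff (X' (g (be m1 k1))) (X' (g (be m k))) e'"
proof (rule levels_agree[where e = e])
  have "(e, e) \<in> Z" using e A.le_refl A.C_Field by blast
  then show "greatest_diff (X (al s1 t1)) (X (al s t)) e" "least_diff (X (be m1 k1)) (X (be m k)) e"
    using F ne by (auto simp: greatest_diff_def least_diff_def al be split: if_splits)
qed (use F eq in \<open>simp_all add: al be inc_al_be\<close>)

text \<open>The neighbours of the flag in the plane branch off exactly at level \<open>e'\<close> after applying \<open>g\<close>, and
  the \<open>W\<close>-coordinates of the image vanish except at \<open>(e', e')\<close>.\<close>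

definition good :: "'z \<Rightarrow> real \<Rightarrow> real \<Rightarrow> real \<Rightarrow> real \<Rightarrow> bool" where
  "good e' s t m k \<longleftrightarrow>
     (\<forall>s1\<in>F. \<forall>t1\<in>F. t1 + k = m * s1 \<longrightarrow> s1 \<noteq> s \<longrightarrow>
        greatest_diff (X' (g (al s1 t1))) (X' (g (al s t))) e') \<and>
     (\<forall>m1\<in>F. \<forall>k1\<in>F. t + k1 = m1 * s \<longrightarrow> m1 \<noteq> m \<longrightarrow>
        least_diff (X' (g (be m1 k1))) (X' (g (be m k))) e') \<and>
     (\<forall>f. X' (g (al s t)) f \<noteq> 0 \<longrightarrow> (f, e') \<in> Z) \<and> (\<forall>i. Y' (g (al s t)) i \<noteq> 0 \<longrightarrow> i = (e', e')) \<and>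
     (\<forall>f. X' (g (be m k)) f \<noteq> 0 \<longrightarrow> (e', f) \<in> Z) \<and> (\<forall>i. Y' (g (be m k)) i \<noteq> 0 \<longrightarrow> i = (e', e'))"

text \<open>By \<open>plane_levels\<close> each lower neighbour of the flag has the same level as
  each upper one. So a single neighbour at \<open>e'\<close> fixes all those on the other side, and
  these in turn all those on its own side.\<close>

lemma good_levels:
  assumes F: "s \<in> F" "t \<in> F" "m \<in> F" "k \<in> F" and eq: "t + k = m * s"
    and ex: "(\<exists>s1\<in>F. \<exists>t1\<in>F. t1 + k = m * s1 \<and> s1 \<noteq> s \<and>
        greatest_diff (X' (g (al s1 t1))) (X' (g (al s t))) e') \<or>
      (\<exists>m1\<in>F. \<exists>k1\<in>F. t + k1 = m1 * s \<and> m1 \<noteq> m \<and>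
        least_diff (X' (g (be m1 k1))) (X' (g (be m k))) e')"
  shows "\<forall>s1\<in>F. \<forall>t1\<in>F. t1 + k = m * s1 \<longrightarrow> s1 \<noteq> s \<longrightarrow>
        greatest_diff (X' (g (al s1 t1))) (X' (g (al s t))) e'"
    "\<forall>m1\<in>F. \<forall>k1\<in>F. t + k1 = m1 * s \<longrightarrow> m1 \<noteq> m \<longrightarrow>
        least_diff (X' (g (be m1 k1))) (X' (g (be m k))) e'"
proof -
  have lev: "\<exists>e'\<in>C. greatest_diff (X' (g (al s1 t1))) (X' (g (al s t))) e' \<and>
    least_diff (X' (g (be m1 k1))) (X' (g (be m k))) e'"
    if "s1 \<in> F" "t1 \<in> F" "m1 \<in> F" "k1 \<in> F" "t1 + k = m * s1" "t + k1 = m1 * s" "s1 \<noteq> s" "m1 \<noteq> m" for s1 t1 m1 k1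
    using plane_levels[OF F(1,2) that(1,2) F(3,4) that(3,4) eq that(5-8)] .
  have exs: "\<exists>s1\<in>F. \<exists>t1\<in>F. t1 + k = m * s1 \<and> s1 \<noteq> s"
    by (rule bexI[of _ "s + 1"], rule bexI[of _ "m * (s + 1) - k"]) (use F F_closed in auto)
  have exm: "\<exists>m1\<in>F. \<exists>k1\<in>F. t + k1 = m1 * s \<and> m1 \<noteq> m"
    by (rule bexI[of _ "m + 1"], rule bexI[of _ "(m + 1) * s - t"]) (use F F_closed in auto)
  have both: "\<exists>s1\<in>F. \<exists>t1\<in>F. t1 + k = m * s1 \<and> s1 \<noteq> s \<and>
        greatest_diff (X' (g (al s1 t1))) (X' (g (al s t))) e'"
    "\<exists>m1\<in>F. \<exists>k1\<in>F. t + k1 = m1 * s \<and> m1 \<noteq> m \<and>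
        least_diff (X' (g (be m1 k1))) (X' (g (be m k))) e'"
    using ex exs exm lev greatest_diff_unique least_diff_unique by metis+
  show "\<forall>s1\<in>F. \<forall>t1\<in>F. t1 + k = m * s1 \<longrightarrow> s1 \<noteq> s \<longrightarrow>
        greatest_diff (X' (g (al s1 t1))) (X' (g (al s t))) e'"
    using both(2) lev least_diff_unique by metis
  show "\<forall>m1\<in>F. \<forall>k1\<in>F. t + k1 = m1 * s \<longrightarrow> m1 \<noteq> m \<longrightarrow>
        least_diff (X' (g (be m1 k1))) (X' (g (be m k))) e'"
    using both(1) lev greatest_diff_unique by metis
qed

text \<open>A product \<open>X' b f * X' a h\<close> with \<open>f \<le> h\<close> is nonzero only
  if \<open>e' \<le> f\<close> and \<open>h \<le> e'\<close>, that is, at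
  \<open>(e', e')\<close>.\<close>

lemma Y_level:
  assumes "a \<in> L'" "b \<in> U'" "B.inc a b" "\<And>f. X' a f \<noteq> 0 \<Longrightarrow> (f, e') \<in> Z" "\<And>f. X' b f \<noteq> 0 \<Longrightarrow> (e', f) \<in> Z"
    and i: "i \<noteq> (e', e')"
  shows "Y' a i + Y' b i = 0"
proof (cases i)
  case (Pair f h)
  have "X' b f * X' a h = 0" if "(f, h) \<in> A.T"
  proof (rule ccontr)
    assume "X' b f * X' a h \<noteq> 0"
    then have "(e', f) \<in> Z" "(h, e') \<in> Z"
      using assms(4,5) by auto
    moreover have "(f, h) \<in> Z"
      using that by (simp add: A.T_iff)
    ultimately have "f = e'" "h = e'"
      using A.le_trans A.le_antisym by blast+
    then show False using i Pair by simp
  qed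
  then show ?thesis
    using B.inc_iff_pairing[OF assms(1,2)] assms(3) Pair by (simp add: B.pairing_def)
qed

text \<open>The old line is a neighbour of the new flag, so the level stays \<open>e'\<close>;
  \<open>Y_level\<close> transfers the vanishing of \<open>Y'\<close> from the shared point to the
  new line.\<close>

lemma good_step_upper:
  assumes F: "s \<in> F" "t \<in> F" "m \<in> F" "k \<in> F" "m1 \<in> F" "k1 \<in> F"
    and eq: "t + k = m * s" "t + k1 = m1 * s" and good: "good e' s t m k"
  shows "good e' s t m1 k1"
proof (cases "m1 = m")
  case True
  then have "k1 = k" using eq by simp
  with True show ?thesis using good by simp
next
  case False
  then have diff: "least_diff (X' (g (be m1 k1))) (X' (g (be m k))) e'"
    using good F eq unfolding good_def by blast
  then have "least_diff (X' (g (be m k))) (X' (g (be m1 k1))) e'"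
    by (rule least_diff_sym)
  then have lev: "\<forall>s2\<in>F. \<forall>t2\<in>F. t2 + k1 = m1 * s2 \<longrightarrow> s2 \<noteq> s \<longrightarrow>
        greatest_diff (X' (g (al s2 t2))) (X' (g (al s t))) e'"
    "\<forall>m2\<in>F. \<forall>k2\<in>F. t + k2 = m2 * s \<longrightarrow> m2 \<noteq> m1 \<longrightarrow>
        least_diff (X' (g (be m2 k2))) (X' (g (be m1 k1))) e'"
    using good_levels[OF F(1,2,5,6) eq(2)] F eq False by metis+
  have X: "(e', f) \<in> Z" if "X' (g (be m1 k1)) f \<noteq> 0" for f
    using diff good that unfolding least_diff_def good_def by metis
  have "i = (e', e')" if "Y' (g (be m1 k1)) i \<noteq> 0" for i
  proof (rule ccontr)
    assume i: "i \<noteq> (e', e')"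
    have "Y' (g (al s t)) i + Y' (g (be m1 k1)) i = 0"
      using good X by (intro Y_level[OF _ _ _ _ _ i])
        (auto simp: good_def g_in al be inc_al_be F eq)
    moreover have "Y' (g (al s t)) i = 0"
      using good i unfolding good_def by blast
    ultimately show False using that by simp
  qed
  then show ?thesis
    using lev X good unfolding good_def by blast
qed

lemma good_step_lower:
  assumes F: "s \<in> F" "t \<in> F" "m \<in> F" "k \<in> F" "s1 \<in> F" "t1 \<in> F"
    and eq: "t + k = m * s" "t1 + k = m * s1" and good: "good e' s t m k"
  shows "good e' s1 t1 m k"
proof (cases "s1 = s")
  case True
  then have "t1 = t" using eq by simp
  with True show ?thesis using good by simp
next
  case False
  then have diff: "greatest_diff (X' (g (al s1 t1))) (X' (g (al s t))) e'"
    using good F eq unfolding good_def by blast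
  then have "greatest_diff (X' (g (al s t))) (X' (g (al s1 t1))) e'"
    by (rule greatest_diff_sym)
  then have lev: "\<forall>s2\<in>F. \<forall>t2\<in>F. t2 + k = m * s2 \<longrightarrow> s2 \<noteq> s1 \<longrightarrow>
        greatest_diff (X' (g (al s2 t2))) (X' (g (al s1 t1))) e'"
    "\<forall>m2\<in>F. \<forall>k2\<in>F. t1 + k2 = m2 * s1 \<longrightarrow> m2 \<noteq> m \<longrightarrow>
        least_diff (X' (g (be m2 k2))) (X' (g (be m k))) e'"
    using good_levels[OF F(5,6,3,4) eq(2)] F eq False by metis+
  have X: "(f, e') \<in> Z" if "X' (g (al s1 t1)) f \<noteq> 0" for f
    using diff good that unfolding greatest_diff_def good_def by metis
  have "i = (e', e')" if "Y' (g (al s1 t1)) i \<noteq> 0" for i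
  proof (rule ccontr)
    assume i: "i \<noteq> (e', e')"
    have "Y' (g (al s1 t1)) i + Y' (g (be m k)) i = 0"
      using good X by (intro Y_level[OF _ _ _ _ _ i])
        (auto simp: good_def g_in al be inc_al_be F eq)
    moreover have "Y' (g (be m k)) i = 0"
      using good i unfolding good_def by blast
    ultimately show False using that by simp
  qed
  then show ?thesis
    using lev X good unfolding good_def by blast
qed

lemma al_zero: "al 0 0 = A.lo0" and be_zero: "be 0 0 = A.up0"
  by (simp_all add: al_def be_def)

text \<open>Any two flags of the plane are joined by exchanging point and line in turn, so goodness
  spreads from the base flag, whose image has zero coordinates.\<close>

lemma ex_good:
  obtains e' where "e' \<in> C"
    "\<And>s t m k. s \<in> F \<Longrightarrow> t \<in> F \<Longrightarrow> m \<in> F \<Longrightarrow> k \<in> F \<Longrightarrow> t + k = m * s \<Longrightarrow> good e' s t m k"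
proof -
  obtain e' where e': "e' \<in> C" "greatest_diff (X' (g (al 1 0))) (X' (g (al 0 0))) e'"
    using plane_levels[of 0 0 1 0 0 0 1 0] F_closed by auto
  then have "\<exists>s1\<in>F. \<exists>t1\<in>F. t1 + 0 = 0 * s1 \<and> s1 \<noteq> 0 \<and>
      greatest_diff (X' (g (al s1 t1))) (X' (g (al 0 0))) e'"
    using F_closed by (intro bexI[of _ 1] bexI[of _ 0]) auto
  then have "good e' 0 0 0 0"
    using good_levels[of 0 0 0 0 e'] F_closed unfolding good_def
    by (simp add: al_zero be_zero base B.lo0_coord B.up0_coord)
  note good0 = this
  have "good e' s t m k" if F: "s \<in> F" "t \<in> F" "m \<in> F" "k \<in> F" and eq: "t + k = m * s" for s t m k
  proof (cases "s = 0")
    case False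
    have ts: "t / s \<in> F" using F field_divide[OF A.F] by simp
    have "good e' 0 0 (t / s) 0"
      using good_step_upper[OF _ _ _ _ ts _ _ _ good0] F_closed by simp
    then have "good e' s t (t / s) 0"
      using good_step_lower[of 0 0 "t / s" 0 s t e'] F ts F_closed False by simp
    then show ?thesis
      using good_step_upper[of s t "t / s" 0 m k e'] F ts F_closed False eq by simp
  next
    case True
    \<comment> \<open>The line through \<open>(0, 0)\<close> and \<open>(0, t)\<close> would be
      vertical. The detour runs through \<open>(1, 0)\<close> and the line of slope
      \<open>- t\<close> from there to \<open>(0, t)\<close>.\<close>
    have "good e' 1 0 0 0"
      using good_step_lower[of 0 0 0 0 1 0 e'] F_closed good0 by simp
    then have "good e' 1 0 (- t) (- t)"
      using good_step_upper[of 1 0 0 0 "- t" "- t" e'] F F_closed by simp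
    then have "good e' 0 t (- t) (- t)"
      using good_step_lower[of 1 0 "- t" "- t" 0 t e'] F F_closed by simp
    then show ?thesis
      using good_step_upper[of 0 t "- t" "- t" m k e'] F F_closed True eq by simp
  qed
  then show ?thesis using that e'(1) by blast
qed

section \<open>Coordinatisation of the image plane\<close>

text \<open>The factor \<open>G 1\<close> appears because only the base flag is normalised, not the
  unit; the homomorphism wanted is \<open>G x / G 1\<close>. That \<open>G 1\<close> is nonzero
  holds since the unit point and the line of slope \<open>1\<close> really separate from the base
  flag at \<open>e'\<close>.\<close>

lemma coordinate_hom:
  obtains G where "\<And>x. x \<in> F \<Longrightarrow> G x \<in> F'" "G 1 \<noteq> 0"
    "\<And>x y. x \<in> F \<Longrightarrow> y \<in> F \<Longrightarrow> G (x + y) = G x + G y"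
    "\<And>x y. x \<in> F \<Longrightarrow> y \<in> F \<Longrightarrow> G x * G y = G (x * y) * G 1"
proof -
  obtain e' where e': "e' \<in> C"
    and good: "\<And>s t m k. s \<in> F \<Longrightarrow> t \<in> F \<Longrightarrow> m \<in> F \<Longrightarrow> k \<in> F \<Longrightarrow> t + k = m * s \<Longrightarrow> good e' s t m k"
    using ex_good by blast
  have ee: "(e', e') \<in> A.T"
    using e' A.le_refl A.C_Field by (simp add: A.T_iff)
  define \<tau> where "\<tau> s t = X' (g (al s t)) e'" for s t
  define \<gamma> where "\<gamma> s t = Y' (g (al s t)) (e', e')" for s t
  define \<sigma> where "\<sigma> m k = X' (g (be m k)) e'" for m k
  define \<eta> where "\<eta> m k = Y' (g (be m k)) (e', e')" for m k
  have in_F': "\<tau> s t \<in> F'" "\<gamma> s t \<in> F'" "\<sigma> s t \<in> F'" "\<eta> s t \<in> F'" if "s \<in> F" "t \<in> F" for s t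
    using that B.X_V B.Y_W g_in al be unfolding \<tau>_def \<gamma>_def \<sigma>_def \<eta>_def B.V_def B.W_def
    by (meson finsupp_value)+
  have inc: "\<gamma> s t + \<eta> m k = \<sigma> m k * \<tau> s t"
    if "s \<in> F" "t \<in> F" "m \<in> F" "k \<in> F" "t + k = m * s" for s t m k
  proof -
    have "B.inc (g (al s t)) (g (be m k))"
      using that by (simp add: g_in al be inc_al_be)
    then show ?thesis
      using ee unfolding B.inc_def \<tau>_def \<gamma>_def \<sigma>_def \<eta>_def by blast
  qed
  \<comment> \<open>Every point lies on a horizontal line and every line meets the vertical axis, so
    each belongs to a flag to which \<open>good\<close> applies.\<close>
  have goodL: "good e' s t 0 (- t)" and goodU: "good e' 0 (- t) s t" if "s \<in> F" "t \<in> F" for s t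
    using that F_closed by (simp_all add: good)
  have lower: "(f, e') \<in> Z" if "s \<in> F" "t \<in> F" "X' (g (al s t)) f \<noteq> 0" for s t f
    using goodL[OF that(1,2)] that(3) unfolding good_def by blast
  have lowerY: "i = (e', e')" if "s \<in> F" "t \<in> F" "Y' (g (al s t)) i \<noteq> 0" for s t i
    using goodL[OF that(1,2)] that(3) unfolding good_def by blast
  have upper: "(e', f) \<in> Z" if "m \<in> F" "k \<in> F" "X' (g (be m k)) f \<noteq> 0" for m k f
    using goodU[OF that(1,2)] that(3) unfolding good_def by blast
  have upperY: "i = (e', e')" if "m \<in> F" "k \<in> F" "Y' (g (be m k)) i \<noteq> 0" for m k i
    using goodU[OF that(1,2)] that(3) unfolding good_def by blast
  have unit': "(\<lambda>i. if i = e' then c else 0) \<in> V'" "(\<lambda>i. if i = (e', e') then c else 0) \<in> W'" if "c \<in> F'" for c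
    unfolding B.V_def B.W_def by (rule finsupp_unit[OF B.F that e'] finsupp_unit[OF B.F that ee])+
  note F'_closed = field_zero[OF B.F] field_diff[OF B.F] field_mult[OF B.F] field_divide[OF B.F]
  text \<open>If \<open>\<tau> s t\<close> and \<open>\<tau> s t'\<close> differed, the images of \<open>al s t\<close> and \<open>al s t'\<close> would have a common upper
    bound at level \<open>e'\<close>, but for \<open>t \<noteq> t'\<close> the points themselves have none.\<close>
  have \<tau>_indep: "\<tau> s t = \<tau> s t'" if F: "s \<in> F" "t \<in> F" "t' \<in> F" for s t t'
  proof (rule ccontr)
    assume ne: "\<tau> s t \<noteq> \<tau> s t'"
    \<comment> \<open>Slope and negated intercept of the line through the two image points.\<close>
    define m where "m = (\<gamma> s t - \<gamma> s t') / (\<tau> s t - \<tau> s t')"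
    define k where "k = m * \<tau> s t - \<gamma> s t"
    have mk: "m \<in> F'" "k \<in> F'"
      using in_F' F F'_closed by (simp_all add: m_def k_def)
    have "m * (\<tau> s t - \<tau> s t') = \<gamma> s t - \<gamma> s t'"
      using ne by (simp add: m_def)
    then have k': "k = m * \<tau> s t' - \<gamma> s t'"
      by (simp add: k_def algebra_simps)
    let ?b = "up' (\<lambda>i. if i = e' then m else 0) (\<lambda>i. if i = (e', e') then k else 0)"
    have b: "?b \<in> U'" "X' ?b = (\<lambda>i. if i = e' then m else 0)" "Y' ?b = (\<lambda>i. if i = (e', e') then k else 0)"
      using mk by (simp_all add: B.up_in B.X_up B.Y_up unit')
    have incb: "B.inc (g (al s u)) ?b" if u: "u \<in> F" "k = m * \<tau> s u - \<gamma> s u" for u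
      unfolding B.inc_def
    proof (intro allI impI)
      fix f h assume T: "(f, h) \<in> A.T"
      show "Y' (g (al s u)) (f, h) + Y' ?b (f, h) = X' ?b f * X' (g (al s u)) h"
      proof (cases "(f, h) = (e', e')")
        case True
        then show ?thesis using u by (simp add: b \<tau>_def \<gamma>_def)
      next
        case False
        then have "Y' (g (al s u)) (f, h) = 0"
          using lowerY[OF F(1) u(1)] by blast
        moreover have "X' ?b f * X' (g (al s u)) h = 0"
        proof (rule ccontr)
          assume "X' ?b f * X' (g (al s u)) h \<noteq> 0"
          then have "f = e'" "(h, e') \<in> Z"
            using lower[OF F(1) u(1)] by (auto simp: b split: if_splits)
          then show False
            using T False A.le_antisym by (auto simp: A.T_iff)
        qed
        ultimately show ?thesis using False by (auto simp: b)
      qed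
    qed
    obtain b' where b': "b' \<in> U" "g b' = ?b"
      using iso_surj(2)[OF iso b(1)] by blast
    have "A.inc (al s t) b'" "A.inc (al s t') b'"
      using incb[OF F(2)] incb[OF F(3)] k' g_in(3)[OF _ b'(1)] b'(2) F by (simp_all add: k_def al)
    then have "Y (al s t) (e, e) + Y b' (e, e) = X b' e * X (al s t) e"
      "Y (al s t') (e, e) + Y b' (e, e) = X b' e * X (al s t') e"
      using eeT unfolding A.inc_def by blast+
    then have "t = t'" using F by (simp add: al)
    then show False using ne by simp
  qed
  \<comment> \<open>Dual argument: image lines of different slope would meet at level
    \<open>e'\<close>, in the point with coordinates \<open>s\<close> and \<open>t\<close>, whereas
    \<open>be m k\<close> and \<open>be m k'\<close> are parallel.\<close>
  have \<sigma>_indep: "\<sigma> m k = \<sigma> m k'" if F: "m \<in> F" "k \<in> F" "k' \<in> F" for m k k'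
  proof (rule ccontr)
    assume ne: "\<sigma> m k \<noteq> \<sigma> m k'"
    define s where "s = (\<eta> m k - \<eta> m k') / (\<sigma> m k - \<sigma> m k')"
    define t where "t = s * \<sigma> m k - \<eta> m k"
    have st: "s \<in> F'" "t \<in> F'"
      using in_F' F F'_closed by (simp_all add: s_def t_def)
    have "s * (\<sigma> m k - \<sigma> m k') = \<eta> m k - \<eta> m k'"
      using ne by (simp add: s_def)
    then have t': "t = s * \<sigma> m k' - \<eta> m k'"
      by (simp add: t_def algebra_simps)
    let ?a = "lo' (\<lambda>i. if i = e' then s else 0) (\<lambda>i. if i = (e', e') then t else 0)"
    have a: "?a \<in> L'" "X' ?a = (\<lambda>i. if i = e' then s else 0)" "Y' ?a = (\<lambda>i. if i = (e', e') then t else 0)"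
      using st by (simp_all add: B.lo_in B.X_lo B.Y_lo unit')
    have inca: "B.inc ?a (g (be m u))" if u: "u \<in> F" "t = s * \<sigma> m u - \<eta> m u" for u
      unfolding B.inc_def
    proof (intro allI impI)
      fix f h assume T: "(f, h) \<in> A.T"
      show "Y' ?a (f, h) + Y' (g (be m u)) (f, h) = X' (g (be m u)) f * X' ?a h"
      proof (cases "(f, h) = (e', e')")
        case True
        then show ?thesis using u by (simp add: a \<sigma>_def \<eta>_def)
      next
        case False
        then have "Y' (g (be m u)) (f, h) = 0"
          using upperY[OF F(1) u(1)] by blast
        moreover have "X' (g (be m u)) f * X' ?a h = 0"
        proof (rule ccontr)
          assume "X' (g (be m u)) f * X' ?a h \<noteq> 0"
          then have "h = e'" "(e', f) \<in> Z"
            using upper[OF F(1) u(1)] by (auto simp: a split: if_splits)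
          then show False
            using T False A.le_antisym by (auto simp: A.T_iff)
        qed
        ultimately show ?thesis using False by (auto simp: a)
      qed
    qed
    obtain a' where a': "a' \<in> L" "g a' = ?a"
      using iso_surj(1)[OF iso a(1)] by blast
    have "A.inc a' (be m k)" "A.inc a' (be m k')"
      using inca[OF F(2)] inca[OF F(3)] t' g_in(3)[OF a'(1)] a'(2) F by (simp_all add: t_def be)
    then have "Y a' (e, e) + Y (be m k) (e, e) = X (be m k) e * X a' e"
      "Y a' (e, e) + Y (be m k') (e, e) = X (be m k') e * X a' e"
      using eeT unfolding A.inc_def by blast+
    then have "k = k'" using F by (simp add: be)
    then show False using ne by simp
  qed
  have zero: "\<tau> 0 0 = 0" "\<gamma> 0 0 = 0" "\<sigma> 0 0 = 0" "\<eta> 0 0 = 0"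
    by (simp_all add: \<tau>_def \<gamma>_def \<sigma>_def \<eta>_def al_zero be_zero base B.lo0_coord B.up0_coord)
  have \<tau>0: "\<tau> 0 t = 0" if "t \<in> F" for t
    using \<tau>_indep[of 0 t 0] that zero F_closed by simp
  have \<sigma>0: "\<sigma> 0 t = 0" if "t \<in> F" for t
    using \<sigma>_indep[of 0 t 0] that zero F_closed by simp
  \<comment> \<open>The image of the vertical axis. Horizontal lines carry its ordinates to all
    points, and the points of the axis carry them to all lines.\<close>
  define G where "G t = \<gamma> 0 t" for t
  have \<gamma>: "\<gamma> s t = G t" if "s \<in> F" "t \<in> F" for s t
    using inc[of s t 0 "- t"] inc[of 0 t 0 "- t"] \<sigma>0[of "- t"] that F_closed by (simp add: G_def)
  have \<eta>: "\<eta> m k = - G (- k)" if "m \<in> F" "k \<in> F" for m k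
    using inc[of 0 "- k" m k] \<tau>0[of "- k"] that F_closed by (simp add: G_def)
  \<comment> \<open>The line of slope \<open>m\<close> through \<open>(s, t)\<close> meets the axis
    at \<open>t - m * s\<close>. Taking \<open>t = m * s\<close> gives the product law, slope
    \<open>1\<close> additivity.\<close>
  have main: "G t - G (t - m * s) = \<sigma> m 0 * \<tau> s 0" if F: "s \<in> F" "t \<in> F" "m \<in> F" for s t m
  proof -
    have k: "m * s - t \<in> F" using F F_closed by simp
    have "\<gamma> s t + \<eta> m (m * s - t) = \<sigma> m (m * s - t) * \<tau> s t"
      using F k by (intro inc) auto
    moreover have "\<sigma> m (m * s - t) = \<sigma> m 0" "\<tau> s t = \<tau> s 0"
      using \<sigma>_indep[OF F(3) k] \<tau>_indep[OF F(1,2)] F_closed by auto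
    ultimately show ?thesis
      using \<gamma>[OF F(1,2)] \<eta>[OF F(3) k] by simp
  qed
  have G0: "G 0 = 0" by (simp add: G_def zero)
  have mult: "G (m * s) = \<sigma> m 0 * \<tau> s 0" if "s \<in> F" "m \<in> F" for s m
    using main[of s "m * s" m] that F_closed G0 by simp
  show ?thesis
  proof
    show "G x \<in> F'" if "x \<in> F" for x
      using in_F'(2)[of 0 x] that F_closed by (simp add: G_def)
    show "G (x + y) = G x + G y" if "x \<in> F" "y \<in> F" for x y
      using main[of y "x + y" 1] mult[of y 1] that F_closed by simp
    show "G x * G y = G (x * y) * G 1" if "x \<in> F" "y \<in> F" for x y
      using mult[of 1 x] mult[of y 1] mult[of y x] mult[of 1 1] that F_closed by simp
    have "good e' 0 0 0 0"
      using good F_closed by simp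
    then have "greatest_diff (X' (g (al 1 0))) (X' (g (al 0 0))) e'"
      "least_diff (X' (g (be 1 0))) (X' (g (be 0 0))) e'"
      unfolding good_def using F_closed by auto
    then have "\<tau> 1 0 \<noteq> \<tau> 0 0" "\<sigma> 1 0 \<noteq> \<sigma> 0 0"
      by (simp_all add: greatest_diff_def least_diff_def \<tau>_def \<sigma>_def)
    then show "G 1 \<noteq> 0"
      using mult[of 1 1] F_closed zero by simp
  qed
qed

end

end

section \<open>Inclusion of the fields\<close>

text \<open>Flag transitivity of the target lets the isomorphism be normalised to match the base
  flags. The homomorphism into \<open>F'\<close> that it induces is the identity by
  \<open>field_hom_eq_id\<close>, so each element of \<open>F\<close> is one of
  \<open>F'\<close>.\<close>

lemma subfield_of_iso:
  assumes "A.M \<cong>\<^sub>o B.M"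
  shows "F \<subseteq> F'"
proof -
  obtain g0 where g0: "order_iso g0 A.M B.M"
    using assms by (auto simp: order_isomorphic_def)
  have "g0 A.lo0 \<in> L'" "g0 A.up0 \<in> U'" "B.inc (g0 A.lo0) (g0 A.up0)"
    using iso_in[OF g0] A.lo0_L A.up0_U A.inc_lo0_up0 by simp_all
  then obtain h where h: "order_iso h B.M B.M" "h (g0 A.lo0) = B.lo0" "h (g0 A.up0) = B.up0"
    by (rule B.aut_flag)
  have g: "order_iso (h \<circ> g0) A.M B.M" "(h \<circ> g0) A.lo0 = B.lo0" "(h \<circ> g0) A.up0 = B.up0"
    using order_iso_compose[OF g0 h(1)] h by simp_all
  obtain e where "e \<in> C" using A.C_nonempty by blast
  then obtain G where G: "\<And>x. x \<in> F \<Longrightarrow> G x \<in> F'" "G 1 \<noteq> 0"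
    "\<And>x y. x \<in> F \<Longrightarrow> y \<in> F \<Longrightarrow> G (x + y) = G x + G y"
    "\<And>x y. x \<in> F \<Longrightarrow> y \<in> F \<Longrightarrow> G x * G y = G (x * y) * G 1"
    using coordinate_hom[OF g(1) _ g(2,3)] by metis
  have "G x / G 1 = x" if "x \<in> F" for x
    by (rule field_hom_eq_id[OF A.F _ _ _ that]) (use G in \<open>simp_all add: field_simps\<close>)
  then show ?thesis
    using G(1) field_divide[OF B.F] field_one[OF A.F] by (metis subsetI)
qed

end

subsection \<open>The orders \<open>\<int>\<^sup>\<alpha>\<close>, \<open>\<rat>.\<int>\<^sup>\<alpha>\<close> and \<open>\<rat>.2\<close>\<close>

definition transitive_on :: "'z rel \<Rightarrow> 'z set \<Rightarrow> bool" where
  "transitive_on Z C \<longleftrightarrow> (\<forall>e\<in>C. \<forall>f\<in>C.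
     \<exists>p. bij p \<and> (\<forall>x y. (p x, p y) \<in> Z \<longleftrightarrow> (x, y) \<in> Z) \<and> (\<forall>x. p x \<in> C \<longleftrightarrow> x \<in> C) \<and> p e = f)"

text \<open>\<open>s\<close> is a successor function on \<open>Field Z\<close>. This is the case in
  which \<open>C\<close> can be everything; it contains the integer powers and is inherited by their
  rational multiples.\<close>

definition discrete_homogeneous :: "'z rel \<Rightarrow> ('z \<Rightarrow> 'z) \<Rightarrow> bool" where
  "discrete_homogeneous Z s \<longleftrightarrow> Linear_order Z \<and> countable (Field Z) \<and> Field Z \<noteq> {} \<and>
     (\<forall>z\<in>Field Z. (z, s z) \<in> Z \<and> s z \<noteq> z \<and> (\<forall>w. (z, w) \<in> Z \<longrightarrow> z \<noteq> w \<longrightarrow> (s z, w) \<in> Z) \<and>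
       (\<exists>w. (w, z) \<in> Z \<and> w \<noteq> z)) \<and> transitive_on Z (Field Z)"

text \<open>All points are branching levels, with \<open>s e\<close> the level just above
  \<open>e\<close>; in \<open>between\<close> the lower end \<open>z\<close> itself serves as the
  index.\<close>

lemma branching_discrete_homogeneous:
  assumes "discrete_homogeneous Z s"
  shows "branching_order Z (Field Z)"
proof -
  have Z: "Linear_order Z" and s: "\<And>z. z \<in> Field Z \<Longrightarrow> (z, s z) \<in> Z \<and> s z \<noteq> z"
    "\<And>z w. z \<in> Field Z \<Longrightarrow> (z, w) \<in> Z \<Longrightarrow> z \<noteq> w \<Longrightarrow> (s z, w) \<in> Z"
    and below: "\<And>z. z \<in> Field Z \<Longrightarrow> \<exists>w. (w, z) \<in> Z \<and> w \<noteq> z"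
    and tr: "transitive_on Z (Field Z)" and cnt: "countable (Field Z)" "Field Z \<noteq> {}"
    using assms unfolding discrete_homogeneous_def by blast+
  have ref: "(z, z) \<in> Z" if "z \<in> Field Z" for z
    using Z that unfolding order_on_defs by (auto dest: refl_onD)
  have asym: "x = y" if "(x, y) \<in> Z" "(y, x) \<in> Z" for x y
    using Z that unfolding order_on_defs by (auto dest: antisymD)
  have tot: "(x, y) \<in> Z \<or> (y, x) \<in> Z" if "x \<in> Field Z" "y \<in> Field Z" "x \<noteq> y" for x y
    using Z that unfolding order_on_defs total_on_def by blast
  let ?J = "\<lambda>e z. (e, z) \<in> Z \<and> e \<noteq> z \<and> (\<forall>f\<in>Field Z. (f, z) \<in> Z \<and> f \<noteq> z \<longrightarrow> (f, e) \<in> Z)"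
  have jump: "?J e (s e)" if e: "e \<in> Field Z" for e
  proof -
    have "(f, e) \<in> Z" if f: "f \<in> Field Z" "(f, s e) \<in> Z" "f \<noteq> s e" for f
    proof (rule ccontr)
      assume n: "(f, e) \<notin> Z"
      then have "(e, f) \<in> Z" "e \<noteq> f"
        using tot[OF e f(1)] ref[OF e] by auto
      then have "(s e, f) \<in> Z"
        using s(2)[OF e] by blast
      then show False using asym f(2,3) by blast
    qed
    then show ?thesis using s(1)[OF e] by auto
  qed
  show ?thesis
  proof
    show "\<exists>e\<in>Field Z. (z, e) \<in> Z \<and> (e, w) \<in> Z \<and> e \<noteq> w" if "(z, w) \<in> Z" "z \<noteq> w" for z w
      using that ref[of z] by (intro bexI[of _ z]) (auto simp: Field_def)
    show "\<exists>z. ?J e z" if "e \<in> Field Z" for e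
      using jump[OF that] by blast
    show "\<exists>w. (z, w) \<in> Z \<and> w \<noteq> z" if "z \<in> Field Z" for z
      using s(1)[OF that] by blast
  qed (use Z cnt below tr in \<open>auto simp: transitive_on_def\<close>)
qed

lemma relation_of_Field: "(\<And>x. x \<in> S \<Longrightarrow> P x x) \<Longrightarrow> Field (relation_of P S) = S"
  by (auto simp: Field_def relation_of_def)

lemma countable_int_power_carrier:
  assumes "countable (Field \<alpha>)"
  shows "countable (int_power_carrier \<alpha>)"
proof -
  have "(\<lambda>f i. real_of_int (f i)) ` int_power_carrier \<alpha> \<subseteq> finsupp (Field \<alpha>) \<int>"
    by (auto simp: int_power_carrier_def finsupp_def)
  then have "countable ((\<lambda>f i. real_of_int (f i)) ` int_power_carrier \<alpha>)"
    by (rule countable_subset) (simp add: countable_finsupp assms countable_int)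
  moreover have "inj_on (\<lambda>f i. real_of_int (f i)) (int_power_carrier \<alpha>)"
    by (auto simp: inj_on_def fun_eq_iff)
  ultimately show ?thesis
    by (rule countable_image_inj_on)
qed

section \<open>Powers of the integers\<close>

context
  fixes \<alpha> :: "'a rel"
  assumes \<alpha>: "Well_order \<alpha>" and ne: "Field \<alpha> \<noteq> {}"
begin

lemma well_linear: "Linear_order \<alpha>"
  using \<alpha> by (simp add: well_order_on_def)

lemma well_trans: "(x, y) \<in> \<alpha> \<Longrightarrow> (y, z) \<in> \<alpha> \<Longrightarrow> (x, z) \<in> \<alpha>"
  and well_antisym: "(x, y) \<in> \<alpha> \<Longrightarrow> (y, x) \<in> \<alpha> \<Longrightarrow> x = y"
  and well_refl: "x \<in> Field \<alpha> \<Longrightarrow> (x, x) \<in> \<alpha>"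
  and well_total: "x \<in> Field \<alpha> \<Longrightarrow> y \<in> Field \<alpha> \<Longrightarrow> (x, y) \<in> \<alpha> \<or> (y, x) \<in> \<alpha>"
  using well_linear unfolding order_on_defs
  by (auto dest: transD antisymD refl_onD simp: total_on_def) (metis refl_onD)

lemma ex_well_least: "\<exists>l\<in>Field \<alpha>. \<forall>x\<in>Field \<alpha>. (l, x) \<in> \<alpha>"
proof -
  have "wf (\<alpha> - Id)"
    using \<alpha> by (simp add: well_order_on_def)
  then obtain z where z: "z \<in> Field \<alpha>" "\<And>y. (y, z) \<in> \<alpha> - Id \<Longrightarrow> y \<notin> Field \<alpha>"
    using ne by (metis ex_in_conv wfE_min)
  then have "(z, x) \<in> \<alpha>" if "x \<in> Field \<alpha>" for x
    using well_total[OF z(1) that] that by blast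
  then show ?thesis using z(1) by blast
qed

lemma carrier_diff: "f \<in> int_power_carrier \<alpha> \<Longrightarrow> g \<in> int_power_carrier \<alpha> \<Longrightarrow>
    finite {i. f i \<noteq> g i} \<and> {i. f i \<noteq> g i} \<subseteq> Field \<alpha>"
proof -
  assume f: "f \<in> int_power_carrier \<alpha>" and g: "g \<in> int_power_carrier \<alpha>"
  have "{i. f i \<noteq> g i} \<subseteq> {i. f i \<noteq> 0} \<union> {i. g i \<noteq> 0}" by auto
  moreover have "finite ({i. f i \<noteq> 0} \<union> {i. g i \<noteq> 0})" "{i. f i \<noteq> 0} \<union> {i. g i \<noteq> 0} \<subseteq> Field \<alpha>"
    using f g by (auto simp: int_power_carrier_def)
  ultimately show ?thesis
    using finite_subset subset_trans by blast
qed

lemma less_total: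
  assumes "f \<in> int_power_carrier \<alpha>" "g \<in> int_power_carrier \<alpha>" "f \<noteq> g"
  shows "int_power_less \<alpha> f g \<or> int_power_less \<alpha> g f"
proof -
  have "{i. f i \<noteq> g i} \<noteq> {}" using assms(3) by auto
  then obtain e where "f e \<noteq> g e" "\<And>i. f i \<noteq> g i \<Longrightarrow> (i, e) \<in> \<alpha>"
    using linear_order_ex_greatest[OF well_linear, of "{i. f i \<noteq> g i}"] carrier_diff[OF assms(1,2)] by auto
  then show ?thesis
    unfolding int_power_less_def by (metis linorder_neq_iff)
qed

lemma less_antisym: "int_power_less \<alpha> f g \<Longrightarrow> int_power_less \<alpha> g f \<Longrightarrow> False"
  unfolding int_power_less_def using well_antisym by (metis order_less_asym)

lemma less_trans:
  assumes "int_power_less \<alpha> f g" "int_power_less \<alpha> g h"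
  shows "int_power_less \<alpha> f h"
proof -
  obtain b where b: "f b < g b" "\<And>i. f i \<noteq> g i \<Longrightarrow> (i, b) \<in> \<alpha>"
    using assms(1) unfolding int_power_less_def by blast
  obtain c where c: "g c < h c" "\<And>i. g i \<noteq> h i \<Longrightarrow> (i, c) \<in> \<alpha>"
    using assms(2) unfolding int_power_less_def by blast
  have bb: "(b, b) \<in> \<alpha>" and cc: "(c, c) \<in> \<alpha>"
    using b c by force+
  then consider "b = c" | "(b, c) \<in> \<alpha>" "b \<noteq> c" | "(c, b) \<in> \<alpha>" "b \<noteq> c"
    using well_total[of b c] by (auto simp: Field_def)
  then show ?thesis
  proof cases
    case 1
    then have "f b < h b" using b(1) c(1) by simp
    moreover have "(i, b) \<in> \<alpha>" if "f i \<noteq> h i" for i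
      using b(2)[of i] c(2)[of i] that 1 by metis
    ultimately show ?thesis unfolding int_power_less_def by (metis order_less_irrefl)
  next
    case 2
    then have "f c = g c" using b(2)[of c] well_antisym by blast
    then have "f c < h c" using c(1) by simp
    moreover have "(i, c) \<in> \<alpha>" if "f i \<noteq> h i" for i
      using b(2)[of i] c(2)[of i] that well_trans[OF _ 2(1)] by metis
    ultimately show ?thesis unfolding int_power_less_def by (metis order_less_irrefl)
  next
    case 3
    then have "g b = h b" using c(2)[of b] well_antisym by blast
    then have "f b < h b" using b(1) by simp
    moreover have "(i, b) \<in> \<alpha>" if "f i \<noteq> h i" for i
      using b(2)[of i] c(2)[of i] that well_trans[OF _ 3(1)] by metis
    ultimately show ?thesis unfolding int_power_less_def by (metis order_less_irrefl)
  qed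
qed

lemma Field_int_power: "Field (int_power \<alpha>) = int_power_carrier \<alpha>"
  unfolding int_power_def by (rule relation_of_Field) simp

lemma int_power_iff: "(f, g) \<in> int_power \<alpha> \<longleftrightarrow> f \<in> int_power_carrier \<alpha> \<and> g \<in> int_power_carrier \<alpha> \<and>
    (f = g \<or> int_power_less \<alpha> f g)"
  by (auto simp: int_power_def relation_of_def)

lemma Linear_order_int_power: "Linear_order (int_power \<alpha>)"
  unfolding order_on_defs Field_int_power
proof (intro conjI)
  show "int_power \<alpha> \<subseteq> int_power_carrier \<alpha> \<times> int_power_carrier \<alpha>"
    by (auto simp: int_power_iff)
  show "refl_on (int_power_carrier \<alpha>) (int_power \<alpha>)"
    by (rule refl_onI) (simp add: int_power_iff)
  show "trans (int_power \<alpha>)"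
    by (rule transI) (use less_trans in \<open>metis int_power_iff\<close>)
  show "antisym (int_power \<alpha>)"
    by (rule antisymI) (use less_antisym in \<open>metis int_power_iff\<close>)
  show "total_on (int_power_carrier \<alpha>) (int_power \<alpha>)"
    unfolding total_on_def using less_total by (metis int_power_iff)
qed

lemma carrier_update: "f \<in> int_power_carrier \<alpha> \<Longrightarrow> i \<in> Field \<alpha> \<Longrightarrow> f(i := c) \<in> int_power_carrier \<alpha>"
proof -
  assume f: "f \<in> int_power_carrier \<alpha>" and i: "i \<in> Field \<alpha>"
  have "{j. (f(i := c)) j \<noteq> 0} \<subseteq> insert i {j. f j \<noteq> 0}" by auto
  then show ?thesis
    using f i finite_subset[of _ "insert i {j. f j \<noteq> 0}"] unfolding int_power_carrier_def by blast
qed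

lemma carrier_add: "f \<in> int_power_carrier \<alpha> \<Longrightarrow> g \<in> int_power_carrier \<alpha> \<Longrightarrow> (\<lambda>i. f i + g i) \<in> int_power_carrier \<alpha>"
  and carrier_minus: "f \<in> int_power_carrier \<alpha> \<Longrightarrow> g \<in> int_power_carrier \<alpha> \<Longrightarrow> (\<lambda>i. f i - g i) \<in> int_power_carrier \<alpha>"
proof -
  assume f: "f \<in> int_power_carrier \<alpha>" and g: "g \<in> int_power_carrier \<alpha>"
  let ?S = "{i. f i \<noteq> 0} \<union> {i. g i \<noteq> 0}"
  have S: "finite ?S" "?S \<subseteq> Field \<alpha>" using f g by (auto simp: int_power_carrier_def)
  have "{i. f i + g i \<noteq> 0} \<subseteq> ?S" "{i. f i - g i \<noteq> 0} \<subseteq> ?S" by auto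
  then show "(\<lambda>i. f i + g i) \<in> int_power_carrier \<alpha>" "(\<lambda>i. f i - g i) \<in> int_power_carrier \<alpha>"
    using S finite_subset unfolding int_power_carrier_def by blast+
qed

text \<open>Translation by \<open>g - f\<close> is defined on all functions, hence a bijection of
  the whole type, and it preserves the carrier because the latter is a group.\<close>

lemma transitive_int_power: "transitive_on (int_power \<alpha>) (int_power_carrier \<alpha>)"
  unfolding transitive_on_def
proof (intro ballI)
  fix f g assume f: "f \<in> int_power_carrier \<alpha>" and g: "g \<in> int_power_carrier \<alpha>"
  let ?d = "\<lambda>i. g i - f i"
  let ?p = "\<lambda>h i. h i + ?d i"
  have d: "?d \<in> int_power_carrier \<alpha>" using carrier_minus f g by blast
  have "bij ?p"
    by (rule bij_betw_byWitness[of _ "\<lambda>h i. h i - ?d i"]) auto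
  moreover have mem: "?p h \<in> int_power_carrier \<alpha> \<longleftrightarrow> h \<in> int_power_carrier \<alpha>" for h
    using carrier_add[OF _ d, of h] carrier_minus[OF _ d, of "?p h"] by auto
  moreover have "(?p x, ?p y) \<in> int_power \<alpha> \<longleftrightarrow> (x, y) \<in> int_power \<alpha>" for x y
    unfolding int_power_iff mem by (simp add: int_power_less_def fun_eq_iff)
  moreover have "?p f = g" by auto
  ultimately show "\<exists>p. bij p \<and> (\<forall>x y. (p x, p y) \<in> int_power \<alpha> \<longleftrightarrow> (x, y) \<in> int_power \<alpha>) \<and>
      (\<forall>x. p x \<in> int_power_carrier \<alpha> \<longleftrightarrow> x \<in> int_power_carrier \<alpha>) \<and> p f = g"
    by (intro exI[of _ ?p] conjI allI)
qed

lemma discrete_int_power: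
  assumes cnt: "countable (Field \<alpha>)"
  obtains s where "discrete_homogeneous (int_power \<alpha>) s"
proof -
  obtain l where l: "l \<in> Field \<alpha>" "\<And>x. x \<in> Field \<alpha> \<Longrightarrow> (l, x) \<in> \<alpha>"
    using ex_well_least by blast
  \<comment> \<open>The least index is the least significant digit, where the successor adds one. A
    larger function either differs at that digit alone, and integers are discrete, or wins at a
    higher index regardless of the digit.\<close>
  let ?s = "\<lambda>f. f(l := f l + 1)"
  have less: "int_power_less \<alpha> f (f(l := c))" if "f l < c" for f c
    unfolding int_power_less_def using that well_refl[OF l(1)] by (intro exI[of _ l]) auto
  have less': "int_power_less \<alpha> (f(l := c)) f" if "c < f l" for f c
    unfolding int_power_less_def using that well_refl[OF l(1)] by (intro exI[of _ l]) auto
  have succ: "?s f = g \<or> int_power_less \<alpha> (?s f) g"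
    if fg: "f \<in> int_power_carrier \<alpha>" "g \<in> int_power_carrier \<alpha>" "int_power_less \<alpha> f g" for f g
  proof -
    obtain b where b: "f b < g b" "\<And>i. f i \<noteq> g i \<Longrightarrow> (i, b) \<in> \<alpha>"
      using fg(3) unfolding int_power_less_def by blast
    show ?thesis
    proof (cases "b = l")
      case True
      have "f i = g i" if "i \<noteq> l" for i
      proof (rule ccontr)
        assume "f i \<noteq> g i"
        then have "(i, l) \<in> \<alpha>" using b(2) True by blast
        then show False using l(2)[of i] well_antisym that by (auto simp: Field_def)
      qed
      then have g: "g = f(l := g l)" by auto
      show ?thesis
      proof (cases "g l = f l + 1")
        case True
        then show ?thesis using g by metis
      next
        case False
        then have "?s f l < g l" using b(1) \<open>b = l\<close> by simp
        then have "int_power_less \<alpha> (?s f) ((?s f)(l := g l))" by (rule less)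
        then show ?thesis using g by simp
      qed
    next
      case False
      have "b \<in> Field \<alpha>" using b(2)[of b] b(1) by (auto simp: Field_def)
      then have "(l, b) \<in> \<alpha>" by (rule l(2))
      then have "int_power_less \<alpha> (?s f) g"
        unfolding int_power_less_def using b False by (intro exI[of _ b]) auto
      then show ?thesis by simp
    qed
  qed
  have upd: "f(l := c) \<in> int_power_carrier \<alpha>" if "f \<in> int_power_carrier \<alpha>" for f c
    using that l(1) by (rule carrier_update)
  have "(\<lambda>_. 0) \<in> int_power_carrier \<alpha>" by (simp add: int_power_carrier_def)
  have neq: "f(l := f l + 1) \<noteq> f" "f(l := f l - 1) \<noteq> f" for f :: "'a \<Rightarrow> int"
    by (simp_all add: fun_upd_idem_iff)
  have "discrete_homogeneous (int_power \<alpha>) ?s"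
    unfolding discrete_homogeneous_def Field_int_power
  proof (intro conjI ballI allI impI)
    fix f assume f: "f \<in> int_power_carrier \<alpha>"
    show "(f, ?s f) \<in> int_power \<alpha>" "?s f \<noteq> f"
      using f upd[OF f] less neq by (auto simp: int_power_iff)
    show "(?s f, g) \<in> int_power \<alpha>" if "(f, g) \<in> int_power \<alpha>" "f \<noteq> g" for g
      using that succ[of f g] upd[OF f] by (auto simp: int_power_iff)
    show "\<exists>w. (w, f) \<in> int_power \<alpha> \<and> w \<noteq> f"
      using f upd[OF f] less'[of "f l - 1" f] neq(2) by (intro exI[of _ "f(l := f l - 1)"]) (auto simp: int_power_iff)
  qed (use Linear_order_int_power[unfolded Field_int_power] countable_int_power_carrier[OF cnt] transitive_int_power
      \<open>(\<lambda>_. 0) \<in> int_power_carrier \<alpha>\<close> in auto)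
  then show ?thesis using that by blast
qed

end

section \<open>Rational multiples\<close>

lemma lex_rat_iff: "((q, x), (r, y)) \<in> lex_product rat_order B \<longleftrightarrow>
    x \<in> Field B \<and> y \<in> Field B \<and> (q < r \<or> q = r \<and> (x, y) \<in> B)"
proof -
  have "Field rat_order = UNIV" unfolding rat_order_def by (rule relation_of_Field) simp
  then show ?thesis
    by (auto simp: lex_product_def rat_order_def relation_of_def)
qed

lemma Field_lex_rat:
  assumes "Refl B"
  shows "Field (lex_product rat_order B) = UNIV \<times> Field B"
proof -
  have "((q, x), (q, x)) \<in> lex_product rat_order B" if "x \<in> Field B" for q x
    using that assms by (auto simp: lex_rat_iff dest: refl_onD)
  moreover have "snd p \<in> Field B" if p: "p \<in> Field (lex_product rat_order B)" for p
  proof -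
    obtain p' where "(p, p') \<in> lex_product rat_order B \<or> (p', p) \<in> lex_product rat_order B"
      using p unfolding Field_def Domain_iff Range_iff Un_iff by blast
    then show ?thesis by (cases p; cases p') (auto simp: lex_rat_iff)
  qed
  ultimately show ?thesis
    by (auto intro: FieldI1)
qed

lemma Linear_order_lex_rat:
  assumes B: "Linear_order B"
  shows "Linear_order (lex_product rat_order B)"
proof -
  have B': "refl_on (Field B) B" "trans B" "antisym B" "total_on (Field B) B"
    using B by (auto simp: order_on_defs)
  show ?thesis
    unfolding order_on_defs Field_lex_rat[OF B'(1)]
  proof (intro conjI)
    show "lex_product rat_order B \<subseteq> (UNIV \<times> Field B) \<times> UNIV \<times> Field B"
      by (auto simp: lex_rat_iff)
    show "refl_on (UNIV \<times> Field B) (lex_product rat_order B)"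
      using B'(1) by (auto simp: refl_on_def lex_rat_iff)
    show "trans (lex_product rat_order B)"
      using B'(2) by (auto simp: trans_def lex_rat_iff)
    show "antisym (lex_product rat_order B)"
      using B'(3) by (auto simp: antisym_def lex_rat_iff)
    show "total_on (UNIV \<times> Field B) (lex_product rat_order B)"
      using B'(4) B'(1) by (auto simp: total_on_def lex_rat_iff refl_on_def)
  qed
qed

lemma transitive_lex_rat:
  assumes "transitive_on B S" "S \<subseteq> Field B" "\<And>x. x \<in> Field B \<Longrightarrow> (x, x) \<in> B"
  shows "transitive_on (lex_product rat_order B) (UNIV \<times> S)"
  unfolding transitive_on_def
proof (intro ballI)
  fix e f assume "e \<in> (UNIV :: rat set) \<times> S" "f \<in> (UNIV :: rat set) \<times> S"
  then obtain q x r y where ef: "e = (q, x)" "f = (r, y)" "x \<in> S" "y \<in> S" by auto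
  obtain p where p: "bij p" "\<And>x y. (p x, p y) \<in> B \<longleftrightarrow> (x, y) \<in> B" "\<And>x. p x \<in> S \<longleftrightarrow> x \<in> S" "p x = y"
    using assms(1) ef(3,4) unfolding transitive_on_def by blast
  have Fld: "p x \<in> Field B \<longleftrightarrow> x \<in> Field B" for x
    using assms(3) p(2)[of x x] by (metis FieldI1)
  show "\<exists>p. bij p \<and> (\<forall>x y. (p x, p y) \<in> lex_product rat_order B \<longleftrightarrow> (x, y) \<in> lex_product rat_order B) \<and>
      (\<forall>x. p x \<in> UNIV \<times> S \<longleftrightarrow> x \<in> UNIV \<times> S) \<and> p e = f"
  proof (intro exI conjI allI)
    have "bij (\<lambda>t::rat. t + (r - q))"
      by (rule bij_betw_byWitness[of _ "\<lambda>t. t - (r - q)"]) auto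
    then show "bij (map_prod (\<lambda>t. t + (r - q)) p)"
      using p(1) bij_betw_map_prod[of "\<lambda>t. t + (r - q)" UNIV UNIV p UNIV UNIV] by simp
    show "(map_prod (\<lambda>t. t + (r - q)) p x, map_prod (\<lambda>t. t + (r - q)) p y) \<in> lex_product rat_order B \<longleftrightarrow>
      (x, y) \<in> lex_product rat_order B" for x y
      by (cases x; cases y) (simp add: lex_rat_iff p(2) Fld)
    show "map_prod (\<lambda>t. t + (r - q)) p x \<in> UNIV \<times> S \<longleftrightarrow> x \<in> UNIV \<times> S" for x
      by (cases x) (simp add: p(3))
    show "map_prod (\<lambda>t. t + (r - q)) p e = f"
      by (simp add: ef p(4))
  qed
qed

lemma discrete_lex_rat:
  assumes "discrete_homogeneous B s"
  shows "discrete_homogeneous (lex_product rat_order B) (map_prod id s)"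
proof -
  have B: "Linear_order B" and s: "\<And>z. z \<in> Field B \<Longrightarrow> (z, s z) \<in> B \<and> s z \<noteq> z"
    "\<And>z w. z \<in> Field B \<Longrightarrow> (z, w) \<in> B \<Longrightarrow> z \<noteq> w \<Longrightarrow> (s z, w) \<in> B"
    and below: "\<And>z. z \<in> Field B \<Longrightarrow> \<exists>w. (w, z) \<in> B \<and> w \<noteq> z"
    and tr: "transitive_on B (Field B)" and cnt: "countable (Field B)" "Field B \<noteq> {}"
    using assms unfolding discrete_homogeneous_def by blast+
  have B': "refl_on (Field B) B"
    using B by (auto simp: order_on_defs)
  have sF: "s z \<in> Field B" if "z \<in> Field B" for z
    using s(1)[OF that] by (auto simp: Field_def)
  show ?thesis
    unfolding discrete_homogeneous_def Field_lex_rat[OF B']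
  proof (intro conjI ballI allI impI)
    show "linear_order_on (UNIV \<times> Field B) (lex_product rat_order B)"
      by (rule Linear_order_lex_rat[OF B, unfolded Field_lex_rat[OF B']])
    show "transitive_on (lex_product rat_order B) (UNIV \<times> Field B)"
      by (rule transitive_lex_rat[OF tr]) (auto intro: refl_onD[OF B'])
    fix z assume "z \<in> (UNIV :: rat set) \<times> Field B"
    then obtain q x where z: "z = (q, x)" "x \<in> Field B" by auto
    show "(z, map_prod id s z) \<in> lex_product rat_order B" "map_prod id s z \<noteq> z"
      using z s(1) sF by (auto simp: lex_rat_iff)
    show "(map_prod id s z, w) \<in> lex_product rat_order B"
      if "(z, w) \<in> lex_product rat_order B" "z \<noteq> w" for w
      using that z s(2) sF by (cases w) (auto simp: lex_rat_iff)
    obtain w where w: "(w, x) \<in> B" "w \<noteq> x" using below z(2) by blast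
    then show "\<exists>w. (w, z) \<in> lex_product rat_order B \<and> w \<noteq> z"
      using z by (intro exI[of _ "(q, w)"]) (auto simp: lex_rat_iff Field_def)
  qed (use cnt in auto)
qed

lemma two_chain_iff: "(x, y) \<in> two_chain \<longleftrightarrow> x \<le> y"
  by (simp add: two_chain_def relation_of_def)

lemma Field_two_chain: "Field two_chain = UNIV"
  unfolding two_chain_def by (rule relation_of_Field) simp

text \<open>Here \<open>C\<close> consists of the lower points of the pairs. An upper point has no
  immediate successor, the pairs being densely ordered, but it sits directly above its partner.
  Automorphisms do not mix lower and upper points, so transitivity is available on \<open>C\<close>
  only.\<close>

lemma branching_lex_two:
  "branching_order (lex_product rat_order two_chain) (UNIV \<times> {False})"
proof -
  have lin: "Linear_order two_chain"
    unfolding order_on_defs Field_two_chain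
    by (auto simp: refl_on_def trans_def antisym_def total_on_def two_chain_iff)
  then have ref: "Refl two_chain" by (auto simp: order_on_defs)
  note lex = lex_rat_iff[of _ _ _ _ two_chain, unfolded Field_two_chain two_chain_iff, simplified]
  have Fld: "Field (lex_product rat_order two_chain) = UNIV"
    using Field_lex_rat[OF ref] by (simp add: Field_two_chain)
  have tr2: "transitive_on two_chain {False}"
    unfolding transitive_on_def by (auto intro: exI[of _ id])
  have tr: "transitive_on (lex_product rat_order two_chain) (UNIV \<times> {False})"
    by (rule transitive_lex_rat[OF tr2]) (auto simp: Field_two_chain two_chain_iff)
  let ?R = "lex_product rat_order two_chain"
  let ?J = "\<lambda>e z. (e, z) \<in> ?R \<and> e \<noteq> z \<and> (\<forall>f\<in>UNIV \<times> {False}. (f, z) \<in> ?R \<and> f \<noteq> z \<longrightarrow> (f, e) \<in> ?R)"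
  have jump: "?J (q, False) (q, True)" for q
    by (auto simp: lex)
  show ?thesis
  proof
    show "Linear_order (lex_product rat_order two_chain)"
      by (rule Linear_order_lex_rat[OF lin])
    show "\<exists>e\<in>UNIV \<times> {False}. (z, e) \<in> lex_product rat_order two_chain \<and>
        (e, w) \<in> lex_product rat_order two_chain \<and> e \<noteq> w"
      if zw: "(z, w) \<in> lex_product rat_order two_chain" "z \<noteq> w" for z w
    proof -
      obtain q x r y where eq: "z = (q, x)" "w = (r, y)" by (cases z; cases w)
      show ?thesis
      proof (cases "q < r")
        case True
        \<comment> \<open>A pair strictly in between; if both points belong to one pair, the lower
          one serves itself.\<close>
        then obtain t where "q < t" "t < r" using dense by blast
        then show ?thesis by (intro bexI[of _ "(t, False)"]) (auto simp: eq lex)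
      next
        case False
        then have "q = r" "\<not> x" "y" using zw by (auto simp: eq lex)
        then show ?thesis by (intro bexI[of _ "(q, False)"]) (auto simp: eq lex)
      qed
    qed
    show "z \<in> UNIV \<times> {False} \<or> (\<exists>e\<in>UNIV \<times> {False}. ?J e z)"
      for z
    proof (cases z)
      case (Pair q x)
      then show ?thesis using jump[of q] by (cases x) auto
    qed
    show "\<exists>z. ?J e z" if "e \<in> UNIV \<times> {False}" for e
    proof -
      obtain q where "e = (q, False)" using \<open>e \<in> UNIV \<times> {False}\<close> by auto
      then show ?thesis using jump[of q] by blast
    qed
    show "\<exists>w. (w, z) \<in> lex_product rat_order two_chain \<and> w \<noteq> z" for z
      by (cases z) (auto simp: lex intro!: exI[of _ "fst z - 1"])
    show "\<exists>w. (z, w) \<in> lex_product rat_order two_chain \<and> w \<noteq> z" for z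
      by (cases z) (auto simp: lex intro!: exI[of _ "fst z + 1"])
  qed (use tr in \<open>auto simp: Fld transitive_on_def\<close>)
qed

subsection \<open>Realisation on the natural numbers\<close>

context branching_order
begin

text \<open>All data are countable, so every order can live on the natural numbers and the family is
  a set of relations on one type. The boolean keeps minimal and maximal points apart.\<close>

definition codes :: "real set \<Rightarrow> (bool \<times> ('z \<Rightarrow> real) \<times> ('z \<times> 'z \<Rightarrow> real)) set" where
  "codes F = UNIV \<times> finsupp C F \<times> finsupp T F"

definition code :: "real set \<Rightarrow> bool \<Rightarrow> ('z \<Rightarrow> real) \<Rightarrow> ('z \<times> 'z \<Rightarrow> real) \<Rightarrow> nat" where
  "code F i x y = to_nat_on (codes F) (i, x, y)"

definition decode :: "real set \<Rightarrow> nat \<Rightarrow> bool \<times> ('z \<Rightarrow> real) \<times> ('z \<times> 'z \<Rightarrow> real)" where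
  "decode F = from_nat_into (codes F)"

lemma bilinear_order_code:
  assumes F: "sqrt_closed_field F" and cnt: "countable F"
  shows "bilinear_order Z C F (code F False) (code F True)
    (fst \<circ> snd \<circ> decode F) (snd \<circ> snd \<circ> decode F)"
proof -
  have "countable (codes F)"
    by (simp add: codes_def countable_finsupp C_countable countable_T cnt)
  then have dec: "decode F (code F i x y) = (i, x, y)" if "x \<in> finsupp C F" "y \<in> finsupp T F" for i x y
    using that by (simp add: decode_def code_def codes_def)
  then have "fst (decode F (code F i x y)) = i" if "x \<in> finsupp C F" "y \<in> finsupp T F" for i x y
    using that by simp
  then have "code F False x y \<noteq> code F True x' y'"
    if "x \<in> finsupp C F" "y \<in> finsupp T F" "x' \<in> finsupp C F" "y' \<in> finsupp T F" for x y x' y'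
    using that by metis
  then show ?thesis
    by unfold_locales (use F dec in auto)
qed

definition nat_order :: "real set \<Rightarrow> nat rel" where
  "nat_order F = bilinear_order.M Z C F (code F False) (code F True)
    (fst \<circ> snd \<circ> decode F) (snd \<circ> snd \<circ> decode F)"

lemma nat_order_properties:
  assumes "sqrt_closed_field F" "countable F"
  shows "two_level (nat_order F)" "connected_order (nat_order F)" "CS_homogeneous 3 (nat_order F)"
    "has_interval_type (nat_order F) (add_endpoints Z)"
proof -
  note code = bilinear_order_code[OF assms]
  show "two_level (nat_order F)" "connected_order (nat_order F)" "CS_homogeneous 3 (nat_order F)"
    "has_interval_type (nat_order F) (add_endpoints Z)"
    unfolding nat_order_def
    by (rule bilinear_order.two_level_M[OF code] bilinear_order.connected_M[OF code]
        bilinear_order.CS_homogeneous_M[OF code] bilinear_order.has_interval_type_M[OF code])+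
qed

lemma nat_order_iso_subset:
  assumes "sqrt_closed_field F" "countable F" "sqrt_closed_field F'" "countable F'"
    and "nat_order F \<cong>\<^sub>o nat_order F'"
  shows "F \<subseteq> F'"
  using bilinear_order_pair.subfield_of_iso[OF bilinear_order_pair.intro[OF
    bilinear_order_code[OF assms(1,2)] bilinear_order_code[OF assms(3,4)]]] assms(5)
  unfolding nat_order_def by blast

text \<open>Isomorphism is symmetric, so isomorphic orders give inclusions of the fields both ways.
  Hence fields with isomorphic orders are equal, and the family inherits the size of the set of
  fields.\<close>

lemma continuum_many:
  "\<exists>\<M> :: nat rel set. \<M> \<approx> (UNIV :: nat set set) \<and>
    (\<forall>M\<in>\<M>. two_level M \<and> connected_order M \<and> CS_homogeneous 3 M \<and>
       has_interval_type M (add_endpoints Z)) \<and> pairwise (\<lambda>M N. \<not> M \<cong>\<^sub>o N) \<M>"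
proof (intro exI conjI)
  let ?S = "range sqrt_closure"
  have S: "sqrt_closed_field F" "countable F" if "F \<in> ?S" for F
    using that sqrt_closed_field_sqrt_closure countable_sqrt_closure by auto
  have iso: "F = F'" if "F \<in> ?S" "F' \<in> ?S" "nat_order F \<cong>\<^sub>o nat_order F'" for F F'
    using nat_order_iso_subset[OF S[OF that(1)] S[OF that(2)] that(3)]
      nat_order_iso_subset[OF S[OF that(2)] S[OF that(1)] order_isomorphic_sym[OF that(3)]]
    by (rule subset_antisym)
  have refl: "M \<cong>\<^sub>o M" for M :: "nat rel"
    unfolding order_isomorphic_def order_iso_def by (auto intro: exI[of _ id])
  have "inj_on nat_order ?S"
    using iso refl by (metis inj_onI)
  then have "nat_order ` ?S \<approx> ?S"
    by (rule inj_on_image_eqpoll_self)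
  then show "nat_order ` ?S \<approx> (UNIV :: nat set set)"
    using range_sqrt_closure_eqpoll eqpoll_trans by blast
  show "\<forall>M\<in>nat_order ` ?S. two_level M \<and> connected_order M \<and> CS_homogeneous 3 M \<and>
      has_interval_type M (add_endpoints Z)"
  proof
    fix M assume "M \<in> nat_order ` ?S"
    then obtain F where "M = nat_order F" "F \<in> ?S" by auto
    then show "two_level M \<and> connected_order M \<and> CS_homogeneous 3 M \<and> has_interval_type M (add_endpoints Z)"
      using nat_order_properties[OF S] by simp
  qed
  show "pairwise (\<lambda>M N. \<not> M \<cong>\<^sub>o N) (nat_order ` ?S)"
  proof (rule pairwiseI)
    fix M N assume "M \<in> nat_order ` ?S" "N \<in> nat_order ` ?S" "M \<noteq> N"
    then obtain F F' where "M = nat_order F" "F \<in> ?S" "N = nat_order F'" "F' \<in> ?S" by auto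
    then show "\<not> M \<cong>\<^sub>o N"
      using iso[of F F'] \<open>M \<noteq> N\<close> by metis
  qed
qed

end

lemma has_interval_type_cong: "has_interval_type M L \<Longrightarrow> L \<cong>\<^sub>o L' \<Longrightarrow> has_interval_type M L'"
  unfolding has_interval_type_def using order_isomorphic_trans by blast

theorem corollary3p17:
  fixes Z :: "'z rel"
  assumes "Linear_order Z"
    and "(\<exists>\<alpha> :: nat rel. Well_order \<alpha> \<and> Field \<alpha> \<noteq> {} \<and>
            (Z \<cong>\<^sub>o int_power \<alpha> \<or> Z \<cong>\<^sub>o lex_product rat_order (int_power \<alpha>)))
         \<or> Z \<cong>\<^sub>o lex_product rat_order two_chain"
  shows "\<exists>\<M> :: nat rel set. \<M> \<approx> (UNIV :: nat set set) \<and>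
           (\<forall>M\<in>\<M>. two_level M \<and> connected_order M \<and> CS_homogeneous 3 M \<and>
                   has_interval_type M (add_endpoints Z)) \<and>
           pairwise (\<lambda>M N. \<not> M \<cong>\<^sub>o N) \<M>"
proof -
  \<comment> \<open>Only the interval type mentions the chain, so a model \<open>B\<close> of
    \<open>Z\<close>, on whichever type, yields the result for \<open>Z\<close>.\<close>
  have transport: ?thesis if "branching_order B C" "Z \<cong>\<^sub>o B" for B :: "'b rel" and C
  proof -
    have "add_endpoints B \<cong>\<^sub>o add_endpoints Z"
      by (rule add_endpoints_cong[OF order_isomorphic_sym[OF that(2)]])
    then show ?thesis
      using branching_order.continuum_many[OF that(1)] has_interval_type_cong by meson
  qed
  show ?thesis
    using assms(2)
  proof (elim disjE exE conjE)
    fix \<alpha> :: "nat rel"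
    assume \<alpha>: "Well_order \<alpha>" "Field \<alpha> \<noteq> {}"
    obtain s where s: "discrete_homogeneous (int_power \<alpha>) s"
      using discrete_int_power[OF \<alpha>] by auto
    show ?thesis if "Z \<cong>\<^sub>o int_power \<alpha>"
      using transport[OF branching_discrete_homogeneous[OF s] that] .
    show ?thesis if "Z \<cong>\<^sub>o lex_product rat_order (int_power \<alpha>)"
      using transport[OF branching_discrete_homogeneous[OF discrete_lex_rat[OF s]] that] .
  next
    assume "Z \<cong>\<^sub>o lex_product rat_order two_chain"
    then show ?thesis
      by (rule transport[OF branching_lex_two])
  qed
qed

end
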